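(* Let $(T^*G,G,\omega,H)$ be a regular point reducible Hamiltonian system on the Lie group $G$, with dynamical vector field $X_H$. Let $\gamma: G\to T^*G$ be a one-form on $G$, let $\lambda=\gamma\circ\pi_G: T^*G\to T^*G$, and let $\varepsilon: T^*G\to T^*G$ be a symplectic map. Put $X_H^\gamma=T\pi_G\circ X_H\circ\gamma$ and $X_H^\varepsilon=T\pi_G\circ X_H\circ\varepsilon$. Let $\mu\in\mathfrak{g}^*$ be a regular value of the momentum map $\mathbf{J}_G$, and assume that $\mathrm{Im}(\gamma)\subset\mathbf{J}_G^{-1}(\mu)$, that $\gamma$ is $G_\mu$-invariant, that $\varepsilon$ is $G_\mu$-equivariant, and that $\varepsilon(\mathbf{J}_G^{-1}(\mu))\subset\mathbf{J}_G^{-1}(\mu)$. Put $\bar\gamma=\pi_\mu\circ\gamma: G\to\mathcal{O}_\mu$, $\bar\lambda=\pi_\mu\circ\lambda:\mathbf{J}_G^{-1}(\mu)\to\mathcal{O}_\mu$ and $\bar\varepsilon=\pi_\mu\circ\varepsilon:\mathbf{J}_G^{-1}(\mu)\to\mathcal{O}_\mu$. Let $X_{h_\mu}$ be the dynamical vector field of the Marsden-Weinstein reduced Hamiltonian system $(\mathcal{O}_\mu,\omega^-_{\mathcal{O}_\mu},h_\mu)$, and $X_{h_\mu\circ\bar\varepsilon}$ the Hamiltonian vector field of the function $h_\mu\circ\bar\varepsilon$ on $T^*G$. Then the following two assertions hold: (i) If $\gamma$ is closed with respect to $T\pi_G: TT^*G\to TG$, then $\bar\gamma$ is a solution of the Type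 I Hamilton-Jacobi equation $T\bar\gamma\circ X_H^\gamma=X_{h_\mu}\circ\bar\gamma$ (an equality of maps $G\to T\mathcal{O}_\mu$). (ii) $\varepsilon$ and $\bar\varepsilon$ satisfy the Type II Hamilton-Jacobi equation $T\bar\gamma\circ X_H^\varepsilon=X_{h_\mu}\circ\bar\varepsilon$ if and only if they satisfy the equation $T\bar\varepsilon\circ X_{h_\mu\circ\bar\varepsilon}=T\bar\lambda\circ X_H\circ\varepsilon$ (equalities of maps $\mathbf{J}_G^{-1}(\mu)\to T\mathcal{O}_\mu$).
   Context: All manifolds are real, smooth and finite dimensional. $G$ is a Lie group with Lie algebra $\mathfrak{g}$, $\pi_G: T^*G\to G$ is the projection, $\omega$ is the canonical symplectic form on $T^*G$; the Hamiltonian vector field of $f$ is determined by $\mathbf{i}_{X_f}\omega=\mathbf{d}f$. One-forms are identified with sections $\gamma: G\to T^*G$. A symplectic map $\varepsilon$ is a smooth map with $\varepsilon^*\omega=\omega$. $G$ acts on itself by left translation and on $T^*G$ by the cotangent lift, with its $\mathrm{Ad}^*$-equivariant momentum map $\mathbf{J}_G: T^*G\to\mathfrak{g}^*$, $\mathbf{J}_G(\alpha_g)=(T_eR_g)^*\alpha_g$. For $\mu\in\mathfrak{g}^*$ a regular value, $G_\mu=\{g\in G:\mathrm{Ad}_g^*\mu=\mu\}$, and the reduced space $(T^*G)_\mu=\mathbf{J}_G^{-1}(\mu)/G_\mu$, with symplectic form whose pullback to $\mathbf{J}_G^{-1}(\mu)$ is the restriction of $\omega$, is identified with the coadjoint orbit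 $\mathcal{O}_\mu=\{\mathrm{Ad}^*_{g^{-1}}\mu: g\in G\}\subset\mathfrak{g}^*$ equipped with the orbit symplectic form $\omega^-_{\mathcal{O}_\mu}(\nu)(\mathrm{ad}^*_\xi\nu,\mathrm{ad}^*_\eta\nu)=-\langle\nu,[\xi,\eta]\rangle$. Under this identification the projection is $\pi_\mu:\mathbf{J}_G^{-1}(\mu)\to\mathcal{O}_\mu$, $\pi_\mu(\alpha_g)=(T_eL_g)^*\alpha_g$. $(T^*G,G,\omega,H)$ is a regular point reducible Hamiltonian system when $H: T^*G\to\mathbb{R}$ is invariant under the left cotangent lifted $G$-action; the reduced Hamiltonian $h_\mu:\mathcal{O}_\mu\to\mathbb{R}$ is defined by $h_\mu\circ\pi_\mu=H|_{\mathbf{J}_G^{-1}(\mu)}$. The vector field $X_{h_\mu}$ is the Hamiltonian vector field of $h_\mu$ with respect to $\omega^-_{\mathcal{O}_\mu}$, namely $X_{h_\mu}(\nu)=\mathrm{ad}^*_{\delta h_\mu/\delta\nu}\nu$. $G_\mu$-invariance of $\gamma$: $\gamma(g\cdot q)=g\cdot\gamma(q)$ for $g\in G_\mu$, $q\in G$. $G_\mu$-equivariance of $\varepsilon$: $\varepsilon(g\cdot\alpha)=g\cdot\varepsilon(\alpha)$ for $g\in G_\mu$. Definition: $\gamma$ is closed with respect to $T\pi_G$ if $\mathbf{d}\gamma(T\pi_G(v),T\pi_G(w))=0$ for all $v,w\in TT^*G$ (based at a common point). Since $h_\mu\circ\bar\varepsilon=H\circ\varepsilon$ on $\mathbf{J}_G^{-1}(\mu)$,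 the function $h_\mu\circ\bar\varepsilon$ is understood on $T^*G$ as $H\circ\varepsilon$: $X_{h_\mu\circ\bar\varepsilon}$ is the restriction to $\mathbf{J}_G^{-1}(\mu)$ of $X_{H\circ\varepsilon}$, and $T\bar\varepsilon\circ X_{h_\mu\circ\bar\varepsilon}$ means $T\pi_\mu\circ T\varepsilon\circ X_{h_\mu\circ\bar\varepsilon}$ (the vectors $T\varepsilon(X_{H\circ\varepsilon})=X_H\circ\varepsilon$ are tangent to $\mathbf{J}_G^{-1}(\mu)$). Likewise $T\bar\lambda$ means $T\pi_\mu\circ T\lambda$, where $\lambda$ takes values in $\mathrm{Im}(\gamma)\subset\mathbf{J}_G^{-1}(\mu)$. *)

theory Defs
  imports "HOL-Analysis.Analysis" "HOL-Algebra.Group"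
begin

section \<open>Smooth manifolds given by an atlas\<close>

text \<open>
  A function is of class C^k on an open set if it is k times differentiable there with
  continuous iterated directional derivatives (on finite-dimensional spaces this is the usual
  notion).
\<close>

primrec Ck_on :: "nat \<Rightarrow> 'a::real_normed_vector set \<Rightarrow> ('a \<Rightarrow> 'b::real_normed_vector) \<Rightarrow> bool" where
  "Ck_on 0 S f \<longleftrightarrow> continuous_on S f"
| "Ck_on (Suc k) S f \<longleftrightarrow>
     (\<forall>x\<in>S. f differentiable (at x)) \<and> (\<forall>v. Ck_on k S (\<lambda>x. frechet_derivative f (at x) v))"

definition smooth_on :: "'a::real_normed_vector set \<Rightarrow> ('a \<Rightarrow> 'b::real_normed_vector) \<Rightarrow> bool" where
  "smooth_on S f \<longleftrightarrow> open S \<and> (\<forall>k. Ck_on k S f)"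

text \<open>
  A chart is a pair of its domain and its coordinate map.  The model space is a type of class
  \<^class>\<open>real_inner\<close>, required to be finite dimensional in the definition of a manifold; this
  is R^n.  The class \<^class>\<open>euclidean_space\<close> is not used because it excludes n = 0, i.e. discrete
  groups.  The topology of a manifold is the one induced by its atlas.
\<close>

type_synonym ('m, 'e) chart = "'m set \<times> ('m \<Rightarrow> 'e)"

definition chart_inv :: "('m, 'e) chart \<Rightarrow> 'e \<Rightarrow> 'm" where
  "chart_inv c = inv_into (fst c) (snd c)"

definition is_chart :: "('m, 'e::real_inner) chart \<Rightarrow> bool" where
  "is_chart c \<longleftrightarrow> inj_on (snd c) (fst c) \<and> open (snd c ` fst c)"

definition mcarrier :: "('m, 'e) chart set \<Rightarrow> 'm set" where
  "mcarrier A = (\<Union>c\<in>A. fst c)"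

definition mtopology :: "('m, 'e::real_inner) chart set \<Rightarrow> 'm topology" where
  "mtopology A = topology (\<lambda>W. W \<subseteq> mcarrier A \<and> (\<forall>c\<in>A. open (snd c ` (W \<inter> fst c))))"

definition smooth_atlas :: "('m, 'e::real_inner) chart set \<Rightarrow> bool" where
  "smooth_atlas A \<longleftrightarrow> (\<forall>c\<in>A. is_chart c) \<and>
     (\<forall>c\<in>A. \<forall>d\<in>A. smooth_on (snd c ` (fst c \<inter> fst d)) (snd d \<circ> chart_inv c))"

definition smooth_manifold :: "('m, 'e::real_inner) chart set \<Rightarrow> bool" where
  "smooth_manifold A \<longleftrightarrow>
     (\<exists>B::'e set. finite B \<and> span B = UNIV) \<and> smooth_atlas A \<and>
     Hausdorff_space (mtopology A) \<and> second_countable (mtopology A)"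

definition smooth_map ::
  "('m, 'e::real_inner) chart set \<Rightarrow> ('n, 'f::real_inner) chart set \<Rightarrow> ('m \<Rightarrow> 'n) \<Rightarrow> bool" where
  "smooth_map A B f \<longleftrightarrow> continuous_map (mtopology A) (mtopology B) f \<and>
     (\<forall>c\<in>A. \<forall>d\<in>B. smooth_on (snd c ` (fst c \<inter> f -` fst d)) (snd d \<circ> f \<circ> chart_inv c))"

definition real_atlas :: "(real, real) chart set" where
  "real_atlas = {(UNIV, id)}"

definition prod_atlas ::
  "('m, 'e) chart set \<Rightarrow> ('n, 'f) chart set \<Rightarrow> ('m \<times> 'n, 'e \<times> 'f) chart set" where
  "prod_atlas A B = {(fst c \<times> fst d, map_prod (snd c) (snd d)) | c d. c \<in> A \<and> d \<in> B}"


section \<open>Tangent and cotangent spaces\<close>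

text \<open>
  A tangent vector at p is the family of its coordinate vectors in all the charts of the atlas
  around p, related by the derivatives of the transition maps.  Families vanish on all other
  pairs, and covectors vanish outside the tangent space, so that equality of vectors and of
  covectors is equality of functions.
\<close>

type_synonym ('m, 'e) tvec = "('m, 'e) chart \<Rightarrow> 'e"
type_synonym ('m, 'e) covec = "('m, 'e) tvec \<Rightarrow> real"

definition charts_at :: "('m, 'e) chart set \<Rightarrow> 'm \<Rightarrow> ('m, 'e) chart set" where
  "charts_at A p = {c \<in> A. p \<in> fst c}"

definition chart_at :: "('m, 'e) chart set \<Rightarrow> 'm \<Rightarrow> ('m, 'e) chart" where
  "chart_at A p = (SOME c. c \<in> charts_at A p)"

definition tangent_space :: "('m, 'e::real_inner) chart set \<Rightarrow> 'm \<Rightarrow> ('m, 'e) tvec set" where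
  "tangent_space A p =
     {v. (\<forall>c\<in>charts_at A p. \<forall>d\<in>charts_at A p.
            v d = frechet_derivative (snd d \<circ> chart_inv c) (at (snd c p)) (v c)) \<and>
         (\<forall>c. c \<notin> charts_at A p \<longrightarrow> v c = 0)}"

text \<open>The tangent vector at p whose coordinate vector in the chart c is u.\<close>

definition coord_tvec ::
  "('m, 'e::real_inner) chart set \<Rightarrow> ('m, 'e) chart \<Rightarrow> 'm \<Rightarrow> 'e \<Rightarrow> ('m, 'e) tvec" where
  "coord_tvec A c p u =
     (\<lambda>d. if d \<in> charts_at A p
          then frechet_derivative (snd d \<circ> chart_inv c) (at (snd c p)) u else 0)"

definition tangent_map ::
  "('m, 'e::real_inner) chart set \<Rightarrow> ('n, 'f::real_inner) chart set \<Rightarrow> ('m \<Rightarrow> 'n) \<Rightarrow>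
     'm \<times> ('m, 'e) tvec \<Rightarrow> 'n \<times> ('n, 'f) tvec" where
  "tangent_map A B f = (\<lambda>(p, v).
     (f p, \<lambda>d. if d \<in> charts_at B (f p)
               then frechet_derivative (snd d \<circ> f \<circ> chart_inv (chart_at A p))
                      (at (snd (chart_at A p) p)) (v (chart_at A p))
               else 0))"

definition differential ::
  "('m, 'e::real_inner) chart set \<Rightarrow> ('m \<Rightarrow> real) \<Rightarrow> 'm \<Rightarrow> ('m, 'e) tvec \<Rightarrow> real" where
  "differential A f p v =
     frechet_derivative (f \<circ> chart_inv (chart_at A p)) (at (snd (chart_at A p) p))
       (v (chart_at A p))"

definition cotangent_space :: "('m, 'e::real_inner) chart set \<Rightarrow> 'm \<Rightarrow> ('m, 'e) covec set" where
  "cotangent_space A p =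
     {\<alpha>. (\<forall>v\<in>tangent_space A p. \<forall>w\<in>tangent_space A p. \<forall>a b.
            \<alpha> (\<lambda>c. a *\<^sub>R v c + b *\<^sub>R w c) = a * \<alpha> v + b * \<alpha> w) \<and>
         (\<forall>v. v \<notin> tangent_space A p \<longrightarrow> \<alpha> v = 0)}"

text \<open>
  The natural charts (q, p) of the cotangent bundle; the momentum coordinate p of a covector is
  the vector representing it through the inner product of the model space.
\<close>

definition cotangent_chart ::
  "('m, 'e::real_inner) chart set \<Rightarrow> ('m, 'e) chart \<Rightarrow>
     ('m \<times> ('m, 'e) covec, 'e \<times> 'e) chart" where
  "cotangent_chart A c =
     (Sigma (fst c) (cotangent_space A),
      \<lambda>(q, \<alpha>). (snd c q, THE a. \<forall>u. a \<bullet> u = \<alpha> (coord_tvec A c q u)))"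

definition cotangent_atlas ::
  "('m, 'e::real_inner) chart set \<Rightarrow> ('m \<times> ('m, 'e) covec, 'e \<times> 'e) chart set" where
  "cotangent_atlas A = cotangent_chart A ` A"

abbreviation cotangent_bundle ::
  "('m, 'e::real_inner) chart set \<Rightarrow> ('m \<times> ('m, 'e) covec) set" where
  "cotangent_bundle A \<equiv> Sigma (mcarrier A) (cotangent_space A)"

definition one_form ::
  "('m, 'e::real_inner) chart set \<Rightarrow> ('m \<Rightarrow> 'm \<times> ('m, 'e) covec) \<Rightarrow> bool" where
  "one_form A \<gamma> \<longleftrightarrow> smooth_map A (cotangent_atlas A) \<gamma> \<and> (\<forall>q\<in>mcarrier A. fst (\<gamma> q) = q)"

text \<open>
  The exterior derivative of a one-form, given by its covector parts; in coordinates
  d(b_i dx^i)(v, w) = sum_(i,j) (d_j b_i) (v^j w^i - w^j v^i).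
\<close>

definition ext_deriv ::
  "('m, 'e::real_inner) chart set \<Rightarrow> ('m \<Rightarrow> ('m, 'e) covec) \<Rightarrow> 'm \<Rightarrow>
     ('m, 'e) tvec \<Rightarrow> ('m, 'e) tvec \<Rightarrow> real" where
  "ext_deriv A \<beta> p v w =
     (let c = chart_at A p;
          b = (\<lambda>u x. \<beta> (chart_inv c x) (coord_tvec A c (chart_inv c x) u))
      in frechet_derivative (b (w c)) (at (snd c p)) (v c)
       - frechet_derivative (b (v c)) (at (snd c p)) (w c))"

definition lie_bracket ::
  "('m, 'e::real_inner) chart set \<Rightarrow> ('m \<Rightarrow> ('m, 'e) tvec) \<Rightarrow> ('m \<Rightarrow> ('m, 'e) tvec) \<Rightarrow>
     'm \<Rightarrow> ('m, 'e) tvec" where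
  "lie_bracket A X Y p =
     (\<lambda>c. if c \<in> charts_at A p
          then frechet_derivative (\<lambda>x. Y (chart_inv c x) c) (at (snd c p)) (X p c)
             - frechet_derivative (\<lambda>x. X (chart_inv c x) c) (at (snd c p)) (Y p c)
          else 0)"


section \<open>The canonical symplectic form and Hamiltonian vector fields\<close>

text \<open>
  The canonical one-form is \<theta> = p dq, and the sign of the symplectic form is \<omega> = - d\<theta> = dq \<and> dp;
  with i_X \<omega> = dH this gives Hamilton's equations q' = dH/dp, p' = - dH/dq.
\<close>

definition canonical_one_form ::
  "('m, 'e::real_inner) chart set \<Rightarrow> 'm \<times> ('m, 'e) covec \<Rightarrow>
     ('m \<times> ('m, 'e) covec, 'e \<times> 'e) covec" where
  "canonical_one_form A z V = snd z (snd (tangent_map (cotangent_atlas A) A fst (z, V)))"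

definition canonical_symplectic ::
  "('m, 'e::real_inner) chart set \<Rightarrow> 'm \<times> ('m, 'e) covec \<Rightarrow>
     ('m \<times> ('m, 'e) covec, 'e \<times> 'e) tvec \<Rightarrow> ('m \<times> ('m, 'e) covec, 'e \<times> 'e) tvec \<Rightarrow> real" where
  "canonical_symplectic A z V W = - ext_deriv (cotangent_atlas A) (canonical_one_form A) z V W"

definition hamiltonian_vf ::
  "('m, 'e::real_inner) chart set \<Rightarrow> ('m \<times> ('m, 'e) covec \<Rightarrow> real) \<Rightarrow> 'm \<times> ('m, 'e) covec \<Rightarrow>
     ('m \<times> ('m, 'e) covec) \<times> ('m \<times> ('m, 'e) covec, 'e \<times> 'e) tvec" where
  "hamiltonian_vf A f z =
     (z, THE V. V \<in> tangent_space (cotangent_atlas A) z \<and>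
           (\<forall>W\<in>tangent_space (cotangent_atlas A) z.
              canonical_symplectic A z V W = differential (cotangent_atlas A) f z W))"

definition symplectic_map ::
  "('m, 'e::real_inner) chart set \<Rightarrow> ('m \<times> ('m, 'e) covec \<Rightarrow> 'm \<times> ('m, 'e) covec) \<Rightarrow> bool" where
  "symplectic_map A \<epsilon> \<longleftrightarrow>
     smooth_map (cotangent_atlas A) (cotangent_atlas A) \<epsilon> \<and>
     (\<forall>z\<in>cotangent_bundle A.
        \<forall>V\<in>tangent_space (cotangent_atlas A) z. \<forall>W\<in>tangent_space (cotangent_atlas A) z.
          canonical_symplectic A (\<epsilon> z)
            (snd (tangent_map (cotangent_atlas A) (cotangent_atlas A) \<epsilon> (z, V)))
            (snd (tangent_map (cotangent_atlas A) (cotangent_atlas A) \<epsilon> (z, W)))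
          = canonical_symplectic A z V W)"

text \<open>d\<gamma>(T\<pi> V, T\<pi> W) = 0 for all V, W tangent to the cotangent bundle at a common point.\<close>

definition closed_wrt_Tpi ::
  "('m, 'e::real_inner) chart set \<Rightarrow> ('m \<Rightarrow> 'm \<times> ('m, 'e) covec) \<Rightarrow> bool" where
  "closed_wrt_Tpi A \<gamma> \<longleftrightarrow>
     (\<forall>z\<in>cotangent_bundle A.
        \<forall>V\<in>tangent_space (cotangent_atlas A) z. \<forall>W\<in>tangent_space (cotangent_atlas A) z.
          ext_deriv A (\<lambda>q. snd (\<gamma> q)) (fst z)
            (snd (tangent_map (cotangent_atlas A) A fst (z, V)))
            (snd (tangent_map (cotangent_atlas A) A fst (z, W))) = 0)"


section \<open>Lie groups, momentum map and coadjoint orbits\<close>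

locale lie_group = group G for G :: "('g, 'b) monoid_scheme" (structure) +
  fixes A :: "('g, 'e::real_inner) chart set"
  assumes manifold: "smooth_manifold A"
    and carrier_eq: "mcarrier A = carrier G"
    and smooth_mult: "smooth_map (prod_atlas A A) A (\<lambda>(x, y). x \<otimes> y)"
    and smooth_inv: "smooth_map A A (\<lambda>x. inv x)"

definition left_trans :: "('g, 'b) monoid_scheme \<Rightarrow> 'g \<Rightarrow> 'g \<Rightarrow> 'g" where
  "left_trans G g x = g \<otimes>\<^bsub>G\<^esub> x"

definition right_trans :: "('g, 'b) monoid_scheme \<Rightarrow> 'g \<Rightarrow> 'g \<Rightarrow> 'g" where
  "right_trans G g x = x \<otimes>\<^bsub>G\<^esub> g"

definition lie_algebra ::
  "('g, 'b) monoid_scheme \<Rightarrow> ('g, 'e::real_inner) chart set \<Rightarrow> ('g, 'e) tvec set" where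
  "lie_algebra G A = tangent_space A \<one>\<^bsub>G\<^esub>"

definition lie_algebra_dual ::
  "('g, 'b) monoid_scheme \<Rightarrow> ('g, 'e::real_inner) chart set \<Rightarrow> ('g, 'e) covec set" where
  "lie_algebra_dual G A = cotangent_space A \<one>\<^bsub>G\<^esub>"

definition left_inv_vf ::
  "('g, 'b) monoid_scheme \<Rightarrow> ('g, 'e::real_inner) chart set \<Rightarrow> ('g, 'e) tvec \<Rightarrow>
     'g \<Rightarrow> ('g, 'e) tvec" where
  "left_inv_vf G A \<xi> g = snd (tangent_map A A (left_trans G g) (\<one>\<^bsub>G\<^esub>, \<xi>))"

definition bracket ::
  "('g, 'b) monoid_scheme \<Rightarrow> ('g, 'e::real_inner) chart set \<Rightarrow> ('g, 'e) tvec \<Rightarrow> ('g, 'e) tvec \<Rightarrow>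
     ('g, 'e) tvec" where
  "bracket G A \<xi> \<eta> = lie_bracket A (left_inv_vf G A \<xi>) (left_inv_vf G A \<eta>) \<one>\<^bsub>G\<^esub>"

definition cotangent_lift ::
  "('g, 'b) monoid_scheme \<Rightarrow> ('g, 'e::real_inner) chart set \<Rightarrow> 'g \<Rightarrow>
     'g \<times> ('g, 'e) covec \<Rightarrow> 'g \<times> ('g, 'e) covec" where
  "cotangent_lift G A g = (\<lambda>(h, \<alpha>).
     (g \<otimes>\<^bsub>G\<^esub> h,
      \<lambda>v. if v \<in> tangent_space A (g \<otimes>\<^bsub>G\<^esub> h)
          then \<alpha> (snd (tangent_map A A (left_trans G (inv\<^bsub>G\<^esub> g)) (g \<otimes>\<^bsub>G\<^esub> h, v))) else 0))"

definition momentum_map ::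
  "('g, 'b) monoid_scheme \<Rightarrow> ('g, 'e::real_inner) chart set \<Rightarrow>
     'g \<times> ('g, 'e) covec \<Rightarrow> ('g, 'e) covec" where
  "momentum_map G A = (\<lambda>(g, \<alpha>) \<xi>.
     if \<xi> \<in> lie_algebra G A
     then \<alpha> (snd (tangent_map A A (right_trans G g) (\<one>\<^bsub>G\<^esub>, \<xi>))) else 0)"

definition momentum_level ::
  "('g, 'b) monoid_scheme \<Rightarrow> ('g, 'e::real_inner) chart set \<Rightarrow> ('g, 'e) covec \<Rightarrow>
     ('g \<times> ('g, 'e) covec) set" where
  "momentum_level G A \<mu> = {z \<in> cotangent_bundle A. momentum_map G A z = \<mu>}"

text \<open>
  The map (g, \<alpha>) \<mapsto> (T_e L_g)^* \<alpha> on the whole cotangent bundle; its restriction to the level set of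
  \<mu> is the reduction projection onto the coadjoint orbit of \<mu>.
\<close>

definition reduction_proj ::
  "('g, 'b) monoid_scheme \<Rightarrow> ('g, 'e::real_inner) chart set \<Rightarrow>
     'g \<times> ('g, 'e) covec \<Rightarrow> ('g, 'e) covec" where
  "reduction_proj G A = (\<lambda>(g, \<alpha>) \<xi>.
     if \<xi> \<in> lie_algebra G A
     then \<alpha> (snd (tangent_map A A (left_trans G g) (\<one>\<^bsub>G\<^esub>, \<xi>))) else 0)"

text \<open>
  The tangent map of a map F from a manifold into the vector space of covectors at a fixed point,
  with the tangent vectors of that vector space identified with its elements: the derivative is taken
  pointwise in the argument of the covectors.  It serves maps into the dual of the Lie algebra and,
  since a coadjoint orbit is an (initial) submanifold of it, maps into coadjoint orbits.
\<close>

definition tangent_map_dual ::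
  "('m, 'e::real_inner) chart set \<Rightarrow> ('m \<Rightarrow> ('g, 'f) covec) \<Rightarrow>
     'm \<times> ('m, 'e) tvec \<Rightarrow> ('g, 'f) covec \<times> ('g, 'f) covec" where
  "tangent_map_dual A F = (\<lambda>(p, v). (F p, \<lambda>\<xi>. differential A (\<lambda>q. F q \<xi>) p v))"

definition regular_value ::
  "('g, 'b) monoid_scheme \<Rightarrow> ('g, 'e::real_inner) chart set \<Rightarrow> ('g, 'e) covec \<Rightarrow> bool" where
  "regular_value G A \<mu> \<longleftrightarrow>
     (\<forall>z\<in>momentum_level G A \<mu>. \<forall>\<kappa>\<in>lie_algebra_dual G A.
        \<exists>V\<in>tangent_space (cotangent_atlas A) z.
          snd (tangent_map_dual (cotangent_atlas A) (momentum_map G A) (z, V)) = \<kappa>)"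

definition Ad ::
  "('g, 'b) monoid_scheme \<Rightarrow> ('g, 'e::real_inner) chart set \<Rightarrow> 'g \<Rightarrow> ('g, 'e) tvec \<Rightarrow> ('g, 'e) tvec"
  where
  "Ad G A g \<xi> = snd (tangent_map A A (\<lambda>x. g \<otimes>\<^bsub>G\<^esub> x \<otimes>\<^bsub>G\<^esub> inv\<^bsub>G\<^esub> g) (\<one>\<^bsub>G\<^esub>, \<xi>))"

text \<open>Conventions: Ad*_g is the dual of Ad_g and ad*_\<xi> is the dual of ad_\<xi> = [\<xi>, -].\<close>

definition coAd ::
  "('g, 'b) monoid_scheme \<Rightarrow> ('g, 'e::real_inner) chart set \<Rightarrow> 'g \<Rightarrow> ('g, 'e) covec \<Rightarrow>
     ('g, 'e) covec" where
  "coAd G A g \<nu> = (\<lambda>\<eta>. if \<eta> \<in> lie_algebra G A then \<nu> (Ad G A g \<eta>) else 0)"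

definition coad ::
  "('g, 'b) monoid_scheme \<Rightarrow> ('g, 'e::real_inner) chart set \<Rightarrow> ('g, 'e) tvec \<Rightarrow> ('g, 'e) covec \<Rightarrow>
     ('g, 'e) covec" where
  "coad G A \<xi> \<nu> = (\<lambda>\<eta>. if \<eta> \<in> lie_algebra G A then \<nu> (bracket G A \<xi> \<eta>) else 0)"

definition isotropy_group ::
  "('g, 'b) monoid_scheme \<Rightarrow> ('g, 'e::real_inner) chart set \<Rightarrow> ('g, 'e) covec \<Rightarrow> 'g set" where
  "isotropy_group G A \<mu> = {g \<in> carrier G. coAd G A g \<mu> = \<mu>}"

definition coadjoint_orbit ::
  "('g, 'b) monoid_scheme \<Rightarrow> ('g, 'e::real_inner) chart set \<Rightarrow> ('g, 'e) covec \<Rightarrow>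
     ('g, 'e) covec set" where
  "coadjoint_orbit G A \<mu> = {coAd G A (inv\<^bsub>G\<^esub> g) \<mu> | g. g \<in> carrier G}"

definition orbit_tangent_space ::
  "('g, 'b) monoid_scheme \<Rightarrow> ('g, 'e::real_inner) chart set \<Rightarrow> ('g, 'e) covec \<Rightarrow>
     ('g, 'e) covec set" where
  "orbit_tangent_space G A \<nu> = {coad G A \<xi> \<nu> | \<xi>. \<xi> \<in> lie_algebra G A}"

text \<open>\<omega>^-(\<nu>)(ad*_\<xi> \<nu>, ad*_\<eta> \<nu>) = - \<nu>[\<xi>, \<eta>].\<close>

definition orbit_symplectic ::
  "('g, 'b) monoid_scheme \<Rightarrow> ('g, 'e::real_inner) chart set \<Rightarrow> ('g, 'e) covec \<Rightarrow>
     ('g, 'e) covec \<Rightarrow> ('g, 'e) covec \<Rightarrow> real" where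
  "orbit_symplectic G A \<nu> a b =
     (THE r. \<exists>\<xi>\<in>lie_algebra G A. \<exists>\<eta>\<in>lie_algebra G A.
        a = coad G A \<xi> \<nu> \<and> b = coad G A \<eta> \<nu> \<and> r = - \<nu> (bracket G A \<xi> \<eta>))"

text \<open>
  The smooth structure of a coadjoint orbit is the one for which the orbit maps g \<mapsto> Ad*_g \<nu> are
  submersions.  The tangent map of such a map at the identity is \<xi> \<mapsto> ad*_\<xi> \<nu>, so the
  differential at \<nu> of a function f on the orbit is ad*_\<xi> \<nu> \<mapsto> d(g \<mapsto> f(Ad*_g \<nu>))_e(\<xi>).
\<close>

definition orbit_differential ::
  "('g, 'b) monoid_scheme \<Rightarrow> ('g, 'e::real_inner) chart set \<Rightarrow> (('g, 'e) covec \<Rightarrow> real) \<Rightarrow>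
     ('g, 'e) covec \<Rightarrow> ('g, 'e) covec \<Rightarrow> real" where
  "orbit_differential G A f \<nu> b =
     (THE r. \<exists>\<xi>\<in>lie_algebra G A.
        b = coad G A \<xi> \<nu> \<and> r = differential A (\<lambda>g. f (coAd G A g \<nu>)) \<one>\<^bsub>G\<^esub> \<xi>)"

definition orbit_hamiltonian_vf ::
  "('g, 'b) monoid_scheme \<Rightarrow> ('g, 'e::real_inner) chart set \<Rightarrow> (('g, 'e) covec \<Rightarrow> real) \<Rightarrow>
     ('g, 'e) covec \<Rightarrow> ('g, 'e) covec \<times> ('g, 'e) covec" where
  "orbit_hamiltonian_vf G A f \<nu> =
     (\<nu>, THE a. a \<in> orbit_tangent_space G A \<nu> \<and>
           (\<forall>b\<in>orbit_tangent_space G A \<nu>.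
              orbit_symplectic G A \<nu> a b = orbit_differential G A f \<nu> b))"

end

theory Submission
  imports Defs
begin

text \<open>
  A one-form with values in the level set of \<open>\<mu>\<close> is the right-invariant form with value \<open>\<mu>\<close> at
  the identity, so the level set is the image of \<open>\<gamma>\<close>.  Right invariance means that the Lie derivative
  of \<open>\<gamma>\<close> along every left-invariant vector field vanishes.  In the left trivialization an invariant
  Hamiltonian depends on the momentum only, hence the base component of \<open>X\<^sub>H(\<gamma> q)\<close> is a left-invariant
  field \<open>\<zeta>\<close> at \<open>q\<close>, and the vanishing Lie derivative shows that \<open>X\<^sub>H(\<gamma> q)\<close> is tangent to the image of
  \<open>\<gamma>\<close>.  Both sides of the Type I equation then equal \<open>ad\<^sup>*\<^sub>\<zeta> \<nu>\<close> at \<open>\<nu> = \<pi>\<^sub>\<mu>(\<gamma> q)\<close>.  The two equations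
  of Type II follow from this at the point \<open>\<epsilon> z = \<gamma> q\<close>, together with \<open>T\<epsilon> X\<^sub>H\<^sub>\<circ>\<^sub>\<epsilon> = X\<^sub>H \<circ> \<epsilon>\<close> for
  symplectic \<open>\<epsilon>\<close>.  All computations are done in charts; the only second-order input is the symmetry
  of second derivatives of the multiplication.
\<close>

section \<open>Calculus in finite-dimensional inner product spaces\<close>

text \<open>The image of \<open>\<gamma>\<close> fills the level set because
  \<open>momentum_map\<close> pairs a covector at g with the right-invariant fields, and these span
  every tangent space: each fibre of the level set over G is a single point. No flow is integrated.
  The Lie derivative identity comes from differentiating the constant pairing of
  \<open>\<gamma>\<close> with a right-invariant field along a left-invariant one. Write p for the
  chart representative of \<open>\<gamma>\<close> and L for the chart field of
  \<open>\<zeta>\<close>. The identity reads Dp(L) . u = - p . DL(u). At the point considered, the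
  invariant H has derivative w . L + p . DL(u) in the direction (u, w), so Hamilton's equations give
  q' = L and the same p' as the identity. Two features of the encoding shape the work. Model spaces
  are inner product spaces with a finite spanning set only, so bases, Riesz vectors and the
  dimension count are built by hand. Hamiltonian vector fields, the orbit form and orbit
  differentials are definite descriptions, so each value must first be shown to exist and to be
  unique.\<close>

text \<open>Orthonormal bases have this property, and nothing else about them is used.\<close>

definition expansion_basis :: "'a::real_inner set \<Rightarrow> bool" where
  "expansion_basis C \<longleftrightarrow> finite C \<and> (\<forall>x. (\<Sum>e\<in>C. (x \<bullet> e) *\<^sub>R e) = x)"

text \<open>Normalise an orthogonal spanning set. The remainder of \<open>x\<close> after
  subtracting its expansion is orthogonal to the whole span, hence to itself, hence zero.\<close>

lemma expansion_basis_exists: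
  fixes B :: "'a::real_inner set"
  assumes "finite B" "span B = UNIV"
  shows "\<exists>C::'a set. expansion_basis C"
proof -
  obtain C where C: "finite C" "span C = (UNIV::'a set)" "pairwise orthogonal C"
    using basis_orthogonal[OF assms(1)] assms(2) by metis
  define f where "f x = x /\<^sub>R norm x" for x :: 'a
  \<comment> \<open>An orthogonal set may contain the zero vector, which cannot be
    normalised.\<close>
  define D where "D = f ` (C - {0})"
  have fD: "finite D" using C D_def by simp
  have ortho: "e \<bullet> e' = (if e = e' then 1 else 0)" if ee: "e \<in> D" "e' \<in> D" for e e'
  proof -
    obtain x where x: "x \<in> C" "x \<noteq> 0" "e = f x" using ee D_def by auto
    obtain y where y: "y \<in> C" "y \<noteq> 0" "e' = f y" using ee D_def by auto
    show ?thesis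
    proof (cases "x = y")
      case True
      then show ?thesis using x y by (simp add: f_def power2_norm_eq_inner[symmetric] power2_eq_square)
    next
      case False
      then have "x \<bullet> y = 0" using C(3) x(1) y(1) by (auto simp: pairwise_def orthogonal_def)
      then have "e \<bullet> e' = 0" using x y by (simp add: f_def)
      moreover have "e \<bullet> e = 1" using x by (simp add: f_def power2_norm_eq_inner[symmetric] power2_eq_square)
      ultimately show ?thesis by auto
    qed
  qed
  have sp: "x \<in> span D" if "x \<in> C" for x
  proof (cases "x = 0")
    case False
    then have "f x \<in> span D" using that D_def by (intro span_base) auto
    then have "norm x *\<^sub>R f x \<in> span D" by (rule span_scale)
    then show ?thesis using False by (simp add: f_def)
  qed (simp add: span_zero)
  have "span C \<subseteq> span D" by (rule span_minimal) (use sp in auto)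
  then have spD: "span D = UNIV" using C by auto
  have "(\<Sum>e\<in>D. (x \<bullet> e) *\<^sub>R e) = x" for x
  proof -
    define y where "y = x - (\<Sum>e\<in>D. (x \<bullet> e) *\<^sub>R e)"
    have "orthogonal y e'" if e': "e' \<in> D" for e'
    proof -
      have "(\<Sum>e\<in>D. (x \<bullet> e) *\<^sub>R e) \<bullet> e' = (\<Sum>e\<in>D. (x \<bullet> e) * (e \<bullet> e'))"
        by (simp add: inner_sum_left)
      also have "\<dots> = (\<Sum>e\<in>D. if e = e' then x \<bullet> e' else 0)"
        by (rule sum.cong) (use ortho e' in auto)
      also have "\<dots> = x \<bullet> e'" using fD e' by simp
      finally show ?thesis by (simp add: y_def orthogonal_def inner_diff_left)
    qed
    then have "orthogonal y y"
      by (intro orthogonal_to_span[of y D]) (auto simp: spD)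
    then have "y = 0" by (simp add: orthogonal_self)
    then show ?thesis by (simp add: y_def)
  qed
  then show ?thesis using fD unfolding expansion_basis_def by blast
qed

text \<open>The explicit representing vector of a functional; it witnesses the momentum coordinate
  in \<open>cotangent_chart\<close> and the components of Hamiltonian vector fields.\<close>

lemma riesz:
  assumes C: "expansion_basis C" and l: "linear l"
  shows "(\<Sum>e\<in>C. l e *\<^sub>R e) \<bullet> u = l u"
proof -
  have "l u = l (\<Sum>e\<in>C. (u \<bullet> e) *\<^sub>R e)" using C by (simp add: expansion_basis_def)
  also have "\<dots> = (\<Sum>e\<in>C. (u \<bullet> e) * l e)"
    by (simp add: linear_sum[OF l] linear_scale[OF l])
  finally show ?thesis by (simp add: inner_sum_left inner_sum_right inner_commute mult.commute)
qed

lemma riesz_unique: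
  assumes "\<And>u. a \<bullet> u = b \<bullet> u" shows "a = (b :: 'a::real_inner)"
proof -
  have "(a - b) \<bullet> (a - b) = 0" using assms[of "a - b"] by (simp only: inner_diff_left)
  then show ?thesis by simp
qed

lemma linear_expand:
  assumes C: "expansion_basis C" and l: "linear l"
  shows "l u = (\<Sum>e\<in>C. (u \<bullet> e) *\<^sub>R l e)"
proof -
  have "l u = l (\<Sum>e\<in>C. (u \<bullet> e) *\<^sub>R e)" using C by (simp add: expansion_basis_def)
  then show ?thesis by (simp add: linear_sum[OF l] linear_scale[OF l])
qed

lemma frechet_derivative_eq: "(f has_derivative f') (at x) \<Longrightarrow> frechet_derivative f (at x) = f'"
  by (simp add: frechet_derivative_at[symmetric])

lemma differentiable_has_derivative: "f differentiable at x \<Longrightarrow> (f has_derivative frechet_derivative f (at x)) (at x)"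
  by (simp add: frechet_derivative_works)

lemma smooth_on_differentiable: "smooth_on S f \<Longrightarrow> x \<in> S \<Longrightarrow> f differentiable at x"
  unfolding smooth_on_def by (metis Ck_on.simps(2))

lemma smooth_on_frechet: "smooth_on S f \<Longrightarrow> smooth_on S (\<lambda>x. frechet_derivative f (at x) v)"
  unfolding smooth_on_def by (metis Ck_on.simps(2))

lemma smooth_on_continuous: "smooth_on S f \<Longrightarrow> continuous_on S f"
  unfolding smooth_on_def by (metis Ck_on.simps(1))

lemma smooth_on_open: "smooth_on S f \<Longrightarrow> open S"
  unfolding smooth_on_def by blast

section \<open>Symmetry of second derivatives\<close>

lemma second_difference_mvt:
  fixes g :: "real \<Rightarrow> real \<Rightarrow> real"
  assumes h: "0 < h"
    and 1: "\<And>s t. \<lbrakk>0 \<le> s; s \<le> h; 0 \<le> t; t \<le> h\<rbrakk> \<Longrightarrow> ((\<lambda>s. g s t) has_real_derivative gs s t) (at s)"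
    and 2: "\<And>s t. \<lbrakk>0 \<le> s; s \<le> h; 0 \<le> t; t \<le> h\<rbrakk> \<Longrightarrow> ((\<lambda>t. gs s t) has_real_derivative gst s t) (at t)"
  shows "\<exists>s t. 0 < s \<and> s < h \<and> 0 < t \<and> t < h \<and> g h h - g h 0 - g 0 h + g 0 0 = h * h * gst s t"
proof -
  \<comment> \<open>The mean value theorem is applied in \<open>s\<close> to the difference
    \<open>g s h - g s 0\<close>, then in \<open>t\<close> to \<open>gs\<close>.\<close>
  have "\<exists>z>0. z < h \<and> (g h h - g h 0) - (g 0 h - g 0 0) = (h - 0) * (gs z h - gs z 0)"
    by (rule MVT2[OF h]) (use h in \<open>auto intro!: DERIV_diff 1\<close>)
  then obtain s where s: "0 < s" "s < h" "(g h h - g h 0) - (g 0 h - g 0 0) = h * (gs s h - gs s 0)"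
    by auto
  have "\<exists>z>0. z < h \<and> gs s h - gs s 0 = (h - 0) * gst s z"
    by (rule MVT2[OF h]) (use h s in \<open>auto intro!: 2\<close>)
  then obtain t where t: "0 < t" "t < h" "gs s h - gs s 0 = h * gst s t" by auto
  have "g h h - g h 0 - g 0 h + g 0 0 = h * (h * gst s t)" using s(3) t(3) by simp
  then show ?thesis using s(1,2) t(1,2) by (metis mult.assoc)
qed

text \<open>Pairing with a fixed vector \<open>w\<close> makes the function real-valued, so that the
  mean value theorem applies.\<close>

lemma has_real_derivative_along_line:
  fixes f :: "'a::real_normed_vector \<Rightarrow> 'b::real_inner"
  assumes "f differentiable at (x + s *\<^sub>R u)"
  shows "((\<lambda>s. w \<bullet> f (x + s *\<^sub>R u)) has_real_derivative
           w \<bullet> frechet_derivative f (at (x + s *\<^sub>R u)) u) (at s)"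
proof -
  let ?D = "frechet_derivative f (at (x + s *\<^sub>R u))"
  have l: "((\<lambda>s. x + s *\<^sub>R u) has_derivative (\<lambda>a. a *\<^sub>R u)) (at s)"
    by (auto intro!: derivative_eq_intros)
  have "((\<lambda>s. f (x + s *\<^sub>R u)) has_derivative (\<lambda>a. ?D (a *\<^sub>R u))) (at s)"
    using diff_chain_at[OF l differentiable_has_derivative[OF assms]] by (simp add: o_def)
  then have "((\<lambda>s. w \<bullet> f (x + s *\<^sub>R u)) has_derivative (\<lambda>a. w \<bullet> ?D (a *\<^sub>R u))) (at s)"
    by (rule has_derivative_inner_right)
  then show ?thesis
    by (simp add: has_field_derivative_def linear_scale[OF linear_frechet_derivative[OF assms]]
        mult.commute[of _ "w \<bullet> ?D u"] mult_commute_abs)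
qed

text \<open>Schwarz's theorem: the second difference over a small parallelogram equals
  \<open>h * h\<close> times either mixed derivative at some point of it, and both mixed derivatives
  are continuous at \<open>x\<close>.\<close>

lemma symmetric_second_derivative:
  fixes f :: "'a::real_normed_vector \<Rightarrow> 'b::real_inner"
  assumes f: "smooth_on S f" and x: "x \<in> S"
  shows "frechet_derivative (\<lambda>y. frechet_derivative f (at y) u) (at x) v =
         frechet_derivative (\<lambda>y. frechet_derivative f (at y) v) (at x) u"
proof (rule riesz_unique, rule ccontr)
  fix w :: 'b
  let ?D2 = "\<lambda>u v y. w \<bullet> frechet_derivative (\<lambda>y. frechet_derivative f (at y) u) (at y) v"
  let ?p = "\<lambda>s t. x + s *\<^sub>R u + t *\<^sub>R v"
  assume "frechet_derivative (\<lambda>y. frechet_derivative f (at y) u) (at x) v \<bullet> w \<noteq>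
         frechet_derivative (\<lambda>y. frechet_derivative f (at y) v) (at x) u \<bullet> w"
  then have ne: "?D2 u v x \<noteq> ?D2 v u x" by (simp add: inner_commute)
  \<comment> \<open>Half the gap: two numbers closer than \<open>e\<close> to the two mixed
    derivatives at \<open>x\<close> cannot coincide.\<close>
  define e where "e = \<bar>?D2 u v x - ?D2 v u x\<bar> / 2"
  have e: "e > 0" using ne by (simp add: e_def)
  have S: "open S" using f smooth_on_open by blast
  have cont: "continuous_on S (?D2 a b)" for a b
    by (intro continuous_on_inner continuous_on_const smooth_on_continuous smooth_on_frechet f)
  have ev: "eventually (\<lambda>y. \<bar>?D2 a b y - ?D2 a b x\<bar> < e) (nhds x)" for a b
  proof -
    have "isCont (?D2 a b) x"
      using cont[of a b] S x by (simp add: continuous_on_eq_continuous_at)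
    then show ?thesis using e
      unfolding continuous_at_eps_delta eventually_nhds_metric dist_real_def by blast
  qed
  have "eventually (\<lambda>y. y \<in> S) (nhds x)" using S x by (auto simp: eventually_nhds)
  with ev[of u v] ev[of v u]
  have "eventually (\<lambda>y. y \<in> S \<and> \<bar>?D2 u v y - ?D2 u v x\<bar> < e \<and> \<bar>?D2 v u y - ?D2 v u x\<bar> < e) (nhds x)"
    by eventually_elim auto
  then obtain r where r: "r > 0"
    "\<And>y. dist y x < r \<Longrightarrow> y \<in> S \<and> \<bar>?D2 u v y - ?D2 u v x\<bar> < e \<and> \<bar>?D2 v u y - ?D2 v u x\<bar> < e"
    unfolding eventually_nhds_metric by blast
  \<comment> \<open>The whole parallelogram of side \<open>h\<close> then stays within
    \<open>r / 2\<close> of \<open>x\<close>; the summand 1 covers \<open>u = v = 0\<close>.\<close>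
  define h where "h = r / (2 * (norm u + norm v + 1))"
  have nz: "norm u + norm v + 1 > 0" by (smt (verit) norm_ge_zero)
  have h: "h > 0" using r nz by (simp add: h_def)
  have close: "dist (?p s t) x < r" if st: "0 \<le> s" "s \<le> h" "0 \<le> t" "t \<le> h" for s t
  proof -
    have "norm (s *\<^sub>R u + t *\<^sub>R v) \<le> s * norm u + t * norm v"
      using norm_triangle_ineq[of "s *\<^sub>R u" "t *\<^sub>R v"] st by simp
    also have "\<dots> \<le> h * norm u + h * norm v" using st by (intro add_mono mult_right_mono) auto
    also have "\<dots> \<le> h * (norm u + norm v + 1)" using h by (simp add: algebra_simps)
    also have "\<dots> = r / 2" using nz by (simp add: h_def field_simps)
    finally show ?thesis using r(1) by (simp add: dist_norm add.assoc)
  qed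
  have dS: "((\<lambda>s. w \<bullet> k (?p s t)) has_real_derivative w \<bullet> frechet_derivative k (at (?p s t)) u) (at s)"
    if "k differentiable at (?p s t)" for s t and k :: "'a \<Rightarrow> 'b"
    using has_real_derivative_along_line[of k "x + t *\<^sub>R v" s u w] that by (simp add: add_ac)
  have dT: "((\<lambda>t. w \<bullet> k (?p s t)) has_real_derivative w \<bullet> frechet_derivative k (at (?p s t)) v) (at t)"
    if "k differentiable at (?p s t)" for s t and k :: "'a \<Rightarrow> 'b"
    using has_real_derivative_along_line[of k "x + s *\<^sub>R u" t v w] that by simp
  note df = smooth_on_differentiable[OF f]
  note ddf = smooth_on_differentiable[OF smooth_on_frechet[OF f]]
  let ?g = "\<lambda>s t. w \<bullet> f (?p s t)"
  have inS: "?p s t \<in> S" if "0 \<le> s" "s \<le> h" "0 \<le> t" "t \<le> h" for s t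
    using close r that by blast
  have "\<exists>s t. 0 < s \<and> s < h \<and> 0 < t \<and> t < h \<and> ?g h h - ?g h 0 - ?g 0 h + ?g 0 0 = h * h * ?D2 u v (?p s t)"
    by (rule second_difference_mvt[OF h, where gs = "\<lambda>s t. w \<bullet> frechet_derivative f (at (?p s t)) u"
          and gst = "\<lambda>s t. ?D2 u v (?p s t)"]) (intro dS dT df ddf inS; assumption)+
  then obtain s t where 1: "0 < s" "s < h" "0 < t" "t < h"
    "?g h h - ?g h 0 - ?g 0 h + ?g 0 0 = h * h * ?D2 u v (?p s t)" by blast
  \<comment> \<open>The same second difference with the two variables exchanged; only its two middle
    terms trade places.\<close>
  have "\<exists>t s. 0 < t \<and> t < h \<and> 0 < s \<and> s < h \<and> ?g h h - ?g 0 h - ?g h 0 + ?g 0 0 = h * h * ?D2 v u (?p s t)"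
    by (rule second_difference_mvt[OF h, where g = "\<lambda>t s. ?g s t" and
          gs = "\<lambda>t s. w \<bullet> frechet_derivative f (at (?p s t)) v" and gst = "\<lambda>t s. ?D2 v u (?p s t)"])
       (intro dS dT df ddf inS; assumption)+
  then obtain t' s' where 2: "0 < s'" "s' < h" "0 < t'" "t' < h"
    "?g h h - ?g 0 h - ?g h 0 + ?g 0 0 = h * h * ?D2 v u (?p s' t')" by blast
  have "h * h * ?D2 u v (?p s t) = h * h * ?D2 v u (?p s' t')" using 1(5) 2(5) by linarith
  then have "?D2 u v (?p s t) = ?D2 v u (?p s' t')" using h by simp
  moreover have "\<bar>?D2 u v (?p s t) - ?D2 u v x\<bar> < e" using r(2) close 1 by simp
  moreover have "\<bar>?D2 v u (?p s' t') - ?D2 v u x\<bar> < e" using r(2) close 2 by simp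
  moreover have False if "p = q" "\<bar>p - a\<bar> < \<bar>a - b\<bar> / 2" "\<bar>q - b\<bar> < \<bar>a - b\<bar> / 2" for p q a b :: real
    using that by (smt (verit) field_sum_of_halves)
  ultimately show False unfolding e_def by blast
qed

text \<open>Both functions have the same set of derivatives, so the choice behind
  \<open>frechet_derivative\<close> agrees even where that set is empty; no differentiability side
  condition arises.\<close>

lemma frechet_derivative_cong_nhds:
  assumes "eventually (\<lambda>y. f y = g y) (nhds x)"
  shows "frechet_derivative f (at x) = frechet_derivative g (at x)"
    and "f differentiable at x \<longleftrightarrow> g differentiable at x"
proof -
  have imp: "(g has_derivative f') (at x)"
    if f': "(f has_derivative f') (at x)" and ev: "eventually (\<lambda>y. f y = g y) (nhds x)"
    for f' and f g :: "'a \<Rightarrow> 'b"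
  proof -
    obtain S where S: "open S" "x \<in> S" "\<And>y. y \<in> S \<Longrightarrow> f y = g y"
      using ev unfolding eventually_nhds by blast
    show ?thesis by (rule has_derivative_transform_within_open[OF f' S])
  qed
  have "eventually (\<lambda>y. g y = f y) (nhds x)" using assms by eventually_elim simp
  with assms have "(f has_derivative f') (at x) \<longleftrightarrow> (g has_derivative f') (at x)" for f'
    using imp by blast
  then show "frechet_derivative f (at x) = frechet_derivative g (at x)"
    "f differentiable at x \<longleftrightarrow> g differentiable at x"
    by (simp_all add: frechet_derivative_def differentiable_def)
qed

lemma linear_inj_imp_surj_finite:
  fixes f :: "'a::real_vector \<Rightarrow> 'a"
  assumes C: "finite (C :: 'a set)" "span C = UNIV" and f: "linear f" "inj f"
  shows "surj f"
proof -
  obtain B :: "'a set" where B: "independent B" "UNIV \<subseteq> span B"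
    by (rule maximal_independent_subset[of UNIV])
  have fB: "finite B" using independent_span_bound[OF C(1) B(1)] C(2) by simp
  have iB: "independent (f ` B)" by (rule linear_independent_injective_image[OF f(1) B(1) inj_on_subset[OF f(2)]]) simp
  have *: "y \<in> span (f ` B)" for y
  proof (rule ccontr)
    assume y: "y \<notin> span (f ` B)"
    then have "independent (insert y (f ` B))" using iB by (rule independent_insertI)
    then have "card (insert y (f ` B)) \<le> card B"
      using independent_span_bound[OF fB, of "insert y (f ` B)"] B(2) by auto
    moreover have "y \<notin> f ` B" using y span_base[of y "f ` B"] by (rule contrapos_nn)
    moreover have "card (f ` B) = card B" using f(2) by (intro card_image) (auto simp: inj_on_def)
    ultimately show False using fB by simp
  qed
  have "y \<in> f ` span B" for y using *[of y] by (simp only: linear_span_image[OF f(1), symmetric])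
  then show ?thesis by (metis surjI surj_def rangeI imageE)
qed

lemma expansion_basis_prod:
  assumes C: "expansion_basis (C :: 'a::real_inner set)"
  shows "\<exists>D :: ('a \<times> 'a) set. finite D \<and> span D = UNIV"
proof (intro exI conjI)
  let ?D = "(\<lambda>e. (e, 0)) ` C \<union> (\<lambda>e. (0, e)) ` C"
  show "finite ?D" using C by (simp add: expansion_basis_def)
  have "z \<in> span ?D" for z
  proof -
    have "z = (\<Sum>e\<in>C. (fst z \<bullet> e) *\<^sub>R (e, 0)) + (\<Sum>e\<in>C. (snd z \<bullet> e) *\<^sub>R (0, e))"
      using C by (simp add: expansion_basis_def prod_eq_iff fst_sum snd_sum)
    also have "\<dots> \<in> span ?D"
      by (intro span_add span_sum span_scale span_base) auto
    finally show ?thesis .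
  qed
  then show "span ?D = UNIV" by blast
qed

section \<open>Differentiable maps in charts\<close>

text \<open>A first-order weakening of \<open>smooth_atlas\<close>: it suffices for tangent maps,
  and for the cotangent atlas it asks for one derivative of the transition maps instead of
  all.\<close>

definition diff_atlas :: "('m, 'e::real_inner) chart set \<Rightarrow> bool" where
  "diff_atlas A \<longleftrightarrow> (\<forall>c\<in>A. is_chart c) \<and>
     (\<forall>c\<in>A. \<forall>d\<in>A. open (snd c ` (fst c \<inter> fst d)) \<and>
        (\<forall>p\<in>fst c \<inter> fst d. (snd d \<circ> chart_inv c) differentiable at (snd c p)))"

text \<open>The eventuality clause is continuity in the form that the chain rule uses: nearby points
  are mapped into the target chart, where its inverse cancels.\<close>

definition diff_rep ::
  "('m, 'e::real_inner) chart \<Rightarrow> ('n, 'f::real_inner) chart \<Rightarrow> ('m \<Rightarrow> 'n) \<Rightarrow> 'm \<Rightarrow> bool" where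
  "diff_rep c d f p \<longleftrightarrow> p \<in> fst c \<and> f p \<in> fst d \<and>
     eventually (\<lambda>x. x \<in> snd c ` fst c \<and> f (chart_inv c x) \<in> fst d) (nhds (snd c p)) \<and>
     (snd d \<circ> f \<circ> chart_inv c) differentiable at (snd c p)"

definition mdiff ::
  "('m, 'e::real_inner) chart set \<Rightarrow> ('n, 'f::real_inner) chart set \<Rightarrow> ('m \<Rightarrow> 'n) \<Rightarrow> 'm \<Rightarrow> bool" where
  "mdiff A B f p \<longleftrightarrow> p \<in> mcarrier A \<and> f p \<in> mcarrier B \<and>
     (\<forall>c\<in>charts_at A p. \<forall>d\<in>charts_at B (f p). diff_rep c d f p)"

lemma diff_atlas_chart: "diff_atlas A \<Longrightarrow> c \<in> charts_at A p \<Longrightarrow> is_chart c"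
  by (auto simp: diff_atlas_def charts_at_def)

lemma charts_atD: "c \<in> charts_at A p \<Longrightarrow> p \<in> fst c" "c \<in> charts_at A p \<Longrightarrow> c \<in> A"
  by (auto simp: charts_at_def)

lemma chart_at_in: "p \<in> mcarrier A \<Longrightarrow> chart_at A p \<in> charts_at A p"
  unfolding chart_at_def by (rule someI_ex) (auto simp: mcarrier_def charts_at_def)

lemma charts_at_mcarrier: "c \<in> charts_at A p \<Longrightarrow> p \<in> mcarrier A"
  by (auto simp: mcarrier_def charts_at_def)

lemma chart_inv_eq: "is_chart c \<Longrightarrow> p \<in> fst c \<Longrightarrow> chart_inv c (snd c p) = p"
  by (simp add: is_chart_def chart_inv_def)

lemma chart_inv_in: "x \<in> snd c ` fst c \<Longrightarrow> chart_inv c x \<in> fst c"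
  by (simp add: chart_inv_def inv_into_into)

lemma chart_inv_right: "x \<in> snd c ` fst c \<Longrightarrow> snd c (chart_inv c x) = x"
  by (simp add: chart_inv_def f_inv_into_f)

lemma eventually_chart:
  "is_chart c \<Longrightarrow> p \<in> fst c \<Longrightarrow> eventually (\<lambda>x. x \<in> snd c ` fst c) (nhds (snd c p))"
  by (auto simp: is_chart_def eventually_nhds)

text \<open>Transition maps are the representations of \<open>id\<close>; every change of chart thus
  becomes an instance of the chain rule \<open>diff_rep_comp\<close>.\<close>

lemma diff_rep_id:
  assumes A: "diff_atlas A" and c: "c \<in> charts_at A p" and d: "d \<in> charts_at A p"
  shows "diff_rep c d id p"
proof -
  have o: "open (snd c ` (fst c \<inter> fst d))" and ch: "is_chart c"
    using assms by (auto simp: diff_atlas_def charts_at_def)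
  have "eventually (\<lambda>x. x \<in> snd c ` (fst c \<inter> fst d)) (nhds (snd c p))"
    using o charts_atD(1)[OF c] charts_atD(1)[OF d] by (intro eventually_nhds_in_open) simp_all
  then have "eventually (\<lambda>x. x \<in> snd c ` fst c \<and> id (chart_inv c x) \<in> fst d) (nhds (snd c p))"
    by eventually_elim (auto simp: chart_inv_eq[OF ch])
  then show ?thesis using assms by (auto simp: diff_rep_def diff_atlas_def charts_at_def)
qed

text \<open>The chain rule through a middle chart \<open>d\<close>. Inserting
  \<open>chart_inv d\<close> after \<open>snd d\<close> changes nothing near the point, and
  derivatives see only a neighbourhood.\<close>

lemma diff_rep_comp:
  assumes d: "is_chart d" and f: "diff_rep c d f p" and g: "diff_rep d e g (f p)" and c: "is_chart c"
  shows "diff_rep c e (g \<circ> f) p"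
    and "frechet_derivative (snd e \<circ> (g \<circ> f) \<circ> chart_inv c) (at (snd c p)) =
         frechet_derivative (snd e \<circ> g \<circ> chart_inv d) (at (snd d (f p))) \<circ>
         frechet_derivative (snd d \<circ> f \<circ> chart_inv c) (at (snd c p))"
proof -
  let ?F = "snd d \<circ> f \<circ> chart_inv c" and ?G = "snd e \<circ> g \<circ> chart_inv d"
  have p: "p \<in> fst c" "f p \<in> fst d" "g (f p) \<in> fst e" using f g by (auto simp: diff_rep_def)
  have Fp: "?F (snd c p) = snd d (f p)" using p c by (simp add: chart_inv_eq)
  have dF: "?F differentiable at (snd c p)" and dG: "?G differentiable at (?F (snd c p))"
    using f g Fp by (auto simp: diff_rep_def)
  have evF: "eventually (\<lambda>x. x \<in> snd c ` fst c \<and> f (chart_inv c x) \<in> fst d) (nhds (snd c p))"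
    using f by (simp add: diff_rep_def)
  have "isCont ?F (snd c p)" using dF by (rule differentiable_imp_continuous_within)
  moreover have evG: "eventually (\<lambda>y. y \<in> snd d ` fst d \<and> g (chart_inv d y) \<in> fst e) (nhds (?F (snd c p)))"
    using g Fp by (simp add: diff_rep_def)
  ultimately have "eventually (\<lambda>x. ?F x \<in> snd d ` fst d \<and> g (chart_inv d (?F x)) \<in> fst e) (at (snd c p))"
    unfolding isCont_def by (blast dest: filterlim_iff[THEN iffD1])
  \<comment> \<open>Continuity gives the condition on a punctured neighbourhood; its truth at the
    point itself is added here.\<close>
  then have "eventually (\<lambda>x. ?F x \<in> snd d ` fst d \<and> g (chart_inv d (?F x)) \<in> fst e) (nhds (snd c p))"
    using eventually_nhds_x_imp_x[OF evG] by (simp only: eventually_nhds_conv_at)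
  with evF have ev: "eventually (\<lambda>x. x \<in> snd c ` fst c \<and> g (f (chart_inv c x)) \<in> fst e) (nhds (snd c p))"
    by eventually_elim (auto simp: chart_inv_eq[OF d])
  have eq: "eventually (\<lambda>x. (snd e \<circ> (g \<circ> f) \<circ> chart_inv c) x = (?G \<circ> ?F) x) (nhds (snd c p))"
    using evF by eventually_elim (auto simp: chart_inv_eq[OF d])
  have "(?G \<circ> ?F) differentiable at (snd c p)" by (rule differentiable_chain_at[OF dF dG])
  then show "diff_rep c e (g \<circ> f) p"
    using p ev frechet_derivative_cong_nhds(2)[OF eq] unfolding diff_rep_def o_apply[of g f] by blast
  show "frechet_derivative (snd e \<circ> (g \<circ> f) \<circ> chart_inv c) (at (snd c p)) =
         frechet_derivative ?G (at (snd d (f p))) \<circ> frechet_derivative ?F (at (snd c p))"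
    unfolding frechet_derivative_cong_nhds(1)[OF eq] frechet_derivative_compose[OF dF dG] unfolding Fp ..
qed

lemma mdiffD: "mdiff A B f p \<Longrightarrow> c \<in> charts_at A p \<Longrightarrow> d \<in> charts_at B (f p) \<Longrightarrow> diff_rep c d f p"
  by (simp add: mdiff_def)

text \<open>One pair of charts suffices: \<open>diff_rep_id\<close> is composed on either side to
  reach any other pair.\<close>

lemma mdiffI:
  assumes A: "diff_atlas A" and B: "diff_atlas B"
    and c: "c \<in> charts_at A p" and d: "d \<in> charts_at B (f p)" and r: "diff_rep c d f p"
  shows "mdiff A B f p"
  unfolding mdiff_def
proof (intro conjI ballI)
  fix c' d' assume c': "c' \<in> charts_at A p" and d': "d' \<in> charts_at B (f p)"
  have "diff_rep c d' (id \<circ> f) p"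
    using diff_rep_comp(1)[OF diff_atlas_chart[OF B d] r diff_rep_id[OF B d d'] diff_atlas_chart[OF A c]] .
  then have 1: "diff_rep c d' f (id p)" by (simp only: id_comp id_apply)
  show "diff_rep c' d' f p"
    using diff_rep_comp(1)[OF diff_atlas_chart[OF A c] diff_rep_id[OF A c' c] 1 diff_atlas_chart[OF A c']]
    by (simp only: comp_id)
qed (rule charts_at_mcarrier[OF c] charts_at_mcarrier[OF d])+

lemma mdiff_comp:
  assumes A: "diff_atlas A" and B: "diff_atlas B" and C: "diff_atlas C"
    and f: "mdiff A B f p" and g: "mdiff B C g (f p)"
  shows "mdiff A C (g \<circ> f) p"
proof -
  have c: "chart_at A p \<in> charts_at A p" "chart_at B (f p) \<in> charts_at B (f p)"
    "chart_at C (g (f p)) \<in> charts_at C (g (f p))"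
    using f g by (auto intro!: chart_at_in simp: mdiff_def)
  show ?thesis
    using diff_rep_comp(1)[OF diff_atlas_chart[OF B c(2)] mdiffD[OF f c(1,2)] mdiffD[OF g c(2,3)]
        diff_atlas_chart[OF A c(1)]] c
    by (intro mdiffI[OF A C c(1)]) auto
qed

lemma smooth_map_mdiff:
  assumes A: "diff_atlas A" and B: "diff_atlas B" and f: "smooth_map A B f"
    and p: "p \<in> mcarrier A" "f p \<in> mcarrier B"
  shows "mdiff A B f p"
  unfolding mdiff_def
proof (intro conjI ballI p)
  fix c d assume c: "c \<in> charts_at A p" and d: "d \<in> charts_at B (f p)"
  let ?S = "snd c ` (fst c \<inter> f -` fst d)"
  have s: "smooth_on ?S (snd d \<circ> f \<circ> chart_inv c)"
    using f charts_atD[OF c] charts_atD[OF d] by (simp add: smooth_map_def)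
  have pS: "snd c p \<in> ?S" using charts_atD[OF c] charts_atD[OF d] by simp
  have "eventually (\<lambda>x. x \<in> ?S) (nhds (snd c p))"
    using smooth_on_open[OF s] pS by (rule eventually_nhds_in_open)
  then have "eventually (\<lambda>x. x \<in> snd c ` fst c \<and> f (chart_inv c x) \<in> fst d) (nhds (snd c p))"
    by eventually_elim (auto simp: chart_inv_eq[OF diff_atlas_chart[OF A c]])
  then show "diff_rep c d f p"
    using smooth_on_differentiable[OF s pS] charts_atD[OF c] charts_atD[OF d] by (simp add: diff_rep_def)
qed

lemma smooth_atlas_diff_atlas: "smooth_atlas A \<Longrightarrow> diff_atlas A"
  unfolding smooth_atlas_def diff_atlas_def using smooth_on_open smooth_on_differentiable by blast

section \<open>Tangent maps\<close>

text \<open>The compatibility condition of a tangent vector is the cocycle identity of the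
  transition maps, that is, the chain rule for \<open>id\<close> after \<open>id\<close>.\<close>

lemma coord_tvec_in:
  assumes A: "diff_atlas A" and c: "c \<in> charts_at A p"
  shows "coord_tvec A c p u \<in> tangent_space A p"
  unfolding tangent_space_def coord_tvec_def
proof (intro CollectI conjI ballI allI impI)
  fix d e assume d: "d \<in> charts_at A p" and e: "e \<in> charts_at A p"
  have "diff_rep d e id (id p)" using diff_rep_id[OF A d e] by simp
  from diff_rep_comp(2)[OF diff_atlas_chart[OF A d] diff_rep_id[OF A c d] this diff_atlas_chart[OF A c]]
  show "(if e \<in> charts_at A p then frechet_derivative (snd e \<circ> chart_inv c) (at (snd c p)) u else 0) =
       frechet_derivative (snd e \<circ> chart_inv d) (at (snd d p))
        (if d \<in> charts_at A p then frechet_derivative (snd d \<circ> chart_inv c) (at (snd c p)) u else 0)"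
    using d e unfolding comp_id id_comp by (simp add: fun_eq_iff)
qed simp

lemma coord_tvec_chart:
  assumes A: "diff_atlas A" and c: "c \<in> charts_at A p"
  shows "coord_tvec A c p u c = u"
proof -
  have "eventually (\<lambda>x. (snd c \<circ> chart_inv c) x = id x) (nhds (snd c p))"
    using eventually_chart[OF diff_atlas_chart[OF A c] charts_atD(1)[OF c]]
    by eventually_elim (simp add: chart_inv_right)
  from frechet_derivative_cong_nhds(1)[OF this] have "frechet_derivative (snd c \<circ> chart_inv c) (at (snd c p)) u = u"
    by (simp add: id_def del: o_apply)
  then show ?thesis using c by (simp add: coord_tvec_def)
qed

lemma tangent_spaceD:
  assumes "v \<in> tangent_space A p"
  shows "\<lbrakk>c \<in> charts_at A p; d \<in> charts_at A p\<rbrakk> \<Longrightarrow>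
           v d = frechet_derivative (snd d \<circ> chart_inv c) (at (snd c p)) (v c)"
    and "c \<notin> charts_at A p \<Longrightarrow> v c = 0"
  using assms unfolding tangent_space_def by blast+

lemma coord_tvec_self:
  assumes c: "c \<in> charts_at A p" and v: "v \<in> tangent_space A p"
  shows "coord_tvec A c p (v c) = v"
proof
  fix d show "coord_tvec A c p (v c) d = v d"
    by (cases "d \<in> charts_at A p")
       (simp_all add: coord_tvec_def tangent_spaceD(1)[OF v c, symmetric] tangent_spaceD(2)[OF v])
qed

text \<open>The standard way to prove vectors equal: the transition maps recover the whole family
  from one coordinate vector.\<close>

lemma tangent_space_eqI:
  assumes "c \<in> charts_at A p" "v \<in> tangent_space A p" "w \<in> tangent_space A p" "v c = w c"
  shows "v = w"
  using coord_tvec_self[OF assms(1,2)] coord_tvec_self[OF assms(1,3)] assms(4) by metis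

lemma coord_tvec_linear:
  assumes A: "diff_atlas A" and c: "c \<in> charts_at A p"
  shows "coord_tvec A c p (a *\<^sub>R u + b *\<^sub>R w) = (\<lambda>d. a *\<^sub>R coord_tvec A c p u d + b *\<^sub>R coord_tvec A c p w d)"
proof
  fix d
  show "coord_tvec A c p (a *\<^sub>R u + b *\<^sub>R w) d = a *\<^sub>R coord_tvec A c p u d + b *\<^sub>R coord_tvec A c p w d"
  proof (cases "d \<in> charts_at A p")
    case True
    have "linear (frechet_derivative (snd d \<circ> chart_inv c) (at (snd c p)))"
      using diff_rep_id[OF A c True] by (intro linear_frechet_derivative) (simp add: diff_rep_def)
    then show ?thesis using True by (simp add: coord_tvec_def linear_add linear_scale)
  qed (simp add: coord_tvec_def)
qed

lemma tangent_space_linear: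
  assumes A: "diff_atlas A" and p: "p \<in> mcarrier A"
    and v: "v \<in> tangent_space A p" and w: "w \<in> tangent_space A p"
  shows "(\<lambda>c. a *\<^sub>R v c + b *\<^sub>R w c) \<in> tangent_space A p"
proof -
  note c = chart_at_in[OF p]
  have "(\<lambda>d. a *\<^sub>R v d + b *\<^sub>R w d) =
    coord_tvec A (chart_at A p) p (a *\<^sub>R v (chart_at A p) + b *\<^sub>R w (chart_at A p))"
    by (simp add: coord_tvec_linear[OF A c] coord_tvec_self[OF c v] coord_tvec_self[OF c w])
  then show ?thesis using coord_tvec_in[OF A c] by simp
qed

lemma fst_tangent_map [simp]: "fst (tangent_map A B f z) = f (fst z)"
  by (simp add: tangent_map_def split: prod.split)

text \<open>Frees \<open>tangent_map\<close> from the arbitrary chart \<open>chart_at A p\<close> of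
  its definition.\<close>

lemma tangent_map_rep:
  assumes A: "diff_atlas A" and f: "mdiff A B f p" and v: "v \<in> tangent_space A p"
    and c: "c \<in> charts_at A p" and d: "d \<in> charts_at B (f p)"
  shows "snd (tangent_map A B f (p, v)) d =
         frechet_derivative (snd d \<circ> f \<circ> chart_inv c) (at (snd c p)) (v c)"
proof -
  define c0 where "c0 = chart_at A p"
  have c0: "c0 \<in> charts_at A p" unfolding c0_def using f by (intro chart_at_in) (simp add: mdiff_def)
  have r: "diff_rep c d f (id p)" using mdiffD[OF f c d] by simp
  have vc: "v c = frechet_derivative (snd c \<circ> chart_inv c0) (at (snd c0 p)) (v c0)"
    by (rule tangent_spaceD(1)[OF v c0 c])
  show ?thesis
    using diff_rep_comp(2)[OF diff_atlas_chart[OF A c] diff_rep_id[OF A c0 c] r diff_atlas_chart[OF A c0]]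
    unfolding comp_id by (simp add: tangent_map_def d c0_def[symmetric] vc)
qed

text \<open>Holds for every \<open>v\<close>: only one coordinate vector of \<open>v\<close> is
  read, and the result is spread over all target charts by transition maps.\<close>

lemma tangent_map_in:
  assumes A: "diff_atlas A" and B: "diff_atlas B" and f: "mdiff A B f p"
  shows "snd (tangent_map A B f (p, v)) \<in> tangent_space B (f p)"
proof -
  define c0 where "c0 = chart_at A p"
  have c0: "c0 \<in> charts_at A p" unfolding c0_def using f by (intro chart_at_in) (simp add: mdiff_def)
  define d0 where "d0 = chart_at B (f p)"
  have d0: "d0 \<in> charts_at B (f p)" unfolding d0_def using f by (intro chart_at_in) (simp add: mdiff_def)
  have "snd (tangent_map A B f (p, v)) =
     coord_tvec B d0 (f p) (frechet_derivative (snd d0 \<circ> f \<circ> chart_inv c0) (at (snd c0 p)) (v c0))"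
  proof
    fix d
    show "snd (tangent_map A B f (p, v)) d =
     coord_tvec B d0 (f p) (frechet_derivative (snd d0 \<circ> f \<circ> chart_inv c0) (at (snd c0 p)) (v c0)) d"
    proof (cases "d \<in> charts_at B (f p)")
      case True
      show ?thesis
        using diff_rep_comp(2)[OF diff_atlas_chart[OF B d0] mdiffD[OF f c0 d0] diff_rep_id[OF B d0 True]
            diff_atlas_chart[OF A c0]] True
        unfolding comp_id id_comp by (simp add: tangent_map_def c0_def[symmetric] coord_tvec_def)
    qed (simp add: tangent_map_def coord_tvec_def)
  qed
  then show ?thesis using coord_tvec_in[OF B d0] by simp
qed

lemma tangent_map_comp:
  assumes A: "diff_atlas A" and B: "diff_atlas B" and C: "diff_atlas C"
    and f: "mdiff A B f p" and g: "mdiff B C g (f p)" and v: "v \<in> tangent_space A p"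
  shows "snd (tangent_map A C (g \<circ> f) (p, v)) =
         snd (tangent_map B C g (f p, snd (tangent_map A B f (p, v))))"
proof -
  have c: "chart_at A p \<in> charts_at A p" "chart_at B (f p) \<in> charts_at B (f p)"
    "chart_at C (g (f p)) \<in> charts_at C (g (f p))"
    using f g by (auto intro!: chart_at_in simp: mdiff_def)
  note gf = mdiff_comp[OF A B C f g]
  have in1: "snd (tangent_map A C (g \<circ> f) (p, v)) \<in> tangent_space C (g (f p))"
    using tangent_map_in[OF A C gf] by simp
  have c3: "chart_at C (g (f p)) \<in> charts_at C ((g \<circ> f) p)" using c(3) by simp
  show ?thesis
  proof (rule tangent_space_eqI[OF c(3) in1 tangent_map_in[OF B C g]])
    show "snd (tangent_map A C (g \<circ> f) (p, v)) (chart_at C (g (f p))) =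
      snd (tangent_map B C g (f p, snd (tangent_map A B f (p, v)))) (chart_at C (g (f p)))"
      unfolding tangent_map_rep[OF A gf v c(1) c3]
        tangent_map_rep[OF B g tangent_map_in[OF A B f] c(2,3)] tangent_map_rep[OF A f v c(1,2)]
        diff_rep_comp(2)[OF diff_atlas_chart[OF B c(2)] mdiffD[OF f c(1,2)] mdiffD[OF g c(2,3)]
          diff_atlas_chart[OF A c(1)]] by simp
  qed
qed

lemma tangent_map_id:
  assumes A: "diff_atlas A" and p: "p \<in> mcarrier A" and v: "v \<in> tangent_space A p"
  shows "snd (tangent_map A A id (p, v)) = v"
proof
  fix d
  show "snd (tangent_map A A id (p, v)) d = v d"
    by (cases "d \<in> charts_at A p")
       (simp_all add: tangent_map_def tangent_spaceD(1)[OF v chart_at_in[OF p], symmetric] tangent_spaceD(2)[OF v])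
qed

lemma rep_cong:
  assumes A: "diff_atlas A" and c: "c \<in> charts_at A p" and fg: "\<And>x. x \<in> mcarrier A \<Longrightarrow> f x = g x"
  shows "frechet_derivative (k \<circ> f \<circ> chart_inv c) (at (snd c p)) =
         frechet_derivative (k \<circ> g \<circ> chart_inv c) (at (snd c p))"
proof (rule frechet_derivative_cong_nhds(1))
  show "eventually (\<lambda>x. (k \<circ> f \<circ> chart_inv c) x = (k \<circ> g \<circ> chart_inv c) x) (nhds (snd c p))"
    using eventually_chart[OF diff_atlas_chart[OF A c] charts_atD(1)[OF c]]
  proof eventually_elim
    case (elim x)
    then have "chart_inv c x \<in> mcarrier A"
      using chart_inv_in[of x c] charts_atD(2)[OF c] by (force simp: mcarrier_def)
    then show ?case by (simp add: fg)
  qed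
qed

lemma tangent_map_cong:
  assumes A: "diff_atlas A" and p: "p \<in> mcarrier A" and fg: "\<And>x. x \<in> mcarrier A \<Longrightarrow> f x = g x"
  shows "tangent_map A B f (p, v) = tangent_map A B g (p, v)"
proof -
  have "frechet_derivative (snd d \<circ> f \<circ> chart_inv (chart_at A p)) (at (snd (chart_at A p) p)) =
    frechet_derivative (snd d \<circ> g \<circ> chart_inv (chart_at A p)) (at (snd (chart_at A p) p))"
    if "d \<in> B" for d
    by (rule rep_cong[OF A chart_at_in[OF p] fg])
  then show ?thesis by (auto simp: tangent_map_def fg[OF p] charts_at_def fun_eq_iff)
qed

lemma tangent_map_linear:
  assumes f: "mdiff A B f p"
  shows "snd (tangent_map A B f (p, \<lambda>c. a *\<^sub>R v c + b *\<^sub>R w c)) =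
     (\<lambda>d. a *\<^sub>R snd (tangent_map A B f (p, v)) d + b *\<^sub>R snd (tangent_map A B f (p, w)) d)"
proof
  fix d
  have c: "chart_at A p \<in> charts_at A p" using f by (intro chart_at_in) (simp add: mdiff_def)
  show "snd (tangent_map A B f (p, \<lambda>c. a *\<^sub>R v c + b *\<^sub>R w c)) d =
     a *\<^sub>R snd (tangent_map A B f (p, v)) d + b *\<^sub>R snd (tangent_map A B f (p, w)) d"
  proof (cases "d \<in> charts_at B (f p)")
    case True
    have "linear (frechet_derivative (snd d \<circ> f \<circ> chart_inv (chart_at A p)) (at (snd (chart_at A p) p)))"
      using mdiffD[OF f c True] by (intro linear_frechet_derivative) (simp add: diff_rep_def)
    then show ?thesis using True by (simp add: tangent_map_def linear_add linear_scale)
  qed (simp add: tangent_map_def)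
qed

section \<open>Differentials of functions\<close>

lemma charts_at_real_atlas [simp]: "charts_at real_atlas x = {(UNIV, id)}"
  by (auto simp: charts_at_def real_atlas_def)

lemma diff_atlas_real: "diff_atlas real_atlas"
proof -
  have "chart_inv (UNIV, id) = (\<lambda>x :: real. x)" by (auto simp: chart_inv_def inv_id)
  then show ?thesis by (simp add: diff_atlas_def real_atlas_def is_chart_def id_def o_def)
qed

lemma mcarrier_real_atlas [simp]: "mcarrier real_atlas = UNIV"
  by (auto simp: mcarrier_def real_atlas_def)

lemma mdiff_real_differentiable:
  assumes "mdiff A real_atlas f p" "c \<in> charts_at A p"
  shows "(f \<circ> chart_inv c) differentiable at (snd c p)"
  using mdiffD[OF assms, of "(UNIV, id)"] by (simp add: diff_rep_def)

text \<open>Viewing the differential as a tangent map into the one-chart manifold of reals transfers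
  chart independence and the chain rule to it.\<close>

lemma differential_tangent_map:
  "differential A f p v = snd (tangent_map A real_atlas f (p, v)) (UNIV, id)"
  by (simp add: differential_def tangent_map_def)

lemma differential_rep:
  assumes A: "diff_atlas A" and c: "c \<in> charts_at A p" and v: "v \<in> tangent_space A p"
    and f: "mdiff A real_atlas f p"
  shows "differential A f p v = frechet_derivative (f \<circ> chart_inv c) (at (snd c p)) (v c)"
  using tangent_map_rep[OF A f v c, of "(UNIV, id)"] by (simp add: differential_tangent_map)

lemma differential_comp:
  assumes A: "diff_atlas A" and B: "diff_atlas B"
    and f: "mdiff A B f p" and g: "mdiff B real_atlas g (f p)" and v: "v \<in> tangent_space A p"
  shows "differential A (g \<circ> f) p v = differential B g (f p) (snd (tangent_map A B f (p, v)))"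
  using tangent_map_comp[OF A B diff_atlas_real f g v] by (simp add: differential_tangent_map)

lemma differential_cong:
  assumes A: "diff_atlas A" and p: "p \<in> mcarrier A" and fg: "\<And>x. x \<in> mcarrier A \<Longrightarrow> f x = g x"
  shows "differential A f p v = differential A g p v"
  by (simp add: differential_tangent_map tangent_map_cong[OF A p fg])

section \<open>The cotangent bundle\<close>

locale finite_dim_atlas =
  fixes A :: "('m, 'e::real_inner) chart set" and E :: "'e set"
  assumes smooth: "smooth_atlas A" and E: "expansion_basis E"
begin

abbreviation TA where "TA \<equiv> cotangent_atlas A"

lemma diff_atlas_base: "diff_atlas A" by (rule smooth_atlas_diff_atlas[OF smooth])

lemma chart: "c \<in> A \<Longrightarrow> is_chart c" using diff_atlas_base by (simp add: diff_atlas_def)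

text \<open>The inverse of the fibre coordinate of \<open>cotangent_chart\<close>. The value 0 off
  the tangent space is the normalisation demanded by \<open>cotangent_space\<close>.\<close>

definition covec_of :: "('m, 'e) chart \<Rightarrow> 'm \<Rightarrow> 'e \<Rightarrow> ('m, 'e) covec" where
  "covec_of c q a = (\<lambda>v. if v \<in> tangent_space A q then a \<bullet> v c else 0)"

lemma covec_linear:
  assumes "c \<in> charts_at A q" "\<alpha> \<in> cotangent_space A q"
  shows "linear (\<lambda>u. \<alpha> (coord_tvec A c q u))"
proof (rule linearI)
  have eq: "\<alpha> (coord_tvec A c q (a *\<^sub>R u + b *\<^sub>R w)) = a * \<alpha> (coord_tvec A c q u) + b * \<alpha> (coord_tvec A c q w)"
    for a b u w
    using assms(2) coord_tvec_in[OF diff_atlas_base assms(1)]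
    unfolding coord_tvec_linear[OF diff_atlas_base assms(1)] cotangent_space_def by blast
  show "\<alpha> (coord_tvec A c q (u + w)) = \<alpha> (coord_tvec A c q u) + \<alpha> (coord_tvec A c q w)" for u w
    using eq[of 1 u 1 w] by simp
  show "\<alpha> (coord_tvec A c q (a *\<^sub>R u)) = a *\<^sub>R \<alpha> (coord_tvec A c q u)" for a u
    using eq[of a u 0 u] by simp
qed

text \<open>Settles the \<open>THE\<close> in \<open>cotangent_chart\<close>: \<open>riesz\<close>
  gives existence and \<open>riesz_unique\<close> uniqueness of the representing vector.\<close>

lemma cotangent_chart_coords:
  assumes "c \<in> charts_at A q" "\<alpha> \<in> cotangent_space A q"
  shows "snd (snd (cotangent_chart A c) (q, \<alpha>)) \<bullet> u = \<alpha> (coord_tvec A c q u)"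
proof -
  let ?r = "\<Sum>e\<in>E. \<alpha> (coord_tvec A c q e) *\<^sub>R e"
  have r: "?r \<bullet> u = \<alpha> (coord_tvec A c q u)" for u
    by (rule riesz[OF E covec_linear[OF assms]])
  have "(THE a. \<forall>u. a \<bullet> u = \<alpha> (coord_tvec A c q u)) = ?r"
  proof (rule the_equality)
    show "\<forall>u. ?r \<bullet> u = \<alpha> (coord_tvec A c q u)" using r by blast
    fix a assume "\<forall>u. a \<bullet> u = \<alpha> (coord_tvec A c q u)"
    then have "a \<bullet> u = ?r \<bullet> u" for u by (simp only: r)
    then show "a = ?r" by (rule riesz_unique)
  qed
  then show ?thesis by (simp only: cotangent_chart_def snd_conv prod.case r)
qed

lemma covec_apply:
  assumes "c \<in> charts_at A q" "\<alpha> \<in> cotangent_space A q" "v \<in> tangent_space A q"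
  shows "\<alpha> v = snd (snd (cotangent_chart A c) (q, \<alpha>)) \<bullet> v c"
  using cotangent_chart_coords[OF assms(1,2), of "v c"] coord_tvec_self[OF assms(1,3)] by simp

lemma covec_of_in:
  assumes "c \<in> charts_at A q" shows "covec_of c q a \<in> cotangent_space A q"
  using tangent_space_linear[OF diff_atlas_base charts_at_mcarrier[OF assms]]
  by (auto simp: cotangent_space_def covec_of_def inner_add_right)

lemma covec_of_coords:
  assumes "c \<in> charts_at A q"
  shows "snd (cotangent_chart A c) (q, covec_of c q a) = (snd c q, a)"
proof -
  have "snd (snd (cotangent_chart A c) (q, covec_of c q a)) = a"
    by (rule riesz_unique)
       (simp add: cotangent_chart_coords[OF assms covec_of_in[OF assms]],
        simp add: covec_of_def coord_tvec_in[OF diff_atlas_base assms] coord_tvec_chart[OF diff_atlas_base assms])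
  then show ?thesis by (simp add: cotangent_chart_def)
qed

lemma covec_of_self:
  assumes "c \<in> charts_at A q" "\<alpha> \<in> cotangent_space A q"
  shows "covec_of c q (snd (snd (cotangent_chart A c) (q, \<alpha>))) = \<alpha>"
proof
  fix v show "covec_of c q (snd (snd (cotangent_chart A c) (q, \<alpha>))) v = \<alpha> v"
    using covec_apply[OF assms, of v] assms(2) by (auto simp: covec_of_def cotangent_space_def)
qed

lemma fst_cotangent_chart [simp]:
  "fst (cotangent_chart A c) = Sigma (fst c) (cotangent_space A)"
  "fst (snd (cotangent_chart A c) z) = snd c (fst z)"
  by (simp_all add: cotangent_chart_def split: prod.split)

lemma charts_at_cotangent:
  "C \<in> charts_at TA z \<longleftrightarrow> snd z \<in> cotangent_space A (fst z) \<and> (\<exists>c\<in>charts_at A (fst z). C = cotangent_chart A c)"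
proof -
  have "z \<in> fst (cotangent_chart A c) \<longleftrightarrow> snd z \<in> cotangent_space A (fst z) \<and> fst z \<in> fst c" for c
    by (cases z) auto
  then show ?thesis by (auto simp only: charts_at_def cotangent_atlas_def)
qed

lemma mcarrier_cotangent: "mcarrier TA = cotangent_bundle A"
  by (auto simp add: mcarrier_def cotangent_atlas_def UN_simps fst_cotangent_chart simp del: UN_iff)

lemma cotangent_chart_image:
  assumes "c \<in> A" "U \<subseteq> fst c"
  shows "snd (cotangent_chart A c) ` Sigma U (cotangent_space A) = (snd c ` U) \<times> UNIV"
proof (intro equalityI subsetI)
  fix x :: "'e \<times> 'e" assume "x \<in> snd (cotangent_chart A c) ` Sigma U (cotangent_space A)"
  then show "x \<in> (snd c ` U) \<times> UNIV" by (auto simp: cotangent_chart_def)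
next
  fix x :: "'e \<times> 'e" assume "x \<in> (snd c ` U) \<times> UNIV"
  then obtain q a where q: "q \<in> U" "x = (snd c q, a)" by auto
  have c: "c \<in> charts_at A q" using assms q by (auto simp: charts_at_def)
  show "x \<in> snd (cotangent_chart A c) ` Sigma U (cotangent_space A)"
    using covec_of_coords[OF c, of a] covec_of_in[OF c, of a] q by (intro image_eqI[of _ _ "(q, covec_of c q a)"]) auto
qed

lemma cotangent_chart_inj:
  assumes c: "c \<in> A" shows "inj_on (snd (cotangent_chart A c)) (fst (cotangent_chart A c))"
proof (rule inj_onI)
  fix z w assume z: "z \<in> fst (cotangent_chart A c)" and w: "w \<in> fst (cotangent_chart A c)"
    and eq: "snd (cotangent_chart A c) z = snd (cotangent_chart A c) w"
  have "snd c (fst z) = snd c (fst w)" using arg_cong[OF eq, of fst] by simp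
  then have f: "fst z = fst w" using z w diff_atlas_base c by (auto simp: diff_atlas_def is_chart_def inj_on_def)
  have cz: "c \<in> charts_at A (fst z)" using z c by (auto simp: charts_at_def)
  have "covec_of c (fst z) (snd (snd (cotangent_chart A c) (fst z, snd z))) = snd z"
    "covec_of c (fst z) (snd (snd (cotangent_chart A c) (fst z, snd w))) = snd w"
    using z w f covec_of_self[OF cz] by auto
  then show "z = w" using eq f by (metis prod.collapse)
qed

lemma cotangent_chart_is_chart:
  assumes c: "c \<in> A" shows "is_chart (cotangent_chart A c)"
  using cotangent_chart_inj[OF c] cotangent_chart_image[OF c, of "fst c"] diff_atlas_base c
  by (auto simp: is_chart_def diff_atlas_def intro: open_Times)

lemma cotangent_chart_inv:
  assumes c: "c \<in> A" and x: "x \<in> snd c ` fst c"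
  shows "chart_inv (cotangent_chart A c) (x, a) = (chart_inv c x, covec_of c (chart_inv c x) a)"
proof -
  have q: "chart_inv c x \<in> fst c" using chart_inv_in[OF x] .
  then have cq: "c \<in> charts_at A (chart_inv c x)" using c by (simp add: charts_at_def)
  have "snd (cotangent_chart A c) (chart_inv c x, covec_of c (chart_inv c x) a) = (x, a)"
    by (simp add: covec_of_coords[OF cq] chart_inv_right[OF x])
  then show ?thesis
    using chart_inv_eq[OF cotangent_chart_is_chart[OF c], of "(chart_inv c x, covec_of c (chart_inv c x) a)"]
      q covec_of_in[OF cq] by simp
qed

text \<open>Momenta transform by the transpose of the derivative of the inverse transition map; the
  sum over \<open>E\<close> writes out this transpose.\<close>

lemma cotangent_transition:
  assumes c: "c \<in> A" and d: "d \<in> A" and x: "x \<in> snd c ` (fst c \<inter> fst d)"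
  shows "(snd (cotangent_chart A d) \<circ> chart_inv (cotangent_chart A c)) (x, a) =
    ((snd d \<circ> chart_inv c) x,
     \<Sum>e\<in>E. (a \<bullet> frechet_derivative (snd c \<circ> chart_inv d) (at ((snd d \<circ> chart_inv c) x)) e) *\<^sub>R e)"
proof -
  let ?q = "chart_inv c x"
  have q: "?q \<in> fst c" "?q \<in> fst d"
    using x chart_inv_eq[OF chart[OF c]] by auto
  have cq: "c \<in> charts_at A ?q" and dq: "d \<in> charts_at A ?q" using c d q by (simp_all add: charts_at_def)
  have eq: "chart_inv (cotangent_chart A c) (x, a) = (?q, covec_of c ?q a)"
    using x by (intro cotangent_chart_inv[OF c]) auto
  let ?l = "\<lambda>u. a \<bullet> frechet_derivative (snd c \<circ> chart_inv d) (at (snd d ?q)) u"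
  have "(snd c \<circ> chart_inv d) differentiable at (snd d ?q)"
    using diff_atlas_base c d q by (auto simp: diff_atlas_def)
  then have l: "linear ?l"
    by (intro linearI) (simp_all add: inner_add_right linear_add[OF linear_frechet_derivative]
        linear_scale[OF linear_frechet_derivative])
  have "snd (snd (cotangent_chart A d) (?q, covec_of c ?q a)) \<bullet> u = ?l u" for u
    unfolding cotangent_chart_coords[OF dq covec_of_in[OF cq]]
    using coord_tvec_in[OF diff_atlas_base dq] cq by (simp add: covec_of_def) (simp add: coord_tvec_def)
  then have "snd (snd (cotangent_chart A d) (?q, covec_of c ?q a)) \<bullet> u = (\<Sum>e\<in>E. ?l e *\<^sub>R e) \<bullet> u" for u
    by (simp only: riesz[OF E l])
  then have "snd (snd (cotangent_chart A d) (?q, covec_of c ?q a)) = (\<Sum>e\<in>E. ?l e *\<^sub>R e)"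
    by (rule riesz_unique)
  then show ?thesis by (simp add: eq prod_eq_iff)
qed

text \<open>The fibre part of a transition contains a first derivative of a base transition, so its
  differentiability uses second-order smoothness of the base atlas.\<close>

lemma diff_atlas_cotangent: "diff_atlas TA"
  unfolding diff_atlas_def cotangent_atlas_def ball_simps
proof (intro conjI ballI)
  fix c d assume c: "c \<in> A" and d: "d \<in> A"
  let ?C = "cotangent_chart A c" and ?D = "cotangent_chart A d"
  have fst: "fst ?C \<inter> fst ?D = Sigma (fst c \<inter> fst d) (cotangent_space A)" by auto
  have im: "snd ?C ` (fst ?C \<inter> fst ?D) = (snd c ` (fst c \<inter> fst d)) \<times> UNIV"
    unfolding fst by (rule cotangent_chart_image[OF c]) simp
  have o: "open (snd c ` (fst c \<inter> fst d))" using diff_atlas_base c d by (simp add: diff_atlas_def)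
  show "open (snd ?C ` (fst ?C \<inter> fst ?D))" unfolding im using o by (simp add: open_Times)
  fix z assume z: "z \<in> fst ?C \<inter> fst ?D"
  define x where "x = snd c (fst z)"
  have x: "x \<in> snd c ` (fst c \<inter> fst d)" using z by (auto simp: x_def)
  obtain a where a: "snd ?C z = (x, a)" by (metis fst_cotangent_chart(2) prod.collapse x_def)
  let ?\<psi> = "\<lambda>y. \<lambda>e. frechet_derivative (snd c \<circ> chart_inv d) (at y) e"
  let ?\<phi> = "snd d \<circ> chart_inv c"
  have sm: "smooth_on (snd d ` (fst d \<inter> fst c)) (snd c \<circ> chart_inv d)" using smooth c d by (simp add: smooth_atlas_def)
  have d\<phi>: "?\<phi> differentiable at x"
    using diff_atlas_base c d x unfolding diff_atlas_def x_def by auto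
  have "?\<phi> x \<in> snd d ` (fst d \<inter> fst c)"
    using x chart_inv_eq[OF chart[OF c]] by auto
  then have "(\<lambda>y. ?\<psi> y e) differentiable at (?\<phi> x)" for e
    by (rule smooth_on_differentiable[OF smooth_on_frechet[OF sm]])
  then have "((\<lambda>y. ?\<psi> y e) \<circ> ?\<phi>) differentiable at x" for e
    by (intro differentiable_chain_at d\<phi>)
  moreover have "fst differentiable at (x, a)"
    by (intro bounded_linear_imp_differentiable bounded_linear_fst)
  ultimately have 1: "((\<lambda>y. ?\<psi> (?\<phi> y) e) \<circ> fst) differentiable at (x, a)" for e
    by (intro differentiable_chain_at) (simp_all add: o_def)
  have 2: "(?\<phi> \<circ> fst) differentiable at (x, a)"
    by (rule differentiable_chain_at) (simp_all add: d\<phi> bounded_linear_imp_differentiable bounded_linear_fst)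
  \<comment> \<open>The formula of \<open>cotangent_transition\<close> as a function on the whole
    model space; it agrees with the transition only near the point.\<close>
  let ?T = "\<lambda>z. ((?\<phi> \<circ> fst) z, \<Sum>e\<in>E. (snd z \<bullet> ((\<lambda>y. ?\<psi> (?\<phi> y) e) \<circ> fst) z) *\<^sub>R e)"
  have fE: "finite E" using E by (simp add: expansion_basis_def)
  have "?T differentiable at (x, a)"
  proof -
    obtain D2 where D2: "((?\<phi> \<circ> fst) has_derivative D2) (at (x, a))" using 2 by (auto simp: differentiable_def)
    have "\<forall>e. \<exists>D1. (((\<lambda>y. ?\<psi> (?\<phi> y) e) \<circ> fst) has_derivative D1) (at (x, a))"
      using 1 by (simp add: differentiable_def)
    then obtain D1 where D1: "\<And>e. (((\<lambda>y. ?\<psi> (?\<phi> y) e) \<circ> fst) has_derivative D1 e) (at (x, a))" by metis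
    have "(?T has_derivative (\<lambda>h. (D2 h, \<Sum>e\<in>E. (snd (x, a) \<bullet> D1 e h +
        snd h \<bullet> ((\<lambda>y. ?\<psi> (?\<phi> y) e) \<circ> fst) (x, a)) *\<^sub>R e))) (at (x, a))"
      by (intro has_derivative_Pair D2 has_derivative_sum has_derivative_scaleR_left has_derivative_inner D1
          has_derivative_snd has_derivative_ident)
    then show ?thesis unfolding differentiable_def by blast
  qed
  moreover have "eventually (\<lambda>y. (snd ?D \<circ> chart_inv ?C) y = ?T y) (nhds (x, a))"
  proof -
    have "eventually (\<lambda>y. y \<in> (snd c ` (fst c \<inter> fst d)) \<times> UNIV) (nhds (x, a))"
      using o x by (intro eventually_nhds_in_open open_Times) auto
    then show ?thesis
    proof eventually_elim
      case (elim y)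
      then show ?case using cotangent_transition[OF c d, of "fst y" "snd y"] by auto
    qed
  qed
  ultimately show "(snd ?D \<circ> chart_inv ?C) differentiable at (snd ?C z)"
    unfolding a by (subst frechet_derivative_cong_nhds(2))
next
  fix c assume "c \<in> A"
  then show "is_chart (cotangent_chart A c)" by (rule cotangent_chart_is_chart)
qed


section \<open>The canonical symplectic form\<close>

lemma cotangent_chart_at:
  "c \<in> charts_at A (fst z) \<Longrightarrow> snd z \<in> cotangent_space A (fst z) \<Longrightarrow> cotangent_chart A c \<in> charts_at TA z"
  by (auto simp: charts_at_cotangent)

lemma bundleD: "z \<in> cotangent_bundle A \<Longrightarrow> fst z \<in> mcarrier A" "z \<in> cotangent_bundle A \<Longrightarrow> snd z \<in> cotangent_space A (fst z)"
  by auto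

lemma chart_at_cotangent:
  assumes z: "z \<in> cotangent_bundle A"
  obtains c where "c \<in> charts_at A (fst z)" "chart_at TA z = cotangent_chart A c"
    "cotangent_chart A c \<in> charts_at TA z"
proof -
  have "chart_at TA z \<in> charts_at TA z" using z by (intro chart_at_in) (simp only: mcarrier_cotangent)
  then show ?thesis using that by (auto simp: charts_at_cotangent)
qed

lemma fst_rep:
  assumes z: "snd z \<in> cotangent_space A (fst z)" and c: "c \<in> charts_at A (fst z)"
  shows "eventually (\<lambda>y. (snd c \<circ> fst \<circ> chart_inv (cotangent_chart A c)) y = fst y) (nhds (snd (cotangent_chart A c) z))"
proof -
  let ?C = "cotangent_chart A c"
  have C: "?C \<in> charts_at TA z" using cotangent_chart_at[OF c z] .
  show ?thesis
    using eventually_chart[OF diff_atlas_chart[OF diff_atlas_cotangent C] charts_atD(1)[OF C]]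
  proof eventually_elim
    case (elim y)
    have "snd c (fst (chart_inv ?C y)) = fst (snd ?C (chart_inv ?C y))" by simp
    then show ?case by (simp only: chart_inv_right[OF elim] o_apply)
  qed
qed

lemma fst_differentiable: "fst differentiable at x"
  by (simp add: bounded_linear_imp_differentiable bounded_linear_fst)

lemma frechet_derivative_fst: "frechet_derivative fst (at x) = fst"
  by (rule frechet_derivative_eq) (rule bounded_linear_imp_has_derivative[OF bounded_linear_fst])

lemma mdiff_fst:
  assumes z: "z \<in> cotangent_bundle A"
  shows "mdiff TA A fst z"
proof -
  define c where "c = chart_at A (fst z)"
  have c: "c \<in> charts_at A (fst z)" unfolding c_def using z by (intro chart_at_in) auto
  let ?C = "cotangent_chart A c"
  have C: "?C \<in> charts_at TA z" using cotangent_chart_at[OF c] z by auto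
  have "eventually (\<lambda>x. x \<in> snd ?C ` fst ?C) (nhds (snd ?C z))"
    using eventually_chart[OF diff_atlas_chart[OF diff_atlas_cotangent C] charts_atD(1)[OF C]] .
  then have "eventually (\<lambda>x. x \<in> snd ?C ` fst ?C \<and> fst (chart_inv ?C x) \<in> fst c) (nhds (snd ?C z))"
  proof eventually_elim
    case (elim x)
    then show ?case using chart_inv_in[OF elim] by (auto simp del: image_iff)
  qed
  moreover have "(snd c \<circ> fst \<circ> chart_inv ?C) differentiable at (snd ?C z)"
    by (simp only: frechet_derivative_cong_nhds(2)[OF fst_rep[OF bundleD(2)[OF z] c]] fst_differentiable)
  ultimately have "diff_rep ?C c fst z"
    using charts_atD(1)[OF C] charts_atD(1)[OF c] unfolding diff_rep_def by blast
  then show ?thesis using C c by (intro mdiffI[OF diff_atlas_cotangent diff_atlas_base, of ?C z c fst])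
qed

lemma tangent_map_fst:
  assumes z: "z \<in> cotangent_bundle A" and c: "c \<in> charts_at A (fst z)" and V: "V \<in> tangent_space TA z"
  shows "snd (tangent_map TA A fst (z, V)) c = fst (V (cotangent_chart A c))"
proof -
  have C: "cotangent_chart A c \<in> charts_at TA z" using cotangent_chart_at[OF c] z by auto
  show ?thesis
    unfolding tangent_map_rep[OF diff_atlas_cotangent mdiff_fst[OF z] V C c] frechet_derivative_cong_nhds(1)[OF fst_rep[OF bundleD(2)[OF z] c]]
      frechet_derivative_fst ..
qed

lemma canonical_one_form_coords:
  assumes z: "z \<in> cotangent_bundle A" and c: "c \<in> charts_at A (fst z)" and V: "V \<in> tangent_space TA z"
  shows "canonical_one_form A z V = snd (snd (cotangent_chart A c) z) \<bullet> fst (V (cotangent_chart A c))"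
proof -
  have "snd (tangent_map TA A fst (z, V)) \<in> tangent_space A (fst z)"
    by (rule tangent_map_in[OF diff_atlas_cotangent diff_atlas_base mdiff_fst[OF z]])
  then show ?thesis
    using covec_apply[OF c bundleD(2)[OF z]] tangent_map_fst[OF z c V]
    by (simp add: canonical_one_form_def)
qed

text \<open>The coefficients of the canonical one-form are linear in the bundle chart, so its
  exterior derivative has constant coefficients. Premise \<open>C\<close> makes the chart the one in
  which \<open>ext_deriv\<close> is evaluated.\<close>

lemma canonical_symplectic_coords:
  assumes z: "z \<in> cotangent_bundle A" and c: "c \<in> charts_at A (fst z)"
    and C: "chart_at TA z = cotangent_chart A c"
    and V: "V \<in> tangent_space TA z" and W: "W \<in> tangent_space TA z"
  shows "canonical_symplectic A z V W =
    fst (V (cotangent_chart A c)) \<bullet> snd (W (cotangent_chart A c)) -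
    snd (V (cotangent_chart A c)) \<bullet> fst (W (cotangent_chart A c))"
proof -
  let ?C = "cotangent_chart A c"
  let ?b = "\<lambda>u y. canonical_one_form A (chart_inv ?C y) (coord_tvec TA ?C (chart_inv ?C y) u)"
  have Cz: "?C \<in> charts_at TA z" using cotangent_chart_at[OF c] z by auto
  have "eventually (\<lambda>y. ?b u y = snd y \<bullet> fst u) (nhds (snd ?C z))" for u
    using eventually_chart[OF diff_atlas_chart[OF diff_atlas_cotangent Cz] charts_atD(1)[OF Cz]]
  proof eventually_elim
    case (elim y)
    let ?w = "chart_inv ?C y"
    have wC: "?w \<in> fst ?C" by (rule chart_inv_in[OF elim])
    have c': "c \<in> charts_at A (fst ?w)" using wC charts_atD(2)[OF c] by (auto simp: charts_at_def)
    have w: "?w \<in> cotangent_bundle A" using wC charts_at_mcarrier[OF c'] by auto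
    have Cw: "?C \<in> charts_at TA ?w" using cotangent_chart_at[OF c' bundleD(2)[OF w]] .
    show ?case
      unfolding canonical_one_form_coords[OF w c' coord_tvec_in[OF diff_atlas_cotangent Cw]] coord_tvec_chart[OF diff_atlas_cotangent Cw]
        chart_inv_right[OF elim] ..
  qed
  then have "frechet_derivative (?b u) (at (snd ?C z)) = frechet_derivative (\<lambda>y. snd y \<bullet> fst u) (at (snd ?C z))" for u
    by (rule frechet_derivative_cong_nhds(1))
  moreover have "frechet_derivative (\<lambda>y. snd y \<bullet> fst u) (at x) = (\<lambda>h. snd h \<bullet> fst u)" for u :: "'e \<times> 'e" and x :: "'e \<times> 'e"
    by (rule frechet_derivative_eq) (auto intro!: derivative_eq_intros)
  ultimately have "frechet_derivative (?b u) (at (snd ?C z)) = (\<lambda>h. snd h \<bullet> fst u)" for u by simp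
  then show ?thesis
    unfolding canonical_symplectic_def ext_deriv_def C Let_def by (simp add: inner_commute)
qed

text \<open>Nondegeneracy of the canonical form: testing against vectors with coordinates
  \<open>(0, w)\<close> and \<open>(u, 0)\<close> isolates the two components of a solution.\<close>

lemma hamiltonian_vf_unique:
  assumes z: "z \<in> cotangent_bundle A" and V: "V \<in> tangent_space TA z"
    and eq: "\<And>W. W \<in> tangent_space TA z \<Longrightarrow> canonical_symplectic A z V W = differential TA f z W"
  shows "hamiltonian_vf A f z = (z, V)"
proof -
  obtain c where c: "c \<in> charts_at A (fst z)" "chart_at TA z = cotangent_chart A c"
    "cotangent_chart A c \<in> charts_at TA z" using chart_at_cotangent[OF z] .
  let ?C = "cotangent_chart A c"
  have "V' = V" if V': "V' \<in> tangent_space TA z"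
    and eq': "\<forall>W\<in>tangent_space TA z. canonical_symplectic A z V' W = differential TA f z W" for V'
  proof (rule tangent_space_eqI[OF c(3) V' V])
    have *: "fst (V' ?C) \<bullet> w - snd (V' ?C) \<bullet> u = fst (V ?C) \<bullet> w - snd (V ?C) \<bullet> u" for u w
      using eq eq' coord_tvec_in[OF diff_atlas_cotangent c(3), of "(u, w)"]
        canonical_symplectic_coords[OF z c(1,2) V coord_tvec_in[OF diff_atlas_cotangent c(3), of "(u, w)"]]
        canonical_symplectic_coords[OF z c(1,2) V' coord_tvec_in[OF diff_atlas_cotangent c(3), of "(u, w)"]]
      by (simp add: coord_tvec_chart[OF diff_atlas_cotangent c(3)])
    have "fst (V' ?C) = fst (V ?C)" using *[of _ 0] by (intro riesz_unique[of "fst (V' ?C)"]) simp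
    moreover have "snd (V' ?C) = snd (V ?C)" using *[of 0] by (intro riesz_unique[of "snd (V' ?C)"]) simp
    ultimately show "V' ?C = V ?C" by (simp add: prod_eq_iff)
  qed
  then have "(THE V. V \<in> tangent_space TA z \<and>
      (\<forall>W\<in>tangent_space TA z. canonical_symplectic A z V W = differential TA f z W)) = V"
    using V eq by (intro the_equality) blast+
  then show ?thesis by (simp add: hamiltonian_vf_def)
qed

text \<open>Hamilton's equations: premise \<open>XP\<close> says that \<open>X\<close> is the
  momentum gradient of \<open>f\<close> and \<open>P\<close> minus its position gradient.\<close>

lemma hamiltonian_vf_coords:
  assumes z: "z \<in> cotangent_bundle A" and f: "mdiff TA real_atlas f z"
    and c: "c \<in> charts_at A (fst z)" and C: "chart_at TA z = cotangent_chart A c"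
    and XP: "\<And>u w. frechet_derivative (f \<circ> chart_inv (cotangent_chart A c)) (at (snd (cotangent_chart A c) z)) (u, w)
          = X \<bullet> w - P \<bullet> u"
  shows "hamiltonian_vf A f z = (z, coord_tvec TA (cotangent_chart A c) z (X, P))"
proof (rule hamiltonian_vf_unique[OF z])
  have Cz: "cotangent_chart A c \<in> charts_at TA z" using cotangent_chart_at[OF c] z by auto
  show V: "coord_tvec TA (cotangent_chart A c) z (X, P) \<in> tangent_space TA z"
    by (rule coord_tvec_in[OF diff_atlas_cotangent Cz])
  fix W assume W: "W \<in> tangent_space TA z"
  show "canonical_symplectic A z (coord_tvec TA (cotangent_chart A c) z (X, P)) W = differential TA f z W"
    unfolding canonical_symplectic_coords[OF z c C V W] coord_tvec_chart[OF diff_atlas_cotangent Cz]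
      differential_rep[OF diff_atlas_cotangent Cz W f] using XP[of "fst (W (cotangent_chart A c))" "snd (W (cotangent_chart A c))"]
    by simp
qed

lemma hamiltonian_vf_spec:
  assumes z: "z \<in> cotangent_bundle A" and f: "mdiff TA real_atlas f z"
  obtains V where "hamiltonian_vf A f z = (z, V)" "V \<in> tangent_space TA z"
    "\<And>W. W \<in> tangent_space TA z \<Longrightarrow> canonical_symplectic A z V W = differential TA f z W"
proof -
  obtain c where c: "c \<in> charts_at A (fst z)" "chart_at TA z = cotangent_chart A c"
    "cotangent_chart A c \<in> charts_at TA z" using chart_at_cotangent[OF z] .
  let ?C = "cotangent_chart A c"
  let ?l = "frechet_derivative (f \<circ> chart_inv ?C) (at (snd ?C z))"
  have l: "linear ?l" using mdiff_real_differentiable[OF f c(3)] by (rule linear_frechet_derivative)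
  let ?X = "\<Sum>e\<in>E. ?l (0, e) *\<^sub>R e" and ?P = "- (\<Sum>e\<in>E. ?l (e, 0) *\<^sub>R e)"
  have l2: "linear (\<lambda>w. ?l (0, w))"
    using linear_add[OF l, of "(0, _)" "(0, _)"] linear_scale[OF l, of _ "(0, _)"] by (intro linearI) simp_all
  have l1: "linear (\<lambda>w. ?l (w, 0))"
    using linear_add[OF l, of "(_, 0)" "(_, 0)"] linear_scale[OF l, of _ "(_, 0)"] by (intro linearI) simp_all
  have "?l (u, w) = ?X \<bullet> w - ?P \<bullet> u" for u w
    using linear_add[OF l, of "(u, 0)" "(0, w)"] riesz[OF E l1, of u] riesz[OF E l2, of w] by simp
  from hamiltonian_vf_coords[OF z f c(1,2) this]
  have h: "hamiltonian_vf A f z = (z, coord_tvec TA ?C z (?X, ?P))" .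
  let ?V = "coord_tvec TA ?C z (?X, ?P)"
  have V: "?V \<in> tangent_space TA z" by (rule coord_tvec_in[OF diff_atlas_cotangent c(3)])
  have "canonical_symplectic A z ?V W = differential TA f z W" if W: "W \<in> tangent_space TA z" for W
    unfolding canonical_symplectic_coords[OF z c(1,2) V W] coord_tvec_chart[OF diff_atlas_cotangent c(3)]
      differential_rep[OF diff_atlas_cotangent c(3) W f]
    using \<open>\<And>w u. ?l (u, w) = ?X \<bullet> w - ?P \<bullet> u\<close>[of "fst (W ?C)" "snd (W ?C)"] by simp
  with h V that show ?thesis by blast
qed

text \<open>The derivative of \<open>\<epsilon>\<close> preserves a nondegenerate form, so it is
  injective and, by dimension, surjective. Every test vector at \<open>\<epsilon> z\<close> is
  therefore an image, and the defining equation at \<open>z\<close> pushes forward.\<close>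

lemma symplectic_map_hamiltonian_vf:
  assumes \<epsilon>: "symplectic_map A \<epsilon>" and z: "z \<in> cotangent_bundle A" and \<epsilon>z: "\<epsilon> z \<in> cotangent_bundle A"
    and f: "mdiff TA real_atlas f (\<epsilon> z)"
  shows "tangent_map TA TA \<epsilon> (hamiltonian_vf A (f \<circ> \<epsilon>) z) = hamiltonian_vf A f (\<epsilon> z)"
proof -
  have md: "mdiff TA TA \<epsilon> z"
    using \<epsilon> z \<epsilon>z by (intro smooth_map_mdiff[OF diff_atlas_cotangent diff_atlas_cotangent]) (simp_all add: symplectic_map_def mcarrier_cotangent)
  have mf: "mdiff TA real_atlas (f \<circ> \<epsilon>) z" by (rule mdiff_comp[OF diff_atlas_cotangent diff_atlas_cotangent diff_atlas_real md f])
  obtain V where V: "hamiltonian_vf A (f \<circ> \<epsilon>) z = (z, V)" "V \<in> tangent_space TA z"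
    "\<And>W. W \<in> tangent_space TA z \<Longrightarrow> canonical_symplectic A z V W = differential TA (f \<circ> \<epsilon>) z W"
    by (rule hamiltonian_vf_spec[OF z mf], blast)
  let ?T = "\<lambda>W. snd (tangent_map TA TA \<epsilon> (z, W))"
  have symp: "canonical_symplectic A (\<epsilon> z) (?T V) (?T W) = canonical_symplectic A z V W"
    if "V \<in> tangent_space TA z" "W \<in> tangent_space TA z" for V W
    using \<epsilon> z that unfolding symplectic_map_def by blast
  obtain c where c: "c \<in> charts_at A (fst z)" "chart_at TA z = cotangent_chart A c"
    "cotangent_chart A c \<in> charts_at TA z" using chart_at_cotangent[OF z] .
  let ?C = "cotangent_chart A c"
  obtain d where d: "d \<in> charts_at A (fst (\<epsilon> z))" "chart_at TA (\<epsilon> z) = cotangent_chart A d"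
    "cotangent_chart A d \<in> charts_at TA (\<epsilon> z)" using chart_at_cotangent[OF \<epsilon>z] .
  let ?D = "cotangent_chart A d"
  let ?S = "frechet_derivative (snd ?D \<circ> \<epsilon> \<circ> chart_inv ?C) (at (snd ?C z))"
  have S: "linear ?S" using mdiffD[OF md c(3) d(3)] by (intro linear_frechet_derivative) (simp add: diff_rep_def)
  have TS: "?T W ?D = ?S (W ?C)" if "W \<in> tangent_space TA z" for W
    by (rule tangent_map_rep[OF diff_atlas_cotangent md that c(3) d(3)])
  have pres: "fst (?S v) \<bullet> snd (?S w) - snd (?S v) \<bullet> fst (?S w) = fst v \<bullet> snd w - snd v \<bullet> fst w" for v w
  proof -
    note iv = coord_tvec_in[OF diff_atlas_cotangent c(3), of v] and iw = coord_tvec_in[OF diff_atlas_cotangent c(3), of w]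
    show ?thesis
      using symp[OF iv iw]
        canonical_symplectic_coords[OF z c(1,2) iv iw]
        canonical_symplectic_coords[OF \<epsilon>z d(1,2) tangent_map_in[OF diff_atlas_cotangent diff_atlas_cotangent md, of "coord_tvec TA ?C z v"]
          tangent_map_in[OF diff_atlas_cotangent diff_atlas_cotangent md, of "coord_tvec TA ?C z w"]]
      by (simp add: TS[OF iv] TS[OF iw] coord_tvec_chart[OF diff_atlas_cotangent c(3)])
  qed
  have "inj ?S"
    unfolding linear_injective_0[OF S]
  proof (intro allI impI)
    fix v assume v: "?S v = 0"
    \<comment> \<open>A kernel vector pairs to zero with everything; \<open>(0, fst v)\<close> and
      \<open>(snd v, 0)\<close> then annihilate its two halves.\<close>
    have *: "fst v \<bullet> snd w - snd v \<bullet> fst w = 0" for w using pres[of v w] v by simp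
    have "fst v \<bullet> fst v = 0" using *[of "(0, fst v)"] by simp
    moreover have "snd v \<bullet> snd v = 0" using *[of "(snd v, 0)"] by simp
    ultimately show "v = 0" by (simp add: prod_eq_iff)
  qed
  then have surj: "surj ?S" using linear_inj_imp_surj_finite[OF _ _ S] expansion_basis_prod[OF E] by metis
  have "hamiltonian_vf A f (\<epsilon> z) = (\<epsilon> z, ?T V)"
  proof (rule hamiltonian_vf_unique[OF \<epsilon>z tangent_map_in[OF diff_atlas_cotangent diff_atlas_cotangent md]])
    fix W assume W: "W \<in> tangent_space TA (\<epsilon> z)"
    obtain w where w: "W ?D = ?S w" using surj by (metis surjD)
    note iw = coord_tvec_in[OF diff_atlas_cotangent c(3), of w]
    have TW: "?T (coord_tvec TA ?C z w) = W"
      by (rule tangent_space_eqI[OF d(3) tangent_map_in[OF diff_atlas_cotangent diff_atlas_cotangent md] W])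
         (simp add: TS[OF iw] coord_tvec_chart[OF diff_atlas_cotangent c(3)] w)
    show "canonical_symplectic A (\<epsilon> z) (?T V) W = differential TA f (\<epsilon> z) W"
      using symp[OF V(2) iw] V(3)[OF iw] differential_comp[OF diff_atlas_cotangent diff_atlas_cotangent md f iw] by (simp add: TW)
  qed
  then show ?thesis by (simp add: V(1) prod_eq_iff)
qed

end

section \<open>Lie groups\<close>

text \<open>These fields are the infinitesimal generators of left translation, which is why
  \<open>momentum_map\<close> evaluates covectors on them.\<close>

definition right_inv_vf ::
  "('g, 'b) monoid_scheme \<Rightarrow> ('g, 'e::real_inner) chart set \<Rightarrow> ('g, 'e) tvec \<Rightarrow>
     'g \<Rightarrow> ('g, 'e) tvec" where
  "right_inv_vf G A \<xi> g = snd (tangent_map A A (right_trans G g) (\<one>\<^bsub>G\<^esub>, \<xi>))"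

text \<open>A product rule for a derivative whose base point and direction both move. The moving
  direction is expanded in \<open>E\<close>, leaving finitely many constant directions with scalar
  coefficients.\<close>

lemma has_derivative_frechet_apply:
  fixes F :: "'e::real_inner \<times> 'e \<Rightarrow> 'f::real_inner"
  assumes E: "expansion_basis (E :: 'e set)" and F: "smooth_on W F"
    and g: "(g has_derivative g') (at y)" "g y \<in> W" and Y: "(Y has_derivative Y') (at y)"
  shows "((\<lambda>y. frechet_derivative F (at (g y)) (0, Y y)) has_derivative
     (\<lambda>v. frechet_derivative F (at (g y)) (0, Y' v) +
          frechet_derivative (\<lambda>z. frechet_derivative F (at z) (0, Y y)) (at (g y)) (g' v))) (at y)"
proof -
  let ?D = "\<lambda>z. frechet_derivative F (at z)"
  let ?D2 = "\<lambda>w. frechet_derivative (\<lambda>z. ?D z w) (at (g y))"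
  have lin: "linear (\<lambda>e. ?D z (0, e))" if "z \<in> W" for z
  proof -
    have l: "linear (?D z)" by (rule linear_frechet_derivative[OF smooth_on_differentiable[OF F that]])
    show ?thesis
      using linear_add[OF l, of "(0, _)" "(0, _)"] linear_scale[OF l, of _ "(0, _)"] by (intro linearI) simp_all
  qed
  have W: "open W" using smooth_on_open[OF F] .
  have D2: "((\<lambda>z. ?D z w) has_derivative ?D2 w) (at (g y))" for w
    by (rule differentiable_has_derivative[OF smooth_on_differentiable[OF smooth_on_frechet[OF F] g(2)]])
  have ev: "eventually (\<lambda>z. z \<in> W) (nhds (g y))" using W g(2) by (rule eventually_nhds_in_open)
  have "isCont g y" using g(1) by (rule has_derivative_continuous)
  then have "eventually (\<lambda>x. g x \<in> W) (at y)"
    using ev unfolding isCont_def by (blast dest: filterlim_iff[THEN iffD1])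
  then have evg: "eventually (\<lambda>x. g x \<in> W) (nhds y)" using g(2) by (simp add: eventually_nhds_conv_at)
  \<comment> \<open>\<open>smooth_on\<close> provides second derivatives one fixed direction at a
    time; this expansion supplies their linearity in that direction.\<close>
  have D2sum: "((\<lambda>z. \<Sum>e\<in>E. (Y y \<bullet> e) *\<^sub>R ?D z (0, e)) has_derivative (\<lambda>v. \<Sum>e\<in>E. (Y y \<bullet> e) *\<^sub>R ?D2 (0, e) v)) (at (g y))"
    by (intro has_derivative_sum has_derivative_scaleR_right D2)
  have "eventually (\<lambda>z. ?D z (0, Y y) = (\<Sum>e\<in>E. (Y y \<bullet> e) *\<^sub>R ?D z (0, e))) (nhds (g y))"
    using ev by eventually_elim (rule linear_expand[OF E lin])
  from frechet_derivative_cong_nhds(1)[OF this] have D2exp: "?D2 (0, Y y) v = (\<Sum>e\<in>E. (Y y \<bullet> e) *\<^sub>R ?D2 (0, e) v)" for v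
    by (simp only: frechet_derivative_eq[OF D2sum])
  have comp: "((\<lambda>y. ?D (g y) w) has_derivative (\<lambda>v. ?D2 w (g' v))) (at y)" for w
    using diff_chain_at[OF g(1) D2[of w]] by (simp add: o_def)
  have "((\<lambda>y. \<Sum>e\<in>E. (Y y \<bullet> e) *\<^sub>R ?D (g y) (0, e)) has_derivative
      (\<lambda>v. \<Sum>e\<in>E. (Y y \<bullet> e) *\<^sub>R ?D2 (0, e) (g' v) + (Y' v \<bullet> e) *\<^sub>R ?D (g y) (0, e))) (at y)"
    by (intro has_derivative_sum has_derivative_scaleR comp has_derivative_inner_left Y)
  moreover have "(\<Sum>e\<in>E. (Y y \<bullet> e) *\<^sub>R ?D2 (0, e) (g' v) + (Y' v \<bullet> e) *\<^sub>R ?D (g y) (0, e)) =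
      ?D (g y) (0, Y' v) + ?D2 (0, Y y) (g' v)" for v
    unfolding sum.distrib D2exp linear_expand[OF E lin[OF g(2)], of "Y' v"] by simp
  ultimately have *: "((\<lambda>y. \<Sum>e\<in>E. (Y y \<bullet> e) *\<^sub>R ?D (g y) (0, e)) has_derivative
      (\<lambda>v. ?D (g y) (0, Y' v) + ?D2 (0, Y y) (g' v))) (at y)" by simp
  have "eventually (\<lambda>x. (\<Sum>e\<in>E. (Y x \<bullet> e) *\<^sub>R ?D (g x) (0, e)) = ?D (g x) (0, Y x)) (nhds y)"
    using evg by eventually_elim (rule linear_expand[OF E lin, symmetric])
  then obtain S where S: "open S" "y \<in> S" "\<And>x. x \<in> S \<Longrightarrow> (\<Sum>e\<in>E. (Y x \<bullet> e) *\<^sub>R ?D (g x) (0, e)) = ?D (g x) (0, Y x)"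
    unfolding eventually_nhds by blast
  show ?thesis by (rule has_derivative_transform_within_open[OF * S])
qed

locale lie_group_basis = lie_group G A + finite_dim_atlas A E
  for G :: "('g, 'b) monoid_scheme" (structure) and A :: "('g, 'e::real_inner) chart set" and E :: "'e set"
begin

text \<open>Written through the product chart exactly as \<open>smooth_map\<close> unfolds at
  \<open>smooth_mult\<close>, so smoothness can be read off; \<open>mult_rep_eq\<close> gives the
  form used in computations.\<close>

definition mult_rep :: "('g, 'e) chart \<Rightarrow> ('g, 'e) chart \<Rightarrow> ('g, 'e) chart \<Rightarrow> 'e \<times> 'e \<Rightarrow> 'e" where
  "mult_rep c d e = snd e \<circ> (\<lambda>(x, y). x \<otimes> y) \<circ> chart_inv (fst c \<times> fst d, map_prod (snd c) (snd d))"

definition mult_dom :: "('g, 'e) chart \<Rightarrow> ('g, 'e) chart \<Rightarrow> ('g, 'e) chart \<Rightarrow> ('e \<times> 'e) set" where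
  "mult_dom c d e = map_prod (snd c) (snd d) ` ((fst c \<times> fst d) \<inter> (\<lambda>(x, y). x \<otimes> y) -` fst e)"

abbreviation (input) Dmult where
  "Dmult c d e z \<equiv> frechet_derivative (mult_rep c d e) (at z)"

lemma smooth_mult_rep:
  assumes "c \<in> A" "d \<in> A" "e \<in> A"
  shows "smooth_on (mult_dom c d e) (mult_rep c d e)"
proof -
  have "(fst c \<times> fst d, map_prod (snd c) (snd d)) \<in> prod_atlas A A"
    using assms unfolding prod_atlas_def by blast
  then show ?thesis
    using smooth_mult assms(3) unfolding smooth_map_def mult_dom_def mult_rep_def by fastforce
qed

lemma mult_domI:
  "\<lbrakk>g \<in> fst c; h \<in> fst d; g \<otimes> h \<in> fst e\<rbrakk> \<Longrightarrow> (snd c g, snd d h) \<in> mult_dom c d e"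
  unfolding mult_dom_def by (rule image_eqI[of _ _ "(g, h)"]) auto

lemma mult_domE:
  assumes "z \<in> mult_dom c d e" "c \<in> A" "d \<in> A"
  shows "fst z \<in> snd c ` fst c" "snd z \<in> snd d ` fst d" "chart_inv c (fst z) \<otimes> chart_inv d (snd z) \<in> fst e"
  using assms chart_inv_eq[OF chart[OF assms(2)]] chart_inv_eq[OF chart[OF assms(3)]]
  unfolding mult_dom_def by auto

lemma mult_rep_eq:
  assumes z: "z \<in> mult_dom c d e" and c: "c \<in> A" and d: "d \<in> A"
  shows "mult_rep c d e z = snd e (chart_inv c (fst z) \<otimes> chart_inv d (snd z))"
proof -
  obtain g h where gh: "g \<in> fst c" "h \<in> fst d" "z = (snd c g, snd d h)"
    using z unfolding mult_dom_def by auto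
  have "inj_on (map_prod (snd c) (snd d)) (fst c \<times> fst d)"
    using chart[OF c] chart[OF d] by (auto simp: is_chart_def intro: map_prod_inj_on)
  then have "chart_inv (fst c \<times> fst d, map_prod (snd c) (snd d)) (map_prod (snd c) (snd d) (g, h)) = (g, h)"
    using gh by (simp add: chart_inv_def del: map_prod_simp)
  then show ?thesis
    using gh chart_inv_eq[OF chart[OF c]] chart_inv_eq[OF chart[OF d]] by (simp add: mult_rep_def)
qed

lemma mult_rep_eq':
  "\<lbrakk>g \<in> fst c; h \<in> fst d; g \<otimes> h \<in> fst e; c \<in> A; d \<in> A\<rbrakk> \<Longrightarrow>
    mult_rep c d e (snd c g, snd d h) = snd e (g \<otimes> h)"
  using mult_rep_eq[OF mult_domI, of g c h d e] by (simp add: chart_inv_eq[OF chart])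

lemma chart_at_carrier: "g \<in> carrier G \<Longrightarrow> chart_at A g \<in> charts_at A g"
  using carrier_eq by (intro chart_at_in) simp

lemma chart_carrier: "c \<in> A \<Longrightarrow> g \<in> fst c \<Longrightarrow> g \<in> carrier G"
  using carrier_eq by (auto simp: mcarrier_def)

lemma charts_at_carrier: "c \<in> charts_at A g \<Longrightarrow> g \<in> carrier G"
  using charts_at_mcarrier[of c A g] carrier_eq by simp

section \<open>Translations\<close>

lemma eventually_mult_dom_snd:
  assumes z: "(x, y) \<in> mult_dom c d e" and m: "c \<in> A" "d \<in> A" "e \<in> A"
  shows "eventually (\<lambda>y. (x, y) \<in> mult_dom c d e) (nhds y)"
    and "eventually (\<lambda>x. (x, y) \<in> mult_dom c d e) (nhds x)"
proof -
  have o: "open (mult_dom c d e)" using smooth_on_open[OF smooth_mult_rep[OF m]] .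
  have "open ((\<lambda>y. (x, y)) -` mult_dom c d e)" "open ((\<lambda>x. (x, y)) -` mult_dom c d e)"
    by (intro open_vimage o continuous_intros)+
  then show "eventually (\<lambda>y. (x, y) \<in> mult_dom c d e) (nhds y)"
    "eventually (\<lambda>x. (x, y) \<in> mult_dom c d e) (nhds x)"
    using z unfolding eventually_nhds by auto
qed

lemma mult_rep_has_derivative:
  assumes "z \<in> mult_dom c d e" "c \<in> A" "d \<in> A" "e \<in> A"
  shows "(mult_rep c d e has_derivative Dmult c d e z) (at z)"
  by (rule differentiable_has_derivative[OF smooth_on_differentiable[OF smooth_mult_rep[OF assms(2-4)] assms(1)]])

lemma Dmult_has_derivative:
  assumes "z \<in> mult_dom c d e" "c \<in> A" "d \<in> A" "e \<in> A"
  shows "((\<lambda>z. Dmult c d e z w) has_derivative frechet_derivative (\<lambda>z. Dmult c d e z w) (at z)) (at z)"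
  by (rule differentiable_has_derivative[OF smooth_on_differentiable[OF smooth_on_frechet[OF smooth_mult_rep[OF assms(2-4)]] assms(1)]])

lemma has_derivative_slice:
  assumes "(f has_derivative f') (at (x, y))"
  shows "((\<lambda>y. f (x, y)) has_derivative (\<lambda>v. f' (0, v))) (at y)"
    and "((\<lambda>x. f (x, y)) has_derivative (\<lambda>v. f' (v, 0))) (at x)"
proof -
  have "((\<lambda>y. (x, y)) has_derivative (\<lambda>v. (0, v))) (at y)" "((\<lambda>x. (x, y)) has_derivative (\<lambda>v. (v, 0))) (at x)"
    by (intro has_derivative_Pair has_derivative_const has_derivative_ident)+
  from diff_chain_at[OF this(1) assms] diff_chain_at[OF this(2) assms]
  show "((\<lambda>y. f (x, y)) has_derivative (\<lambda>v. f' (0, v))) (at y)"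
    "((\<lambda>x. f (x, y)) has_derivative (\<lambda>v. f' (v, 0))) (at x)"
    by (simp_all add: o_def)
qed

text \<open>A left translation is a slice of the multiplication, so its derivative is the partial
  derivative in the second slot. All derivatives of translations are reduced to
  \<open>mult_rep\<close> in this way.\<close>

lemma left_trans_diff_rep:
  assumes c: "c \<in> charts_at A g" and d: "d \<in> charts_at A p" and e: "e \<in> charts_at A (g \<otimes> p)"
  shows "diff_rep d e (left_trans G g) p"
    and "frechet_derivative (snd e \<circ> left_trans G g \<circ> chart_inv d) (at (snd d p)) =
         (\<lambda>v. Dmult c d e (snd c g, snd d p) (0, v))"
proof -
  note cD = charts_atD[OF c] and dD = charts_atD[OF d] and eD = charts_atD[OF e]
  let ?z = "(snd c g, snd d p)"
  have z: "?z \<in> mult_dom c d e" by (rule mult_domI[OF cD(1) dD(1) eD(1)])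
  note ev = eventually_mult_dom_snd(1)[OF z cD(2) dD(2) eD(2)]
  have h: "((\<lambda>y. mult_rep c d e (snd c g, y)) has_derivative (\<lambda>v. Dmult c d e ?z (0, v))) (at (snd d p))"
    by (rule has_derivative_slice(1)[OF mult_rep_has_derivative[OF z cD(2) dD(2) eD(2)]])
  have eq: "eventually (\<lambda>y. (snd e \<circ> left_trans G g \<circ> chart_inv d) y = mult_rep c d e (snd c g, y)) (nhds (snd d p))"
    using ev
  proof eventually_elim
    case (elim y)
    show ?case using mult_rep_eq[OF elim cD(2) dD(2)] chart_inv_eq[OF chart[OF cD(2)] cD(1)]
      by (simp add: left_trans_def)
  qed
  show "frechet_derivative (snd e \<circ> left_trans G g \<circ> chart_inv d) (at (snd d p)) =
         (\<lambda>v. Dmult c d e (snd c g, snd d p) (0, v))"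
    using frechet_derivative_cong_nhds(1)[OF eq] frechet_derivative_eq[OF h] by (rule trans)
  have "(snd e \<circ> left_trans G g \<circ> chart_inv d) differentiable at (snd d p)"
    using frechet_derivative_cong_nhds(2)[OF eq] h unfolding differentiable_def by blast
  moreover have "eventually (\<lambda>y. y \<in> snd d ` fst d \<and> left_trans G g (chart_inv d y) \<in> fst e) (nhds (snd d p))"
    using ev
  proof eventually_elim
    case (elim y)
    show ?case using mult_domE[OF elim cD(2) dD(2)] chart_inv_eq[OF chart[OF cD(2)] cD(1)]
      by (simp add: left_trans_def)
  qed
  ultimately show "diff_rep d e (left_trans G g) p"
    using dD eD unfolding diff_rep_def left_trans_def by blast
qed

lemma right_trans_diff_rep:
  assumes c: "c \<in> charts_at A g" and d: "d \<in> charts_at A p" and e: "e \<in> charts_at A (p \<otimes> g)"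
  shows "diff_rep d e (right_trans G g) p"
    and "frechet_derivative (snd e \<circ> right_trans G g \<circ> chart_inv d) (at (snd d p)) =
         (\<lambda>v. Dmult d c e (snd d p, snd c g) (v, 0))"
proof -
  note cD = charts_atD[OF c] and dD = charts_atD[OF d] and eD = charts_atD[OF e]
  let ?z = "(snd d p, snd c g)"
  have z: "?z \<in> mult_dom d c e" by (rule mult_domI[OF dD(1) cD(1) eD(1)])
  note ev = eventually_mult_dom_snd(2)[OF z dD(2) cD(2) eD(2)]
  have h: "((\<lambda>y. mult_rep d c e (y, snd c g)) has_derivative (\<lambda>v. Dmult d c e ?z (v, 0))) (at (snd d p))"
    by (rule has_derivative_slice(2)[OF mult_rep_has_derivative[OF z dD(2) cD(2) eD(2)]])
  have eq: "eventually (\<lambda>y. (snd e \<circ> right_trans G g \<circ> chart_inv d) y = mult_rep d c e (y, snd c g)) (nhds (snd d p))"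
    using ev
  proof eventually_elim
    case (elim y)
    show ?case using mult_rep_eq[OF elim dD(2) cD(2)] chart_inv_eq[OF chart[OF cD(2)] cD(1)]
      by (simp add: right_trans_def)
  qed
  show "frechet_derivative (snd e \<circ> right_trans G g \<circ> chart_inv d) (at (snd d p)) =
         (\<lambda>v. Dmult d c e (snd d p, snd c g) (v, 0))"
    using frechet_derivative_cong_nhds(1)[OF eq] frechet_derivative_eq[OF h] by (rule trans)
  have "(snd e \<circ> right_trans G g \<circ> chart_inv d) differentiable at (snd d p)"
    using frechet_derivative_cong_nhds(2)[OF eq] h unfolding differentiable_def by blast
  moreover have "eventually (\<lambda>y. y \<in> snd d ` fst d \<and> right_trans G g (chart_inv d y) \<in> fst e) (nhds (snd d p))"
    using ev
  proof eventually_elim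
    case (elim y)
    show ?case using mult_domE[OF elim dD(2) cD(2)] chart_inv_eq[OF chart[OF cD(2)] cD(1)]
      by (simp add: right_trans_def)
  qed
  ultimately show "diff_rep d e (right_trans G g) p"
    using dD eD unfolding diff_rep_def right_trans_def by blast
qed

lemma mdiff_left_trans: "g \<in> carrier G \<Longrightarrow> p \<in> carrier G \<Longrightarrow> mdiff A A (left_trans G g) p"
proof -
  assume g: "g \<in> carrier G" and p: "p \<in> carrier G"
  have e: "chart_at A (g \<otimes> p) \<in> charts_at A (g \<otimes> p)" using g p by (intro chart_at_carrier) simp
  show ?thesis
    by (rule mdiffI[OF diff_atlas_base diff_atlas_base chart_at_carrier[OF p] _ left_trans_diff_rep(1)[OF chart_at_carrier[OF g] chart_at_carrier[OF p] e]])
       (use e in \<open>simp add: left_trans_def[of G g p]\<close>)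
qed

lemma mdiff_right_trans: "g \<in> carrier G \<Longrightarrow> p \<in> carrier G \<Longrightarrow> mdiff A A (right_trans G g) p"
proof -
  assume g: "g \<in> carrier G" and p: "p \<in> carrier G"
  have e: "chart_at A (p \<otimes> g) \<in> charts_at A (p \<otimes> g)" using g p by (intro chart_at_carrier) simp
  show ?thesis
    by (rule mdiffI[OF diff_atlas_base diff_atlas_base chart_at_carrier[OF p] _ right_trans_diff_rep(1)[OF chart_at_carrier[OF g] chart_at_carrier[OF p] e]])
       (use e in \<open>simp add: right_trans_def[of G g p]\<close>)
qed

abbreviation TL where "TL g p v \<equiv> snd (tangent_map A A (left_trans G g) (p, v))"
abbreviation TR where "TR g p v \<equiv> snd (tangent_map A A (right_trans G g) (p, v))"

lemma TL_chart:
  assumes "v \<in> tangent_space A p" "c \<in> charts_at A g" "d \<in> charts_at A p" "e \<in> charts_at A (g \<otimes> p)"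
  shows "TL g p v e = Dmult c d e (snd c g, snd d p) (0, v d)"
proof -
  have "mdiff A A (left_trans G g) p"
    by (rule mdiff_left_trans[OF charts_at_carrier[OF assms(2)] charts_at_carrier[OF assms(3)]])
  from tangent_map_rep[OF diff_atlas_base this assms(1,3), of e] assms(4) show ?thesis
    unfolding left_trans_diff_rep(2)[OF assms(2-4)] by (simp add: left_trans_def)
qed

lemma TR_chart:
  assumes "v \<in> tangent_space A p" "c \<in> charts_at A g" "d \<in> charts_at A p" "e \<in> charts_at A (p \<otimes> g)"
  shows "TR g p v e = Dmult d c e (snd d p, snd c g) (v d, 0)"
proof -
  have "mdiff A A (right_trans G g) p"
    by (rule mdiff_right_trans[OF charts_at_carrier[OF assms(2)] charts_at_carrier[OF assms(3)]])
  from tangent_map_rep[OF diff_atlas_base this assms(1,3), of e] assms(4) show ?thesis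
    unfolding right_trans_diff_rep(2)[OF assms(2-4)] by (simp add: right_trans_def)
qed

lemma TL_in: "g \<in> carrier G \<Longrightarrow> p \<in> carrier G \<Longrightarrow> TL g p v \<in> tangent_space A (g \<otimes> p)"
  using tangent_map_in[OF diff_atlas_base diff_atlas_base mdiff_left_trans, of g p v] by (simp add: left_trans_def)

lemma TR_in: "g \<in> carrier G \<Longrightarrow> p \<in> carrier G \<Longrightarrow> TR g p v \<in> tangent_space A (p \<otimes> g)"
  using tangent_map_in[OF diff_atlas_base diff_atlas_base mdiff_right_trans, of g p v] by (simp add: right_trans_def)

lemma TL_comp:
  assumes "g \<in> carrier G" "h \<in> carrier G" "p \<in> carrier G" "v \<in> tangent_space A p"
  shows "TL g (h \<otimes> p) (TL h p v) = TL (g \<otimes> h) p v"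
proof -
  have "tangent_map A A (left_trans G g \<circ> left_trans G h) (p, v) = tangent_map A A (left_trans G (g \<otimes> h)) (p, v)"
    using assms by (intro tangent_map_cong[OF diff_atlas_base]) (auto simp: carrier_eq left_trans_def m_assoc)
  then show ?thesis
    using tangent_map_comp[OF diff_atlas_base diff_atlas_base diff_atlas_base mdiff_left_trans[of h p] _ assms(4), of "left_trans G g"]
      mdiff_left_trans[of g "h \<otimes> p"] assms
    by (simp add: left_trans_def[of G h p])
qed

lemma TR_comp:
  assumes "g \<in> carrier G" "h \<in> carrier G" "p \<in> carrier G" "v \<in> tangent_space A p"
  shows "TR g (p \<otimes> h) (TR h p v) = TR (h \<otimes> g) p v"
proof -
  have "tangent_map A A (right_trans G g \<circ> right_trans G h) (p, v) = tangent_map A A (right_trans G (h \<otimes> g)) (p, v)"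
    using assms by (intro tangent_map_cong[OF diff_atlas_base]) (auto simp: carrier_eq right_trans_def m_assoc)
  then show ?thesis
    using tangent_map_comp[OF diff_atlas_base diff_atlas_base diff_atlas_base mdiff_right_trans[of h p] _ assms(4), of "right_trans G g"]
      mdiff_right_trans[of g "p \<otimes> h"] assms
    by (simp add: right_trans_def[of G h p])
qed

lemma TL_one: "p \<in> carrier G \<Longrightarrow> v \<in> tangent_space A p \<Longrightarrow> TL \<one> p v = v"
  using tangent_map_cong[OF diff_atlas_base, of p "left_trans G \<one>" id A v] tangent_map_id[OF diff_atlas_base, of p v]
  by (simp add: carrier_eq left_trans_def)

lemma TR_one: "p \<in> carrier G \<Longrightarrow> v \<in> tangent_space A p \<Longrightarrow> TR \<one> p v = v"
  using tangent_map_cong[OF diff_atlas_base, of p "right_trans G \<one>" id A v] tangent_map_id[OF diff_atlas_base, of p v]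
  by (simp add: carrier_eq right_trans_def)

lemma TR_surj:
  assumes "q \<in> carrier G" "v \<in> tangent_space A q"
  obtains \<xi> where "\<xi> \<in> tangent_space A \<one>" "v = TR q \<one> \<xi>"
proof
  show "TR (inv q) q v \<in> tangent_space A \<one>" using TR_in[of "inv q" q v] assms by simp
  show "v = TR q \<one> (TR (inv q) q v)"
    using TR_comp[of q "inv q" q v] TR_one[of q v] assms by simp
qed

section \<open>Invariant vector fields in charts\<close>

lemma left_inv_vf_in: "q \<in> carrier G \<Longrightarrow> left_inv_vf G A \<xi> q \<in> tangent_space A q"
  using TL_in[of q \<one> \<xi>] by (simp add: left_inv_vf_def)

lemma right_inv_vf_in: "q \<in> carrier G \<Longrightarrow> right_inv_vf G A \<xi> q \<in> tangent_space A q"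
  using TR_in[of q \<one> \<xi>] by (simp add: right_inv_vf_def)

lemma left_inv_vf_mult:
  assumes "g \<in> carrier G" "h \<in> carrier G" "\<xi> \<in> tangent_space A \<one>"
  shows "left_inv_vf G A \<xi> (g \<otimes> h) = TL g h (left_inv_vf G A \<xi> h)"
  using TL_comp[of g h \<one> \<xi>] assms by (simp add: left_inv_vf_def)

lemma right_inv_vf_mult:
  assumes "g \<in> carrier G" "h \<in> carrier G" "\<xi> \<in> tangent_space A \<one>"
  shows "right_inv_vf G A \<xi> (g \<otimes> h) = TR h g (right_inv_vf G A \<xi> g)"
  using TR_comp[of h g \<one> \<xi>] assms by (simp add: right_inv_vf_def)

definition left_field :: "('g, 'e) chart \<Rightarrow> ('g, 'e) tvec \<Rightarrow> 'e \<Rightarrow> 'e" where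
  "left_field c \<xi> x = left_inv_vf G A \<xi> (chart_inv c x) c"

definition right_field :: "('g, 'e) chart \<Rightarrow> ('g, 'e) tvec \<Rightarrow> 'e \<Rightarrow> 'e" where
  "right_field c \<xi> x = right_inv_vf G A \<xi> (chart_inv c x) c"

lemma left_field_at: "c \<in> charts_at A q \<Longrightarrow> left_field c \<xi> (snd c q) = left_inv_vf G A \<xi> q c"
  using charts_atD[of c A q] by (simp add: left_field_def chart_inv_eq chart)

lemma right_field_at: "c \<in> charts_at A q \<Longrightarrow> right_field c \<xi> (snd c q) = right_inv_vf G A \<xi> q c"
  using charts_atD[of c A q] by (simp add: right_field_def chart_inv_eq chart)

lemma charts_at_inv: "c \<in> A \<Longrightarrow> x \<in> snd c ` fst c \<Longrightarrow> c \<in> charts_at A (chart_inv c x)"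
  by (simp add: charts_at_def chart_inv_in)

text \<open>A left-invariant field is a first partial derivative of the multiplication at the
  identity, so derivatives of such fields are mixed second derivatives of it.\<close>

lemma left_field_eq:
  assumes c: "c \<in> A" and x: "x \<in> snd c ` fst c" and d: "d \<in> charts_at A \<one>" and \<xi>: "\<xi> \<in> tangent_space A \<one>"
  shows "left_field c \<xi> x = Dmult c d c (x, snd d \<one>) (0, \<xi> d)"
proof -
  have q: "c \<in> charts_at A (chart_inv c x)" by (rule charts_at_inv[OF c x])
  then have "chart_inv c x \<in> carrier G" by (rule charts_at_carrier)
  then show ?thesis
    using TL_chart[OF \<xi> q d, of c] q by (simp add: left_field_def left_inv_vf_def chart_inv_right[OF x])
qed

lemma right_field_eq:
  assumes c: "c \<in> A" and x: "x \<in> snd c ` fst c" and d: "d \<in> charts_at A \<one>" and \<xi>: "\<xi> \<in> tangent_space A \<one>"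
  shows "right_field c \<xi> x = Dmult d c c (snd d \<one>, x) (\<xi> d, 0)"
proof -
  have q: "c \<in> charts_at A (chart_inv c x)" by (rule charts_at_inv[OF c x])
  then have "chart_inv c x \<in> carrier G" by (rule charts_at_carrier)
  then show ?thesis
    using TR_chart[OF \<xi> q d, of c] q by (simp add: right_field_def right_inv_vf_def chart_inv_right[OF x])
qed

lemma chart_dom_right_one: "c \<in> charts_at A q \<Longrightarrow> d \<in> charts_at A \<one> \<Longrightarrow> (snd c q, snd d \<one>) \<in> mult_dom c d c"
  using charts_at_mcarrier[of c A q] carrier_eq by (intro mult_domI) (auto simp: charts_at_def)

lemma chart_dom_left_one: "c \<in> charts_at A q \<Longrightarrow> d \<in> charts_at A \<one> \<Longrightarrow> (snd d \<one>, snd c q) \<in> mult_dom d c c"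
  using charts_at_mcarrier[of c A q] carrier_eq by (intro mult_domI) (auto simp: charts_at_def)

lemma one_chart: "chart_at A \<one> \<in> charts_at A \<one>" by (rule chart_at_carrier) simp

lemma left_field_has_derivative:
  assumes c: "c \<in> charts_at A q" and d: "d \<in> charts_at A \<one>" and \<xi>: "\<xi> \<in> tangent_space A \<one>"
  shows "(left_field c \<xi> has_derivative
    (\<lambda>u. frechet_derivative (\<lambda>z. Dmult c d c z (0, \<xi> d)) (at (snd c q, snd d \<one>)) (u, 0))) (at (snd c q))"
proof -
  note cD = charts_atD[OF c] and dD = charts_atD[OF d]
  have h: "((\<lambda>x. Dmult c d c (x, snd d \<one>) (0, \<xi> d)) has_derivative
    (\<lambda>u. frechet_derivative (\<lambda>z. Dmult c d c z (0, \<xi> d)) (at (snd c q, snd d \<one>)) (u, 0))) (at (snd c q))"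
    by (rule has_derivative_slice(2)[OF Dmult_has_derivative[OF chart_dom_right_one[OF c d] cD(2) dD(2) cD(2)]])
  have "open (snd c ` fst c)" using chart[OF cD(2)] by (simp add: is_chart_def)
  then show ?thesis
    by (rule has_derivative_transform_within_open[OF h]) (use cD left_field_eq[OF cD(2) _ d \<xi>] in auto)
qed

lemma right_field_differentiable:
  assumes c: "c \<in> charts_at A q" and \<xi>: "\<xi> \<in> tangent_space A \<one>"
  shows "right_field c \<xi> differentiable at (snd c q)"
proof -
  note cD = charts_atD[OF c] and dD = charts_atD[OF one_chart]
  let ?d = "chart_at A \<one>"
  have h: "((\<lambda>x. Dmult ?d c c (snd ?d \<one>, x) (\<xi> ?d, 0)) has_derivative
    (\<lambda>u. frechet_derivative (\<lambda>z. Dmult ?d c c z (\<xi> ?d, 0)) (at (snd ?d \<one>, snd c q)) (0, u))) (at (snd c q))"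
    by (rule has_derivative_slice(1)[OF Dmult_has_derivative[OF chart_dom_left_one[OF c one_chart] dD(2) cD(2) cD(2)]])
  have "open (snd c ` fst c)" using chart[OF cD(2)] by (simp add: is_chart_def)
  then have "(right_field c \<xi> has_derivative
    (\<lambda>u. frechet_derivative (\<lambda>z. Dmult ?d c c z (\<xi> ?d, 0)) (at (snd ?d \<one>, snd c q)) (0, u))) (at (snd c q))"
    by (rule has_derivative_transform_within_open[OF h]) (use cD right_field_eq[OF cD(2) _ one_chart \<xi>] in auto)
  then show ?thesis unfolding differentiable_def by blast
qed

lemma mult_rep_right_one:
  assumes c: "c \<in> charts_at A q" and d: "d \<in> charts_at A \<one>"
  shows "mult_rep c d c (snd c q, snd d \<one>) = snd c q"
proof -
  have "q \<in> carrier G" using charts_at_mcarrier[OF c] carrier_eq by simp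
  then show ?thesis using mult_rep_eq'[of q c \<one> d c] charts_atD[OF c] charts_atD[OF d] by simp
qed

text \<open>The right-invariant field at q k is its value at q moved by right translation by k.
  Differentiating this in k at the identity along \<open>\<zeta>\<close> gives one mixed derivative
  of the multiplication; the derivative of the left-invariant field is the other.\<close>

lemma left_field_right_field_commute:
  assumes c: "c \<in> charts_at A q" and \<xi>: "\<xi> \<in> tangent_space A \<one>" and \<zeta>: "\<zeta> \<in> tangent_space A \<one>"
  shows "frechet_derivative (right_field c \<xi>) (at (snd c q)) (left_field c \<zeta> (snd c q)) =
         frechet_derivative (left_field c \<zeta>) (at (snd c q)) (right_field c \<xi> (snd c q))"
proof -
  define d where "d = chart_at A \<one>"
  have d: "d \<in> charts_at A \<one>" unfolding d_def by (rule one_chart)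
  note cD = charts_atD[OF c] and dD = charts_atD[OF d]
  have q: "q \<in> carrier G" using charts_at_mcarrier[OF c] carrier_eq by simp
  let ?x = "snd c q" and ?y = "snd d \<one>" and ?F = "mult_rep c d c"
  let ?r = "right_field c \<xi> ?x"
  have z: "(?x, ?y) \<in> mult_dom c d c" by (rule chart_dom_right_one[OF c d])
  have F0: "?F (?x, ?y) = ?x" by (rule mult_rep_right_one[OF c d])
  have xc: "?x \<in> snd c ` fst c" using cD by simp
  have "(right_field c \<xi> has_derivative frechet_derivative (right_field c \<xi>) (at ?x)) (at (?F (?x, ?y)))"
    unfolding F0 by (rule differentiable_has_derivative[OF right_field_differentiable[OF c \<xi>]])
  from diff_chain_at[OF has_derivative_slice(1)[OF mult_rep_has_derivative[OF z cD(2) dD(2) cD(2)]] this]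
  have 1: "((\<lambda>y. right_field c \<xi> (?F (?x, y))) has_derivative
      (\<lambda>v. frechet_derivative (right_field c \<xi>) (at ?x) (Dmult c d c (?x, ?y) (0, v)))) (at ?y)"
    by (simp add: o_def)
  have 2: "((\<lambda>y. Dmult c d c (?x, y) (?r, 0)) has_derivative
      (\<lambda>v. frechet_derivative (\<lambda>z. Dmult c d c z (?r, 0)) (at (?x, ?y)) (0, v))) (at ?y)"
    by (rule has_derivative_slice(1)[OF Dmult_has_derivative[OF z cD(2) dD(2) cD(2)]])
  have "eventually (\<lambda>y. right_field c \<xi> (?F (?x, y)) = Dmult c d c (?x, y) (?r, 0)) (nhds ?y)"
    using eventually_mult_dom_snd(1)[OF z cD(2) dD(2) cD(2)]
  proof eventually_elim
    case (elim y)
    let ?k = "chart_inv d y"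
    have k: "?k \<in> fst d" "q \<otimes> ?k \<in> fst c" "y \<in> snd d ` fst d"
      using mult_domE[OF elim cD(2) dD(2)] chart_inv_eq[OF chart[OF cD(2)] cD(1)] chart_inv_in[of y d] by auto
    have kG: "?k \<in> carrier G" using chart_carrier[OF dD(2) k(1)] .
    have qk: "c \<in> charts_at A (q \<otimes> ?k)" and kd: "d \<in> charts_at A ?k"
      using k cD dD by (auto simp: charts_at_def)
    have "?F (?x, y) = snd c (q \<otimes> ?k)"
      using mult_rep_eq[OF elim cD(2) dD(2)] chart_inv_eq[OF chart[OF cD(2)] cD(1)] by simp
    then have "right_field c \<xi> (?F (?x, y)) = right_inv_vf G A \<xi> (q \<otimes> ?k) c" using right_field_at[OF qk] by simp
    also have "\<dots> = Dmult c d c (?x, snd d ?k) (right_inv_vf G A \<xi> q c, 0)"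
      unfolding right_inv_vf_mult[OF q kG \<xi>] by (rule TR_chart[OF right_inv_vf_in[OF q] kd c qk])
    finally show ?case by (simp add: right_field_at[OF c] chart_inv_right[OF k(3)])
  qed
  then have "frechet_derivative (\<lambda>y. right_field c \<xi> (?F (?x, y))) (at ?y) (\<zeta> d) =
      frechet_derivative (\<lambda>y. Dmult c d c (?x, y) (?r, 0)) (at ?y) (\<zeta> d)"
    by (simp add: frechet_derivative_cong_nhds(1))
  then have "frechet_derivative (right_field c \<xi>) (at ?x) (Dmult c d c (?x, ?y) (0, \<zeta> d)) =
      frechet_derivative (\<lambda>z. Dmult c d c z (?r, 0)) (at (?x, ?y)) (0, \<zeta> d)"
    unfolding frechet_derivative_eq[OF 1] frechet_derivative_eq[OF 2] .
  also have "\<dots> = frechet_derivative (\<lambda>z. Dmult c d c z (0, \<zeta> d)) (at (?x, ?y)) (?r, 0)"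
    by (rule symmetric_second_derivative[OF smooth_mult_rep[OF cD(2) dD(2) cD(2)] z])
  also have "\<dots> = frechet_derivative (left_field c \<zeta>) (at ?x) ?r"
    unfolding frechet_derivative_eq[OF left_field_has_derivative[OF c d \<zeta>]] ..
  finally show ?thesis unfolding left_field_eq[OF cD(2) xc d \<zeta>] .
qed

lemma left_inv_vf_one: "\<xi> \<in> tangent_space A \<one> \<Longrightarrow> left_inv_vf G A \<xi> \<one> = \<xi>"
  using TL_one[of \<one> \<xi>] by (simp add: left_inv_vf_def)

lemma bracket_chart:
  assumes d: "d \<in> charts_at A \<one>" and "\<zeta> \<in> tangent_space A \<one>" "\<eta> \<in> tangent_space A \<one>"
  shows "bracket G A \<zeta> \<eta> d = frechet_derivative (left_field d \<eta>) (at (snd d \<one>)) (\<zeta> d) -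
     frechet_derivative (left_field d \<zeta>) (at (snd d \<one>)) (\<eta> d)"
  using assms by (simp add: bracket_def lie_bracket_def left_inv_vf_one left_field_def[abs_def])

text \<open>Differentiates the left invariance of the field of \<open>\<eta>\<close> at q k in k
  along \<open>\<zeta>\<close>. The result splits into the derivative taken at the identity and a
  second derivative of the multiplication; the latter is symmetric in \<open>\<zeta>\<close> and
  \<open>\<eta>\<close> and cancels in the commutator.\<close>

lemma left_field_bracket_aux:
  assumes c: "c \<in> charts_at A q" and d: "d \<in> charts_at A \<one>"
    and \<zeta>: "\<zeta> \<in> tangent_space A \<one>" and \<eta>: "\<eta> \<in> tangent_space A \<one>"
  shows "frechet_derivative (left_field c \<eta>) (at (snd c q)) (left_field c \<zeta> (snd c q)) -
         frechet_derivative (left_field c \<zeta>) (at (snd c q)) (left_field c \<eta> (snd c q)) =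
         Dmult c d c (snd c q, snd d \<one>) (0, bracket G A \<zeta> \<eta> d)"
proof -
  note cD = charts_atD[OF c] and dD = charts_atD[OF d]
  have q: "q \<in> carrier G" using charts_at_mcarrier[OF c] carrier_eq by simp
  let ?x = "snd c q" and ?y = "snd d \<one>" and ?F = "mult_rep c d c"
  have z: "(?x, ?y) \<in> mult_dom c d c" by (rule chart_dom_right_one[OF c d])
  have xc: "?x \<in> snd c ` fst c" using cD by simp
  have F0: "?F (?x, ?y) = ?x" by (rule mult_rep_right_one[OF c d])
  let ?D2 = "\<lambda>v w. frechet_derivative (\<lambda>z. Dmult c d c z v) (at (?x, ?y)) w"
  have main: "frechet_derivative (left_field c \<eta>) (at ?x) (left_field c \<zeta> ?x) =
      Dmult c d c (?x, ?y) (0, frechet_derivative (left_field d \<eta>) (at ?y) (\<zeta> d)) + ?D2 (0, \<eta> d) (0, \<zeta> d)"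
    if \<zeta>: "\<zeta> \<in> tangent_space A \<one>" and \<eta>: "\<eta> \<in> tangent_space A \<one>" for \<zeta> \<eta>
  proof -
    have dc: "(left_field c \<eta> has_derivative frechet_derivative (left_field c \<eta>) (at ?x)) (at (?F (?x, ?y)))"
      unfolding F0 using left_field_has_derivative[OF c d \<eta>] by (metis frechet_derivative_eq)
    have dd: "(left_field d \<eta> has_derivative frechet_derivative (left_field d \<eta>) (at ?y)) (at ?y)"
      using left_field_has_derivative[OF d d \<eta>] by (metis frechet_derivative_eq)
    have 1: "((\<lambda>y. left_field c \<eta> (?F (?x, y))) has_derivative
        (\<lambda>v. frechet_derivative (left_field c \<eta>) (at ?x) (Dmult c d c (?x, ?y) (0, v)))) (at ?y)"
      using diff_chain_at[OF has_derivative_slice(1)[OF mult_rep_has_derivative[OF z cD(2) dD(2) cD(2)]] dc]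
      by (simp add: o_def)
    have g: "((\<lambda>y. (?x, y)) has_derivative (\<lambda>v. (0, v))) (at ?y)"
      by (intro has_derivative_Pair has_derivative_const has_derivative_ident)
    note 2 = has_derivative_frechet_apply[OF E smooth_mult_rep[OF cD(2) dD(2) cD(2)] g z dd]
    have "eventually (\<lambda>y. left_field c \<eta> (?F (?x, y)) = Dmult c d c (?x, y) (0, left_field d \<eta> y)) (nhds ?y)"
      using eventually_mult_dom_snd(1)[OF z cD(2) dD(2) cD(2)]
    proof eventually_elim
      case (elim y)
      let ?k = "chart_inv d y"
      have k: "?k \<in> fst d" "q \<otimes> ?k \<in> fst c" "y \<in> snd d ` fst d"
        using mult_domE[OF elim cD(2) dD(2)] chart_inv_eq[OF chart[OF cD(2)] cD(1)] chart_inv_in[of y d] by auto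
      have kG: "?k \<in> carrier G" using chart_carrier[OF dD(2) k(1)] .
      have qk: "c \<in> charts_at A (q \<otimes> ?k)" and kd: "d \<in> charts_at A ?k"
        using k cD dD by (auto simp: charts_at_def)
      have "?F (?x, y) = snd c (q \<otimes> ?k)"
        using mult_rep_eq[OF elim cD(2) dD(2)] chart_inv_eq[OF chart[OF cD(2)] cD(1)] by simp
      then have "left_field c \<eta> (?F (?x, y)) = left_inv_vf G A \<eta> (q \<otimes> ?k) c" using left_field_at[OF qk] by simp
      also have "\<dots> = Dmult c d c (?x, snd d ?k) (0, left_inv_vf G A \<eta> ?k d)"
        unfolding left_inv_vf_mult[OF q kG \<eta>] by (rule TL_chart[OF left_inv_vf_in[OF kG] c kd qk])
      finally show ?case by (simp add: left_field_def chart_inv_right[OF k(3)])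
    qed
    then have "frechet_derivative (\<lambda>y. left_field c \<eta> (?F (?x, y))) (at ?y) (\<zeta> d) =
        frechet_derivative (\<lambda>y. Dmult c d c (?x, y) (0, left_field d \<eta> y)) (at ?y) (\<zeta> d)"
      by (simp add: frechet_derivative_cong_nhds(1))
    then show ?thesis
      unfolding frechet_derivative_eq[OF 1] frechet_derivative_eq[OF 2] left_field_eq[OF cD(2) xc d \<zeta>] left_field_at[OF d] left_inv_vf_one[OF \<eta>] .
  qed
  have l: "linear (Dmult c d c (?x, ?y))"
    using mult_rep_has_derivative[OF z cD(2) dD(2) cD(2)] by (rule has_derivative_linear)
  show ?thesis
    unfolding main[OF \<zeta> \<eta>] main[OF \<eta> \<zeta>] bracket_chart[OF d \<zeta> \<eta>]
      symmetric_second_derivative[OF smooth_mult_rep[OF cD(2) dD(2) cD(2)] z, of "(0, \<zeta> d)"]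
    using linear_diff[OF l, of "(0, _)" "(0, _)"] by simp
qed

text \<open>The preceding identity at q = 1 with two different charts is the transformation law of a
  tangent vector, because translation by the identity acts trivially.\<close>

lemma bracket_in:
  assumes \<zeta>: "\<zeta> \<in> tangent_space A \<one>" and \<eta>: "\<eta> \<in> tangent_space A \<one>"
  shows "bracket G A \<zeta> \<eta> \<in> tangent_space A \<one>"
proof -
  define d where "d = chart_at A \<one>"
  have d: "d \<in> charts_at A \<one>" unfolding d_def by (rule one_chart)
  have "bracket G A \<zeta> \<eta> c = coord_tvec A d \<one> (bracket G A \<zeta> \<eta> d) c" for c
  proof (cases "c \<in> charts_at A \<one>")
    case True
    have "bracket G A \<zeta> \<eta> c = Dmult c d c (snd c \<one>, snd d \<one>) (0, bracket G A \<zeta> \<eta> d)"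
      using left_field_bracket_aux[OF True d \<zeta> \<eta>]
      by (simp add: bracket_chart[OF True \<zeta> \<eta>] left_field_at[OF True] left_inv_vf_one \<zeta> \<eta>)
    also have "\<dots> = TL \<one> \<one> (coord_tvec A d \<one> (bracket G A \<zeta> \<eta> d)) c"
      using TL_chart[OF coord_tvec_in[OF diff_atlas_base d] True d, of c] True by (simp add: coord_tvec_chart[OF diff_atlas_base d])
    also have "\<dots> = coord_tvec A d \<one> (bracket G A \<zeta> \<eta> d) c"
      using TL_one[OF _ coord_tvec_in[OF diff_atlas_base d]] by simp
    finally show ?thesis .
  qed (simp add: bracket_def lie_bracket_def coord_tvec_def)
  then have "bracket G A \<zeta> \<eta> = coord_tvec A d \<one> (bracket G A \<zeta> \<eta> d)" by blast
  then show ?thesis using coord_tvec_in[OF diff_atlas_base d] by metis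
qed

lemma left_field_bracket:
  assumes c: "c \<in> charts_at A q" and \<zeta>: "\<zeta> \<in> tangent_space A \<one>" and \<eta>: "\<eta> \<in> tangent_space A \<one>"
  shows "frechet_derivative (left_field c \<eta>) (at (snd c q)) (left_field c \<zeta> (snd c q)) -
         frechet_derivative (left_field c \<zeta>) (at (snd c q)) (left_field c \<eta> (snd c q)) =
         left_inv_vf G A (bracket G A \<zeta> \<eta>) q c"
proof -
  have q: "q \<in> carrier G" using charts_at_mcarrier[OF c] carrier_eq by simp
  have "left_inv_vf G A (bracket G A \<zeta> \<eta>) q c =
    Dmult c (chart_at A \<one>) c (snd c q, snd (chart_at A \<one>) \<one>) (0, bracket G A \<zeta> \<eta> (chart_at A \<one>))"
    unfolding left_inv_vf_def using TL_chart[OF bracket_in[OF \<zeta> \<eta>] c one_chart, of c] c q by simp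
  then show ?thesis using left_field_bracket_aux[OF c one_chart \<zeta> \<eta>] by simp
qed

lemma bracket_anti: "bracket G A \<zeta> \<eta> = (\<lambda>c. - bracket G A \<eta> \<zeta> c)"
  by (auto simp: bracket_def lie_bracket_def)


section \<open>Adjoint action, momentum map and reduction projection\<close>

lemma TL_TR_commute:
  assumes "q \<in> carrier G" "g \<in> carrier G" "p \<in> carrier G" "v \<in> tangent_space A p"
  shows "TR g (q \<otimes> p) (TL q p v) = TL q (p \<otimes> g) (TR g p v)"
proof -
  have "tangent_map A A (right_trans G g \<circ> left_trans G q) (p, v) = tangent_map A A (left_trans G q \<circ> right_trans G g) (p, v)"
    using assms by (intro tangent_map_cong[OF diff_atlas_base]) (auto simp: carrier_eq left_trans_def right_trans_def m_assoc)
  then show ?thesis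
    using tangent_map_comp[OF diff_atlas_base diff_atlas_base diff_atlas_base mdiff_left_trans[of q p] _ assms(4), of "right_trans G g"]
      tangent_map_comp[OF diff_atlas_base diff_atlas_base diff_atlas_base mdiff_right_trans[of g p] _ assms(4), of "left_trans G q"]
      mdiff_right_trans[of g "q \<otimes> p"] mdiff_left_trans[of q "p \<otimes> g"] assms
    by (simp add: left_trans_def[of G q p] right_trans_def[of G g p])
qed

lemma Ad_eq:
  assumes "g \<in> carrier G" "\<eta> \<in> tangent_space A \<one>"
  shows "Ad G A g \<eta> = TR (inv g) g (TL g \<one> \<eta>)"
proof -
  have "tangent_map A A (\<lambda>x. g \<otimes> x \<otimes> inv g) (\<one>, \<eta>) = tangent_map A A (right_trans G (inv g) \<circ> left_trans G g) (\<one>, \<eta>)"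
    using assms by (intro tangent_map_cong[OF diff_atlas_base]) (auto simp: carrier_eq left_trans_def right_trans_def)
  then show ?thesis
    using tangent_map_comp[OF diff_atlas_base diff_atlas_base diff_atlas_base mdiff_left_trans[of g \<one>] _ assms(2), of "right_trans G (inv g)"]
      mdiff_right_trans[of "inv g" g] assms
    by (simp add: Ad_def left_trans_def[of G g \<one>])
qed

lemma TR_Ad:
  assumes "g \<in> carrier G" "\<eta> \<in> tangent_space A \<one>"
  shows "TR g \<one> (Ad G A g \<eta>) = TL g \<one> \<eta>"
  using TR_comp[of g "inv g" g "TL g \<one> \<eta>"] TR_one[of g "TL g \<one> \<eta>"] TL_in[of g \<one> \<eta>] assms
  by (simp add: Ad_eq)

lemma Ad_in: "g \<in> carrier G \<Longrightarrow> \<eta> \<in> tangent_space A \<one> \<Longrightarrow> Ad G A g \<eta> \<in> tangent_space A \<one>"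
  using TR_in[of "inv g" g] by (simp add: Ad_eq)

lemma momentum_map_apply:
  "\<xi> \<in> tangent_space A \<one> \<Longrightarrow> momentum_map G A z \<xi> = snd z (right_inv_vf G A \<xi> (fst z))"
  by (simp add: momentum_map_def lie_algebra_def right_inv_vf_def split: prod.split)

lemma reduction_proj_apply:
  "reduction_proj G A z \<xi> = (if \<xi> \<in> tangent_space A \<one> then snd z (left_inv_vf G A \<xi> (fst z)) else 0)"
  by (simp add: reduction_proj_def lie_algebra_def left_inv_vf_def split: prod.split)

lemma momentum_level_bundle: "z \<in> momentum_level G A \<mu> \<Longrightarrow> z \<in> cotangent_bundle A"
  by (simp only: momentum_level_def mem_Collect_eq)

text \<open>Every tangent vector at the base point is the right translate of a Lie algebra element,
  so the momentum determines the covector.\<close>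

lemma momentum_level_unique:
  assumes z: "z \<in> momentum_level G A \<mu>" and w: "w \<in> momentum_level G A \<mu>" and eq: "fst z = fst w"
  shows "z = w"
proof -
  note bz = momentum_level_bundle[OF z] and bw = momentum_level_bundle[OF w]
  have q: "fst z \<in> carrier G" using bundleD(1)[OF bz] by (simp add: carrier_eq)
  have "snd z v = snd w v" for v
  proof (cases "v \<in> tangent_space A (fst z)")
    case True
    obtain \<xi> where \<xi>: "\<xi> \<in> tangent_space A \<one>" "v = TR (fst z) \<one> \<xi>" using TR_surj[OF q True] .
    have "momentum_map G A z \<xi> = momentum_map G A w \<xi>" using z w by (simp add: momentum_level_def)
    then show ?thesis using \<xi> eq by (simp add: momentum_map_apply right_inv_vf_def)
  next
    case False
    then show ?thesis using bundleD(2)[OF bz] bundleD(2)[OF bw] eq by (simp add: cotangent_space_def)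
  qed
  then show ?thesis using eq by (simp add: prod_eq_iff fun_eq_iff)
qed

lemma covec_linear_apply:
  assumes "\<alpha> \<in> cotangent_space A p" "v \<in> tangent_space A p" "w \<in> tangent_space A p"
  shows "\<alpha> (\<lambda>c. a *\<^sub>R v c + b *\<^sub>R w c) = a * \<alpha> v + b * \<alpha> w"
  using assms unfolding cotangent_space_def by blast

lemma reduction_proj_in:
  assumes z: "z \<in> cotangent_bundle A"
  shows "reduction_proj G A z \<in> cotangent_space A \<one>"
proof -
  have q: "fst z \<in> carrier G" using bundleD(1)[OF z] by (simp add: carrier_eq)
  have lin: "left_inv_vf G A (\<lambda>c. a *\<^sub>R v c + b *\<^sub>R w c) (fst z) =
      (\<lambda>c. a *\<^sub>R left_inv_vf G A v (fst z) c + b *\<^sub>R left_inv_vf G A w (fst z) c)" for a b v w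
    unfolding left_inv_vf_def by (rule tangent_map_linear[OF mdiff_left_trans[OF q one_closed]])
  have one: "\<one> \<in> mcarrier A" by (simp add: carrier_eq)
  show ?thesis
    unfolding cotangent_space_def[of A \<one>]
    by (simp add: reduction_proj_apply tangent_space_linear[OF diff_atlas_base one] lin
        covec_linear_apply[OF bundleD(2)[OF z] left_inv_vf_in[OF q] left_inv_vf_in[OF q]])
qed

lemma cov_uminus:
  assumes "\<nu> \<in> cotangent_space A p" "v \<in> tangent_space A p"
  shows "\<nu> (\<lambda>c. - v c) = - \<nu> v"
  using covec_linear_apply[OF assms(1,2,2), of "-1" 0] by simp

lemma bracket_pairing_anti:
  assumes "\<nu> \<in> cotangent_space A \<one>" "\<xi> \<in> tangent_space A \<one>" "\<eta> \<in> tangent_space A \<one>"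
  shows "\<nu> (bracket G A \<xi> \<eta>) = - \<nu> (bracket G A \<eta> \<xi>)"
  using cov_uminus[OF assms(1) bracket_in[OF assms(3,2)]] bracket_anti[of \<xi> \<eta>] by simp

section \<open>Hamiltonian vector fields on coadjoint orbits\<close>

text \<open>The value depends on the orbit vectors alone: replace the first generator, then the
  second after swapping the arguments by antisymmetry.\<close>

lemma orbit_symplectic_eq:
  assumes \<nu>: "\<nu> \<in> cotangent_space A \<one>" and \<xi>: "\<xi> \<in> tangent_space A \<one>" and \<eta>: "\<eta> \<in> tangent_space A \<one>"
  shows "orbit_symplectic G A \<nu> (coad G A \<xi> \<nu>) (coad G A \<eta> \<nu>) = - \<nu> (bracket G A \<xi> \<eta>)"
  unfolding orbit_symplectic_def
proof (rule the_equality)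
  show "\<exists>\<xi>'\<in>lie_algebra G A. \<exists>\<eta>'\<in>lie_algebra G A. coad G A \<xi> \<nu> = coad G A \<xi>' \<nu> \<and>
      coad G A \<eta> \<nu> = coad G A \<eta>' \<nu> \<and> - \<nu> (bracket G A \<xi> \<eta>) = - \<nu> (bracket G A \<xi>' \<eta>')"
    using \<xi> \<eta> by (auto simp: lie_algebra_def)
  fix r
  assume "\<exists>\<xi>'\<in>lie_algebra G A. \<exists>\<eta>'\<in>lie_algebra G A. coad G A \<xi> \<nu> = coad G A \<xi>' \<nu> \<and>
      coad G A \<eta> \<nu> = coad G A \<eta>' \<nu> \<and> r = - \<nu> (bracket G A \<xi>' \<eta>')"
  then obtain \<xi>' \<eta>' where *: "\<xi>' \<in> tangent_space A \<one>" "\<eta>' \<in> tangent_space A \<one>"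
    "coad G A \<xi> \<nu> = coad G A \<xi>' \<nu>" "coad G A \<eta> \<nu> = coad G A \<eta>' \<nu>" "r = - \<nu> (bracket G A \<xi>' \<eta>')"
    by (auto simp: lie_algebra_def)
  have "\<nu> (bracket G A \<xi>' \<eta>') = \<nu> (bracket G A \<xi> \<eta>')"
    using fun_cong[OF *(3), of \<eta>'] *(2) by (simp add: coad_def lie_algebra_def)
  moreover have "\<nu> (bracket G A \<eta>' \<xi>) = \<nu> (bracket G A \<eta> \<xi>)"
    using fun_cong[OF *(4), of \<xi>] \<xi> by (simp add: coad_def lie_algebra_def)
  ultimately show "r = - \<nu> (bracket G A \<xi> \<eta>)"
    using *(5) bracket_pairing_anti[OF \<nu> \<xi> \<eta>] bracket_pairing_anti[OF \<nu> \<xi> *(2)] by simp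
qed

text \<open>By antisymmetry the value in \<open>df\<close> is \<open>coad G A \<eta> \<nu>\<close>
  evaluated at \<open>\<zeta>\<close>, so it depends on the orbit vector and not on its generator
  \<open>\<eta>\<close>; this settles \<open>orbit_differential\<close>. The orbit form is
  nondegenerate because its values on all orbit vectors spell out the first argument.\<close>

lemma orbit_hamiltonian_vf_eq:
  assumes \<nu>: "\<nu> \<in> cotangent_space A \<one>" and \<zeta>: "\<zeta> \<in> tangent_space A \<one>"
    and df: "\<And>\<eta>. \<eta> \<in> tangent_space A \<one> \<Longrightarrow>
       differential A (\<lambda>g. f (coAd G A g \<nu>)) \<one> \<eta> = - \<nu> (bracket G A \<zeta> \<eta>)"
  shows "orbit_hamiltonian_vf G A f \<nu> = (\<nu>, coad G A \<zeta> \<nu>)"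
proof -
  have od: "orbit_differential G A f \<nu> (coad G A \<eta> \<nu>) = - \<nu> (bracket G A \<zeta> \<eta>)"
    if \<eta>: "\<eta> \<in> tangent_space A \<one>" for \<eta>
    unfolding orbit_differential_def
  proof (rule the_equality)
    show "\<exists>\<xi>\<in>lie_algebra G A. coad G A \<eta> \<nu> = coad G A \<xi> \<nu> \<and>
        - \<nu> (bracket G A \<zeta> \<eta>) = differential A (\<lambda>g. f (coAd G A g \<nu>)) \<one> \<xi>"
      using \<eta> df[OF \<eta>] by (auto simp: lie_algebra_def)
    fix r
    assume "\<exists>\<xi>\<in>lie_algebra G A. coad G A \<eta> \<nu> = coad G A \<xi> \<nu> \<and>
        r = differential A (\<lambda>g. f (coAd G A g \<nu>)) \<one> \<xi>"
    then obtain \<xi> where \<xi>: "\<xi> \<in> tangent_space A \<one>" "coad G A \<eta> \<nu> = coad G A \<xi> \<nu>"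
      "r = differential A (\<lambda>g. f (coAd G A g \<nu>)) \<one> \<xi>" by (auto simp: lie_algebra_def)
    have "\<nu> (bracket G A \<eta> \<zeta>) = \<nu> (bracket G A \<xi> \<zeta>)"
      using fun_cong[OF \<xi>(2), of \<zeta>] \<zeta> by (simp add: coad_def lie_algebra_def)
    then show "r = - \<nu> (bracket G A \<zeta> \<eta>)"
      using df[OF \<xi>(1)] \<xi>(3) bracket_pairing_anti[OF \<nu> \<zeta> \<eta>] bracket_pairing_anti[OF \<nu> \<zeta> \<xi>(1)] by simp
  qed
  have "(THE a. a \<in> orbit_tangent_space G A \<nu> \<and>
     (\<forall>b\<in>orbit_tangent_space G A \<nu>. orbit_symplectic G A \<nu> a b = orbit_differential G A f \<nu> b)) =
     coad G A \<zeta> \<nu>"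
  proof (rule the_equality)
    show "coad G A \<zeta> \<nu> \<in> orbit_tangent_space G A \<nu> \<and>
     (\<forall>b\<in>orbit_tangent_space G A \<nu>. orbit_symplectic G A \<nu> (coad G A \<zeta> \<nu>) b = orbit_differential G A f \<nu> b)"
      using \<zeta> orbit_symplectic_eq[OF \<nu> \<zeta>] od by (auto simp: orbit_tangent_space_def lie_algebra_def)
    fix a
    assume a: "a \<in> orbit_tangent_space G A \<nu> \<and>
     (\<forall>b\<in>orbit_tangent_space G A \<nu>. orbit_symplectic G A \<nu> a b = orbit_differential G A f \<nu> b)"
    then obtain \<xi> where \<xi>: "\<xi> \<in> tangent_space A \<one>" "a = coad G A \<xi> \<nu>"
      by (auto simp: orbit_tangent_space_def lie_algebra_def)
    have "\<nu> (bracket G A \<xi> \<eta>) = \<nu> (bracket G A \<zeta> \<eta>)" if \<eta>: "\<eta> \<in> tangent_space A \<one>" for \<eta>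
    proof -
      have "coad G A \<eta> \<nu> \<in> orbit_tangent_space G A \<nu>"
        using \<eta> by (auto simp: orbit_tangent_space_def lie_algebra_def)
      then show ?thesis
        using a \<xi>(2) orbit_symplectic_eq[OF \<nu> \<xi>(1) \<eta>] od[OF \<eta>] by simp
    qed
    then show "a = coad G A \<zeta> \<nu>" using \<xi>(2) by (auto simp: coad_def lie_algebra_def)
  qed
  then show ?thesis by (simp add: orbit_hamiltonian_vf_def)
qed

section \<open>Left-invariant Hamiltonians\<close>

lemma left_field_coord_linear:
  assumes c: "c \<in> charts_at A q" and d: "d \<in> charts_at A \<one>"
  shows "linear (\<lambda>a. left_field c (coord_tvec A d \<one> a) (snd c q))"
    and "linear (\<lambda>a. frechet_derivative (left_field c (coord_tvec A d \<one> a)) (at (snd c q)) u)"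
proof -
  note cD = charts_atD[OF c] and dD = charts_atD[OF d]
  have z: "(snd c q, snd d \<one>) \<in> mult_dom c d c" by (rule chart_dom_right_one[OF c d])
  have xc: "snd c q \<in> snd c ` fst c" using cD by simp
  have slice: "linear (\<lambda>a. k (0, a))" if k: "linear k" for k :: "'e \<times> 'e \<Rightarrow> 'e"
    using linear_add[OF k, of "(0, _)" "(0, _)"] linear_scale[OF k, of _ "(0, _)"] by (intro linearI) simp_all
  note ct = coord_tvec_in[OF diff_atlas_base d]
  show "linear (\<lambda>a. left_field c (coord_tvec A d \<one> a) (snd c q))"
    unfolding left_field_eq[OF cD(2) xc d ct] coord_tvec_chart[OF diff_atlas_base d]
    by (rule slice[OF has_derivative_linear[OF mult_rep_has_derivative[OF z cD(2) dD(2) cD(2)]]])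
  \<comment> \<open>Symmetry of second derivatives moves \<open>a\<close> into the outer direction,
    where linearity is that of a derivative.\<close>
  show "linear (\<lambda>a. frechet_derivative (left_field c (coord_tvec A d \<one> a)) (at (snd c q)) u)"
    unfolding frechet_derivative_eq[OF left_field_has_derivative[OF c d ct]] coord_tvec_chart[OF diff_atlas_base d]
      symmetric_second_derivative[OF smooth_mult_rep[OF cD(2) dD(2) cD(2)] z, of "(0, _)"]
    by (rule slice[OF has_derivative_linear[OF Dmult_has_derivative[OF z cD(2) dD(2) cD(2)]]])
qed

lemma left_field_differentiable:
  "c \<in> charts_at A q \<Longrightarrow> \<xi> \<in> tangent_space A \<one> \<Longrightarrow> left_field c \<xi> differentiable at (snd c q)"
  using left_field_has_derivative[OF _ one_chart] unfolding differentiable_def by blast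

text \<open>Lifting by the inverse of the base point carries the covector to the identity without
  changing \<open>H\<close>. The sum over \<open>E\<close> is the fibre coordinate of the
  pulled-back covector, that is, of its image under \<open>reduction_proj\<close>.\<close>

lemma invariant_hamiltonian_rep:
  assumes inv: "\<And>g z. g \<in> carrier G \<Longrightarrow> z \<in> cotangent_bundle A \<Longrightarrow> H (cotangent_lift G A g z) = H z"
    and c: "c \<in> A" and d: "d \<in> charts_at A \<one>" and x: "x \<in> snd c ` fst c"
  shows "(H \<circ> chart_inv (cotangent_chart A c)) (x, p) =
    (H \<circ> chart_inv (cotangent_chart A d)) (snd d \<one>, \<Sum>e\<in>E. (p \<bullet> left_field c (coord_tvec A d \<one> e) x) *\<^sub>R e)"
proof -
  let ?g = "chart_inv c x" and ?N = "\<Sum>e\<in>E. (p \<bullet> left_field c (coord_tvec A d \<one> e) x) *\<^sub>R e"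
  note dD = charts_atD[OF d]
  have cg: "c \<in> charts_at A ?g" by (rule charts_at_inv[OF c x])
  have g: "?g \<in> carrier G" by (rule charts_at_carrier[OF cg])
  let ?\<alpha> = "covec_of c ?g p"
  have "(?g, ?\<alpha>) \<in> cotangent_bundle A" using covec_of_in[OF cg] g by (simp add: carrier_eq)
  then have "H (?g, ?\<alpha>) = H (cotangent_lift G A (inv ?g) (?g, ?\<alpha>))" using inv g by simp
  also have "cotangent_lift G A (inv ?g) (?g, ?\<alpha>) = (\<one>, covec_of d \<one> ?N)"
  proof -
    have "?\<alpha> (TL ?g \<one> v) = ?N \<bullet> v d" if v: "v \<in> tangent_space A \<one>" for v
    proof -
      have l: "linear (\<lambda>a. p \<bullet> left_field c (coord_tvec A d \<one> a) x)"
        using left_field_coord_linear(1)[OF cg d]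
        by (simp add: chart_inv_right[OF x] linear_iff inner_add_right)
      have "?\<alpha> (TL ?g \<one> v) = p \<bullet> left_field c v x"
        using TL_in[of ?g \<one> v] g by (simp add: covec_of_def left_field_def left_inv_vf_def)
      also have "\<dots> = ?N \<bullet> v d" using riesz[OF E l, of "v d"] by (simp add: coord_tvec_self[OF d v])
      finally show ?thesis .
    qed
    then show ?thesis using g by (auto simp: cotangent_lift_def covec_of_def[of d \<one>] fun_eq_iff)
  qed
  also have "(\<one>, covec_of d \<one> ?N) = chart_inv (cotangent_chart A d) (snd d \<one>, ?N)"
    using cotangent_chart_inv[OF dD(2), of "snd d \<one>" ?N] dD by (simp add: chart_inv_eq chart)
  finally show ?thesis by (simp add: cotangent_chart_inv[OF c x])
qed

text \<open>In the left trivialization \<open>H\<close> depends on the fibre coordinate only; \<open>\<zeta>\<close> is its derivative.\<close>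

lemma invariant_hamiltonian_derivative:
  assumes inv: "\<And>g z. g \<in> carrier G \<Longrightarrow> z \<in> cotangent_bundle A \<Longrightarrow> H (cotangent_lift G A g z) = H z"
    and H: "\<And>z. z \<in> cotangent_bundle A \<Longrightarrow> mdiff TA real_atlas H z"
    and c: "c \<in> charts_at A q"
  obtains \<zeta> where "\<zeta> \<in> tangent_space A \<one>"
    "\<And>u w. frechet_derivative (H \<circ> chart_inv (cotangent_chart A c)) (at (snd c q, p)) (u, w) =
       w \<bullet> left_field c \<zeta> (snd c q) + p \<bullet> frechet_derivative (left_field c \<zeta>) (at (snd c q)) u"
proof -
  define d where "d = chart_at A \<one>"
  have d: "d \<in> charts_at A \<one>" unfolding d_def by (rule one_chart)
  note cD = charts_atD[OF c] and dD = charts_atD[OF d]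
  let ?D = "cotangent_chart A d" and ?C = "cotangent_chart A c" and ?x = "snd c q"
  let ?v = "\<lambda>e. coord_tvec A d \<one> e"
  define N where "N y = (\<Sum>e\<in>E. (snd y \<bullet> left_field c (?v e) (fst y)) *\<^sub>R e)" for y :: "'e \<times> 'e"
  let ?Dleft = "\<lambda>\<xi>. frechet_derivative (left_field c \<xi>) (at ?x)"
  have z1: "(\<one>, covec_of d \<one> (N (?x, p))) \<in> cotangent_bundle A"
    using covec_of_in[OF d] by (simp add: carrier_eq)
  have "mdiff TA real_atlas H (\<one>, covec_of d \<one> (N (?x, p)))" by (rule H[OF z1])
  from mdiff_real_differentiable[OF this, of ?D]
  have dH: "(H \<circ> chart_inv ?D) differentiable at (snd d \<one>, N (?x, p))"
    using cotangent_chart_at[OF _ bundleD(2)[OF z1], of d] d by (simp add: covec_of_coords[OF d])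
  let ?K = "frechet_derivative (H \<circ> chart_inv ?D) (at (snd d \<one>, N (?x, p)))"
  have K: "linear ?K" by (rule linear_frechet_derivative[OF dH])
  have L: "((\<lambda>y. left_field c (?v e) (fst y)) has_derivative (\<lambda>h. ?Dleft (?v e) (fst h))) (at (?x, p))" for e
  proof -
    have "(left_field c (?v e) has_derivative ?Dleft (?v e)) (at (fst (?x, p)))"
      using differentiable_has_derivative[OF left_field_differentiable[OF c coord_tvec_in[OF diff_atlas_base d]]] by simp
    from diff_chain_at[OF bounded_linear_imp_has_derivative[OF bounded_linear_fst] this]
    show ?thesis by (simp add: o_def)
  qed
  have N: "(N has_derivative (\<lambda>h. \<Sum>e\<in>E. (snd (?x, p) \<bullet> ?Dleft (?v e) (fst h) + snd h \<bullet> left_field c (?v e) (fst (?x, p))) *\<^sub>R e)) (at (?x, p))"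
    unfolding N_def[abs_def]
    by (intro has_derivative_sum has_derivative_scaleR_left has_derivative_inner L has_derivative_snd has_derivative_ident)
  have chain: "(((H \<circ> chart_inv ?D) \<circ> (\<lambda>y. (snd d \<one>, N y))) has_derivative (?K \<circ> (\<lambda>h. (0,
      \<Sum>e\<in>E. (snd (?x, p) \<bullet> ?Dleft (?v e) (fst h) + snd h \<bullet> left_field c (?v e) (fst (?x, p))) *\<^sub>R e)))) (at (?x, p))"
    by (rule diff_chain_at[OF has_derivative_Pair[OF has_derivative_const N] differentiable_has_derivative[OF dH]])
  have ev: "eventually (\<lambda>y. (H \<circ> chart_inv ?C) y = ((H \<circ> chart_inv ?D) \<circ> (\<lambda>y. (snd d \<one>, N y))) y) (nhds (?x, p))"
  proof -
    have "open (snd c ` fst c)" using chart[OF cD(2)] by (simp add: is_chart_def)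
    then have "eventually (\<lambda>y. y \<in> snd c ` fst c \<times> UNIV) (nhds (?x, p))"
      using cD by (intro eventually_nhds_in_open open_Times) auto
    then show ?thesis
    proof eventually_elim
      case (elim y)
      then show ?case
        using invariant_hamiltonian_rep[of H c d "fst y" "snd y", OF inv cD(2) d] unfolding N_def
        by auto
    qed
  qed
  define k where "k e = ?K (0, e)" for e
  have k: "linear k"
    unfolding k_def using linear_add[OF K, of "(0, _)" "(0, _)"] linear_scale[OF K, of _ "(0, _)"]
    by (intro linearI) simp_all
  \<comment> \<open>The Riesz vector of the fibre derivative of \<open>H\<close> over the identity;
    as a Lie algebra element it is the functional derivative of the reduced Hamiltonian.\<close>
  define a where "a = (\<Sum>e\<in>E. k e *\<^sub>R e)"
  show ?thesis
  proof
    show "?v a \<in> tangent_space A \<one>" by (rule coord_tvec_in[OF diff_atlas_base d])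
    fix u w
    have "frechet_derivative (H \<circ> chart_inv ?C) (at (?x, p)) (u, w) =
        k (\<Sum>e\<in>E. (p \<bullet> ?Dleft (?v e) u + w \<bullet> left_field c (?v e) ?x) *\<^sub>R e)"
      unfolding frechet_derivative_cong_nhds(1)[OF ev] frechet_derivative_eq[OF chain] by (simp add: k_def)
    also have "\<dots> = (\<Sum>e\<in>E. (p \<bullet> ?Dleft (?v e) u + w \<bullet> left_field c (?v e) ?x) * k e)"
      by (simp add: linear_sum[OF k] linear_scale[OF k])
    also have "\<dots> = w \<bullet> left_field c (?v a) ?x + p \<bullet> ?Dleft (?v a) u"
      unfolding a_def linear_sum[OF left_field_coord_linear(1)[OF c d]] linear_sum[OF left_field_coord_linear(2)[OF c d]]
        linear_scale[OF left_field_coord_linear(1)[OF c d]] linear_scale[OF left_field_coord_linear(2)[OF c d]]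
      by (simp add: inner_sum_right sum.distrib[symmetric] algebra_simps)
    finally show "frechet_derivative (H \<circ> chart_inv ?C) (at (?x, p)) (u, w) =
       w \<bullet> left_field c (?v a) ?x + p \<bullet> ?Dleft (?v a) u" .
  qed
qed

end

section \<open>Right-invariant one-forms\<close>

locale momentum_level_form = lie_group_basis G A E
  for G :: "('g, 'b) monoid_scheme" (structure) and A :: "('g, 'e::real_inner) chart set" and E :: "'e set" +
  fixes \<gamma> :: "'g \<Rightarrow> 'g \<times> ('g, 'e) covec" and \<mu> :: "('g, 'e) covec"
  assumes one_form: "one_form A \<gamma>" and level: "\<gamma> ` carrier G \<subseteq> momentum_level G A \<mu>"
begin

lemma gamma_level: "q \<in> carrier G \<Longrightarrow> \<gamma> q \<in> momentum_level G A \<mu>"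
  using level by blast

lemma fst_gamma: "q \<in> carrier G \<Longrightarrow> fst (\<gamma> q) = q"
  using one_form by (simp add: one_form_def carrier_eq)

lemma gamma_bundle: "q \<in> carrier G \<Longrightarrow> \<gamma> q \<in> cotangent_bundle A"
  by (rule momentum_level_bundle[OF gamma_level])

lemma gamma_covec: "q \<in> carrier G \<Longrightarrow> snd (\<gamma> q) \<in> cotangent_space A q"
  using bundleD(2)[OF gamma_bundle] fst_gamma by simp

lemma gamma_pair: "q \<in> carrier G \<Longrightarrow> (q, snd (\<gamma> q)) = \<gamma> q"
  using fst_gamma[of q] by (simp add: prod_eq_iff)

lemma momentum_level_gamma:
  assumes z: "z \<in> momentum_level G A \<mu>"
  shows "fst z \<in> carrier G" "\<gamma> (fst z) = z"
proof -
  show q: "fst z \<in> carrier G" using bundleD(1)[OF momentum_level_bundle[OF z]] by (simp add: carrier_eq)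
  show "\<gamma> (fst z) = z" by (rule momentum_level_unique[OF gamma_level[OF q] z fst_gamma[OF q]])
qed

lemma gamma_right_inv:
  "q \<in> carrier G \<Longrightarrow> \<xi> \<in> tangent_space A \<one> \<Longrightarrow> snd (\<gamma> q) (right_inv_vf G A \<xi> q) = \<mu> \<xi>"
  using gamma_level[of q] momentum_map_apply[of \<xi> "\<gamma> q"] fst_gamma[of q] by (simp add: momentum_level_def)

text \<open>Both sides equal \<open>\<mu> \<xi>\<close> for the generator \<open>\<xi>\<close> of
  the right-invariant field passing through \<open>v\<close>.\<close>

lemma gamma_TR:
  assumes q: "q \<in> carrier G" and g: "g \<in> carrier G" and v: "v \<in> tangent_space A q"
  shows "snd (\<gamma> (q \<otimes> g)) (TR g q v) = snd (\<gamma> q) v"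
proof -
  obtain \<xi> where \<xi>: "\<xi> \<in> tangent_space A \<one>" "v = TR q \<one> \<xi>" using TR_surj[OF q v] .
  have "TR g q v = right_inv_vf G A \<xi> (q \<otimes> g)"
    using right_inv_vf_mult[OF q g \<xi>(1)] \<xi>(2) by (simp add: right_inv_vf_def)
  then show ?thesis
    using gamma_right_inv[OF q \<xi>(1)] gamma_right_inv[of "q \<otimes> g" \<xi>] \<xi> q g by (simp add: right_inv_vf_def)
qed

lemma mdiff_gamma: "q \<in> carrier G \<Longrightarrow> mdiff A TA \<gamma> q"
  using one_form gamma_bundle[of q]
  by (intro smooth_map_mdiff[OF diff_atlas_base diff_atlas_cotangent]) (simp_all add: one_form_def carrier_eq mcarrier_cotangent)

definition form_rep :: "('g, 'e) chart \<Rightarrow> 'e \<Rightarrow> 'e" where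
  "form_rep c x = snd (snd (cotangent_chart A c) (\<gamma> (chart_inv c x)))"

abbreviation Dform where "Dform c q \<equiv> frechet_derivative (form_rep c) (at (snd c q))"
abbreviation Dleft where "Dleft c \<xi> q \<equiv> frechet_derivative (left_field c \<xi>) (at (snd c q))"

lemma chart_gamma: "c \<in> charts_at A q \<Longrightarrow> cotangent_chart A c \<in> charts_at TA (\<gamma> q)"
  using cotangent_chart_at[of c "\<gamma> q"] charts_at_carrier[of c q] fst_gamma gamma_covec by simp

lemma gamma_coords: "c \<in> charts_at A q \<Longrightarrow> snd (cotangent_chart A c) (\<gamma> q) = (snd c q, form_rep c (snd c q))"
  using charts_at_carrier[of c q] fst_gamma[of q] charts_atD[of c A q]
  by (simp add: form_rep_def prod_eq_iff chart_inv_eq chart)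

lemma form_rep_has_derivative:
  assumes c: "c \<in> charts_at A q"
  shows "(form_rep c has_derivative Dform c q) (at (snd c q))"
proof -
  have "(snd (cotangent_chart A c) \<circ> \<gamma> \<circ> chart_inv c) differentiable at (snd c q)"
    using mdiffD[OF mdiff_gamma[OF charts_at_carrier[OF c]] c chart_gamma[OF c]] by (simp add: diff_rep_def)
  then obtain D where "((snd (cotangent_chart A c) \<circ> \<gamma> \<circ> chart_inv c) has_derivative D) (at (snd c q))"
    by (auto simp: differentiable_def)
  then have "((\<lambda>x. snd ((snd (cotangent_chart A c) \<circ> \<gamma> \<circ> chart_inv c) x)) has_derivative (\<lambda>h. snd (D h))) (at (snd c q))"
    by (rule has_derivative_snd)
  moreover have "form_rep c = (\<lambda>x. snd ((snd (cotangent_chart A c) \<circ> \<gamma> \<circ> chart_inv c) x))"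
    by (rule ext) (simp add: form_rep_def)
  ultimately show ?thesis by (metis frechet_derivative_eq)
qed

lemma gamma_apply:
  assumes c: "c \<in> charts_at A q" and v: "v \<in> tangent_space A q"
  shows "snd (\<gamma> q) v = form_rep c (snd c q) \<bullet> v c"
  using covec_apply[OF c gamma_covec[OF charts_at_carrier[OF c]] v] gamma_pair[OF charts_at_carrier[OF c]]
    gamma_coords[OF c] by simp

lemma eventually_charts_at: "c \<in> charts_at A q \<Longrightarrow> eventually (\<lambda>x. x \<in> snd c ` fst c) (nhds (snd c q))"
  by (rule eventually_chart[OF chart]) (simp_all add: charts_at_def)

text \<open>The flows of the left-invariant fields are right translations, which preserve \<open>\<gamma>\<close>:
  this is the vanishing of the Lie derivative of \<open>\<gamma>\<close> along \<open>\<zeta>\<close>.\<close>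

lemma Dform_left_field:
  assumes c: "c \<in> charts_at A q" and \<zeta>: "\<zeta> \<in> tangent_space A \<one>"
  shows "Dform c q (left_field c \<zeta> (snd c q)) \<bullet> u = - (form_rep c (snd c q) \<bullet> Dleft c \<zeta> q u)"
proof -
  note q = charts_at_carrier[OF c]
  let ?x = "snd c q"
  \<comment> \<open>The right-invariant field with value \<open>u\<close> at \<open>q\<close>; it
    extends \<open>u\<close> to a field whose pairing with \<open>\<gamma>\<close> is
    constant.\<close>
  obtain \<xi> where \<xi>: "\<xi> \<in> tangent_space A \<one>" "coord_tvec A c q u = TR q \<one> \<xi>"
    using TR_surj[OF q coord_tvec_in[OF diff_atlas_base c]] .
  have u: "right_field c \<xi> ?x = u"
    using arg_cong[OF \<xi>(2), of "\<lambda>v. v c"] by (simp add: right_field_at[OF c] right_inv_vf_def coord_tvec_chart[OF diff_atlas_base c])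
  have "eventually (\<lambda>x. form_rep c x \<bullet> right_field c \<xi> x = \<mu> \<xi>) (nhds ?x)"
    using eventually_charts_at[OF c]
  proof eventually_elim
    case (elim x)
    have c': "c \<in> charts_at A (chart_inv c x)" by (rule charts_at_inv[OF charts_atD(2)[OF c] elim])
    note q' = charts_at_carrier[OF c']
    show ?case
      using gamma_right_inv[OF q' \<xi>(1)] gamma_apply[OF c' right_inv_vf_in[OF q']]
      by (simp add: right_field_def chart_inv_right[OF elim])
  qed
  from frechet_derivative_cong_nhds(1)[OF this]
  have 0: "frechet_derivative (\<lambda>x. form_rep c x \<bullet> right_field c \<xi> x) (at ?x) = (\<lambda>v. 0)" by (simp add: frechet_derivative_const)
  have "((\<lambda>x. form_rep c x \<bullet> right_field c \<xi> x) has_derivative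
      (\<lambda>v. form_rep c ?x \<bullet> frechet_derivative (right_field c \<xi>) (at ?x) v + Dform c q v \<bullet> right_field c \<xi> ?x)) (at ?x)"
    by (intro has_derivative_inner form_rep_has_derivative[OF c] differentiable_has_derivative[OF right_field_differentiable[OF c \<xi>(1)]])
  \<comment> \<open>The derivative of the constant pairing along the field of \<open>\<zeta>\<close>
    vanishes; commuting the two fields turns the derivative of the right-invariant one into
    \<open>Dleft\<close>.\<close>
  from fun_cong[OF trans[OF frechet_derivative_eq[OF this, symmetric] 0], of "left_field c \<zeta> ?x"]
  show ?thesis unfolding left_field_right_field_commute[OF c \<xi>(1) \<zeta>] u by simp
qed

lemma gamma_bracket:
  assumes c: "c \<in> charts_at A q" and \<zeta>: "\<zeta> \<in> tangent_space A \<one>" and \<eta>: "\<eta> \<in> tangent_space A \<one>"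
  shows "reduction_proj G A (\<gamma> q) (bracket G A \<zeta> \<eta>) =
     form_rep c (snd c q) \<bullet> (Dleft c \<eta> q (left_field c \<zeta> (snd c q)) - Dleft c \<zeta> q (left_field c \<eta> (snd c q)))"
  unfolding left_field_bracket[OF c \<zeta> \<eta>]
  using gamma_apply[OF c left_inv_vf_in[OF charts_at_carrier[OF c]]] fst_gamma[OF charts_at_carrier[OF c]]
  by (simp add: reduction_proj_apply bracket_in[OF \<zeta> \<eta>])

text \<open>The product rule for the pairing of \<open>\<gamma>\<close> with the left-invariant
  field of \<open>\<eta>\<close>; the vanishing Lie derivative rewrites the term that differentiates
  \<open>\<gamma>\<close>, and the two terms combine to a bracket.\<close>

lemma gamma_bar_differential:
  assumes q: "q \<in> carrier G" and \<zeta>: "\<zeta> \<in> tangent_space A \<one>"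
  shows "differential A (\<lambda>g. reduction_proj G A (\<gamma> g) \<eta>) q (left_inv_vf G A \<zeta> q) =
     coad G A \<zeta> (reduction_proj G A (\<gamma> q)) \<eta>"
proof (cases "\<eta> \<in> tangent_space A \<one>")
  \<comment> \<open>Dual vectors are extended by 0 off the Lie algebra, so both sides
    vanish.\<close>
  case False
  then show ?thesis
    by (simp add: reduction_proj_apply coad_def lie_algebra_def differential_def o_def frechet_derivative_const)
next
  case \<eta>: True
  define c where "c = chart_at A q"
  have c: "c \<in> charts_at A q" unfolding c_def by (rule chart_at_carrier[OF q])
  let ?x = "snd c q" and ?f = "\<lambda>g. reduction_proj G A (\<gamma> g) \<eta>"
  have ev: "eventually (\<lambda>x. (?f \<circ> chart_inv c) x = form_rep c x \<bullet> left_field c \<eta> x) (nhds ?x)"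
    using eventually_charts_at[OF c]
  proof eventually_elim
    case (elim x)
    have c': "c \<in> charts_at A (chart_inv c x)" by (rule charts_at_inv[OF charts_atD(2)[OF c] elim])
    note q' = charts_at_carrier[OF c']
    show ?case
      using gamma_apply[OF c' left_inv_vf_in[OF q']] \<eta> fst_gamma[OF q']
      by (simp add: reduction_proj_apply left_field_def chart_inv_right[OF elim])
  qed
  have "((\<lambda>x. form_rep c x \<bullet> left_field c \<eta> x) has_derivative (\<lambda>v. form_rep c ?x \<bullet> Dleft c \<eta> q v + Dform c q v \<bullet> left_field c \<eta> ?x)) (at ?x)"
    by (intro has_derivative_inner form_rep_has_derivative[OF c] differentiable_has_derivative[OF left_field_differentiable[OF c \<eta>]])
  note fd = trans[OF frechet_derivative_cong_nhds(1)[OF ev] frechet_derivative_eq[OF this]]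
  have "differential A ?f q (left_inv_vf G A \<zeta> q) =
      frechet_derivative (?f \<circ> chart_inv c) (at ?x) (left_inv_vf G A \<zeta> q c)"
    by (simp add: differential_def c_def)
  also have "\<dots> = form_rep c ?x \<bullet> Dleft c \<eta> q (left_field c \<zeta> ?x) + Dform c q (left_field c \<zeta> ?x) \<bullet> left_field c \<eta> ?x"
    unfolding fd left_field_at[OF c, symmetric] ..
  also have "\<dots> = reduction_proj G A (\<gamma> q) (bracket G A \<zeta> \<eta>)"
    unfolding Dform_left_field[OF c \<zeta>] gamma_bracket[OF c \<zeta> \<eta>] by (simp add: inner_diff_right)
  finally show ?thesis using \<eta> by (simp add: coad_def lie_algebra_def)
qed

text \<open>Left translation by q g at the identity sends \<open>\<eta>\<close> to the left
  translate by q, then right translate by g, of the adjoint image of \<open>\<eta>\<close>;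
  \<open>\<gamma>\<close> ignores the right translation. Hence the orbit map lifts to
  \<open>\<gamma>\<close> along the left translation by q.\<close>

lemma coAd_gamma_bar:
  assumes q: "q \<in> carrier G" and g: "g \<in> carrier G"
  shows "coAd G A g (reduction_proj G A (\<gamma> q)) = reduction_proj G A (\<gamma> (q \<otimes> g))"
proof
  fix \<eta>
  show "coAd G A g (reduction_proj G A (\<gamma> q)) \<eta> = reduction_proj G A (\<gamma> (q \<otimes> g)) \<eta>"
  proof (cases "\<eta> \<in> tangent_space A \<one>")
    case \<eta>: True
    note w = Ad_in[OF g \<eta>]
    have "left_inv_vf G A \<eta> (q \<otimes> g) = TL q g (TL g \<one> \<eta>)"
      using TL_comp[of q g \<one> \<eta>] q g \<eta> by (simp add: left_inv_vf_def)
    also have "\<dots> = TR g q (TL q \<one> (Ad G A g \<eta>))"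
      using TL_TR_commute[of q g \<one> "Ad G A g \<eta>"] TR_Ad[OF g \<eta>] w q g by simp
    finally have "snd (\<gamma> (q \<otimes> g)) (left_inv_vf G A \<eta> (q \<otimes> g)) = snd (\<gamma> q) (TL q \<one> (Ad G A g \<eta>))"
      using gamma_TR[OF q g, of "TL q \<one> (Ad G A g \<eta>)"] TL_in[of q \<one>] q by simp
    then show ?thesis
      using \<eta> w q g fst_gamma[of q] fst_gamma[of "q \<otimes> g"]
      by (simp add: coAd_def lie_algebra_def reduction_proj_apply left_inv_vf_def)
  qed (simp add: coAd_def lie_algebra_def reduction_proj_apply)
qed

end

section \<open>Noether's theorem and the Type I equation\<close>

locale invariant_hamiltonian = momentum_level_form G A E \<gamma> \<mu>
  for G :: "('g, 'b) monoid_scheme" (structure) and A :: "('g, 'e::real_inner) chart set" and E :: "'e set"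
    and \<gamma> :: "'g \<Rightarrow> 'g \<times> ('g, 'e) covec" and \<mu> :: "('g, 'e) covec" +
  fixes H :: "'g \<times> ('g, 'e) covec \<Rightarrow> real"
  assumes smooth_H: "smooth_map (cotangent_atlas A) real_atlas H"
    and invariant_H: "g \<in> carrier G \<Longrightarrow> z \<in> cotangent_bundle A \<Longrightarrow> H (cotangent_lift G A g z) = H z"
begin

lemma mdiff_H: "z \<in> cotangent_bundle A \<Longrightarrow> mdiff TA real_atlas H z"
  by (rule smooth_map_mdiff[OF diff_atlas_cotangent diff_atlas_real smooth_H]) (simp_all add: mcarrier_cotangent del: mem_Sigma_iff)

text \<open>Noether's theorem: at a point of the level set the Hamiltonian vector field is tangent to
  the image of \<open>\<gamma>\<close>.\<close>

lemma hamiltonian_vf_gamma: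
  assumes q: "q \<in> carrier G"
  obtains c \<zeta> where "c \<in> charts_at A q" "\<zeta> \<in> tangent_space A \<one>"
    "hamiltonian_vf A H (\<gamma> q) = (\<gamma> q, coord_tvec TA (cotangent_chart A c) (\<gamma> q)
       (left_field c \<zeta> (snd c q), Dform c q (left_field c \<zeta> (snd c q))))"
    "\<And>u w. frechet_derivative (H \<circ> chart_inv (cotangent_chart A c)) (at (snd c q, form_rep c (snd c q))) (u, w) =
       w \<bullet> left_field c \<zeta> (snd c q) + form_rep c (snd c q) \<bullet> Dleft c \<zeta> q u"
proof -
  note z = gamma_bundle[OF q]
  obtain c where c': "c \<in> charts_at A (fst (\<gamma> q))" "chart_at TA (\<gamma> q) = cotangent_chart A c"
    using chart_at_cotangent[OF z] by blast
  have c: "c \<in> charts_at A q" using c' fst_gamma[OF q] by simp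
  obtain \<zeta> where \<zeta>: "\<zeta> \<in> tangent_space A \<one>"
    "\<And>u w. frechet_derivative (H \<circ> chart_inv (cotangent_chart A c)) (at (snd c q, form_rep c (snd c q))) (u, w) =
       w \<bullet> left_field c \<zeta> (snd c q) + form_rep c (snd c q) \<bullet> Dleft c \<zeta> q u"
    using invariant_hamiltonian_derivative[OF invariant_H mdiff_H c, of "form_rep c (snd c q)"] by blast
  have "hamiltonian_vf A H (\<gamma> q) = (\<gamma> q, coord_tvec TA (cotangent_chart A c) (\<gamma> q)
       (left_field c \<zeta> (snd c q), Dform c q (left_field c \<zeta> (snd c q))))"
    \<comment> \<open>The momentum equation has right-hand side minus the pairing with
      \<open>Dleft\<close>; \<open>Dform_left_field\<close> identifies it with the derivative of
      \<open>\<gamma>\<close> along the field.\<close>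
    by (rule hamiltonian_vf_coords[OF z mdiff_H[OF z] c'])
       (simp only: gamma_coords[OF c] \<zeta>(2) Dform_left_field[OF c \<zeta>(1)] inner_commute[of _ "left_field c \<zeta> (snd c q)"]
          diff_minus_eq_add)
  with c \<zeta> that show ?thesis by blast
qed

lemma eventually_cotangent_chart:
  assumes c: "c \<in> charts_at A q"
  shows "eventually (\<lambda>y. y \<in> snd c ` fst c \<times> UNIV) (nhds (snd c q, p))"
  using charts_atD[OF c] chart[of c] by (intro eventually_nhds_in_open open_Times) (auto simp: is_chart_def)

text \<open>In the bundle chart the map forgets the momentum and reinserts that of
  \<open>\<gamma>\<close>, so its derivative fixes the vectors tangent to the graph of
  \<open>form_rep\<close>, and the Hamiltonian vector is one of them.\<close>

lemma tangent_map_lambda: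
  assumes q: "q \<in> carrier G"
  shows "tangent_map TA TA (\<gamma> \<circ> fst) (hamiltonian_vf A H (\<gamma> q)) = hamiltonian_vf A H (\<gamma> q)"
proof -
  obtain c \<zeta> where c: "c \<in> charts_at A q" and \<zeta>: "\<zeta> \<in> tangent_space A \<one>"
    and X: "hamiltonian_vf A H (\<gamma> q) = (\<gamma> q, coord_tvec TA (cotangent_chart A c) (\<gamma> q)
       (left_field c \<zeta> (snd c q), Dform c q (left_field c \<zeta> (snd c q))))"
    using hamiltonian_vf_gamma[OF q] by metis
  let ?C = "cotangent_chart A c" and ?x = "snd c q"
  let ?V = "coord_tvec TA ?C (\<gamma> q) (left_field c \<zeta> ?x, Dform c q (left_field c \<zeta> ?x))"
  note C = chart_gamma[OF c]
  note V = coord_tvec_in[OF diff_atlas_cotangent C, of "(left_field c \<zeta> ?x, Dform c q (left_field c \<zeta> ?x))"]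
  have md: "mdiff TA TA (\<gamma> \<circ> fst) (\<gamma> q)"
    by (rule mdiff_comp[OF diff_atlas_cotangent diff_atlas_base diff_atlas_cotangent mdiff_fst[OF gamma_bundle[OF q]]]) (simp add: fst_gamma[OF q] mdiff_gamma[OF q])
  have fixed: "(\<gamma> \<circ> fst) (\<gamma> q) = \<gamma> q" by (simp add: fst_gamma[OF q])
  have ev: "eventually (\<lambda>y. (snd ?C \<circ> (\<gamma> \<circ> fst) \<circ> chart_inv ?C) y = (fst y, form_rep c (fst y))) (nhds (?x, form_rep c ?x))"
    using eventually_cotangent_chart[OF c]
  proof eventually_elim
    case (elim y)
    then have y: "fst y \<in> snd c ` fst c" by auto
    have c': "c \<in> charts_at A (chart_inv c (fst y))" by (rule charts_at_inv[OF charts_atD(2)[OF c] y])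
    show ?case
      using cotangent_chart_inv[OF charts_atD(2)[OF c] y, of "snd y"] gamma_coords[OF c']
      by (simp add: chart_inv_right[OF y])
  qed
  have "(form_rep c has_derivative Dform c q) (at (fst (?x, form_rep c ?x)))" using form_rep_has_derivative[OF c] by simp
  from diff_chain_at[OF bounded_linear_imp_has_derivative[OF bounded_linear_fst] this]
  have "((\<lambda>y. form_rep c (fst y)) has_derivative (\<lambda>h. Dform c q (fst h))) (at (?x, form_rep c ?x))" by (simp add: o_def)
  then have "((\<lambda>y. (fst y, form_rep c (fst y))) has_derivative (\<lambda>h. (fst h, Dform c q (fst h)))) (at (?x, form_rep c ?x))"
    by (intro has_derivative_Pair bounded_linear_imp_has_derivative[OF bounded_linear_fst])
  note fd = trans[OF frechet_derivative_cong_nhds(1)[OF ev] frechet_derivative_eq[OF this]]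
  have "snd (tangent_map TA TA (\<gamma> \<circ> fst) (\<gamma> q, ?V)) = ?V"
  proof (rule tangent_space_eqI[OF C _ V])
    show "snd (tangent_map TA TA (\<gamma> \<circ> fst) (\<gamma> q, ?V)) \<in> tangent_space TA (\<gamma> q)"
      using tangent_map_in[OF diff_atlas_cotangent diff_atlas_cotangent md] unfolding fixed .
    show "snd (tangent_map TA TA (\<gamma> \<circ> fst) (\<gamma> q, ?V)) ?C = ?V ?C"
      using tangent_map_rep[OF diff_atlas_cotangent md V C, of ?C] C
      unfolding fixed gamma_coords[OF c] fd by (simp add: coord_tvec_chart[OF diff_atlas_cotangent C])
  qed
  then show ?thesis unfolding X by (simp add: prod_eq_iff fst_gamma[OF q])
qed

lemma type_I:
  assumes q: "q \<in> carrier G" and h: "\<And>z. z \<in> momentum_level G A \<mu> \<Longrightarrow> h (reduction_proj G A z) = H z"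
  shows "tangent_map_dual A (reduction_proj G A \<circ> \<gamma>) (tangent_map TA A fst (hamiltonian_vf A H (\<gamma> q))) =
     orbit_hamiltonian_vf G A h (reduction_proj G A (\<gamma> q))"
proof -
  obtain c \<zeta> where c: "c \<in> charts_at A q" and \<zeta>: "\<zeta> \<in> tangent_space A \<one>"
    and X: "hamiltonian_vf A H (\<gamma> q) = (\<gamma> q, coord_tvec TA (cotangent_chart A c) (\<gamma> q)
       (left_field c \<zeta> (snd c q), Dform c q (left_field c \<zeta> (snd c q))))"
    and dH: "\<And>u w. frechet_derivative (H \<circ> chart_inv (cotangent_chart A c)) (at (snd c q, form_rep c (snd c q))) (u, w) =
       w \<bullet> left_field c \<zeta> (snd c q) + form_rep c (snd c q) \<bullet> Dleft c \<zeta> q u"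
    using hamiltonian_vf_gamma[OF q] by metis
  let ?C = "cotangent_chart A c" and ?x = "snd c q" and ?\<nu> = "reduction_proj G A (\<gamma> q)"
  let ?V = "coord_tvec TA ?C (\<gamma> q) (left_field c \<zeta> ?x, Dform c q (left_field c \<zeta> ?x))"
  note z = gamma_bundle[OF q] and C = chart_gamma[OF c]
  note V = coord_tvec_in[OF diff_atlas_cotangent C, of "(left_field c \<zeta> ?x, Dform c q (left_field c \<zeta> ?x))"]
  have c': "c \<in> charts_at A (fst (\<gamma> q))" using c fst_gamma[OF q] by simp
  have "snd (tangent_map TA A fst (\<gamma> q, ?V)) = left_inv_vf G A \<zeta> q"
  proof (rule tangent_space_eqI[OF c _ left_inv_vf_in[OF q]])
    show "snd (tangent_map TA A fst (\<gamma> q, ?V)) \<in> tangent_space A q"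
      using tangent_map_in[OF diff_atlas_cotangent diff_atlas_base mdiff_fst[OF z]] unfolding fst_gamma[OF q] .
    show "snd (tangent_map TA A fst (\<gamma> q, ?V)) c = left_inv_vf G A \<zeta> q c"
      unfolding tangent_map_fst[OF z c' V] coord_tvec_chart[OF diff_atlas_cotangent C] left_field_at[OF c, symmetric] by simp
  qed
  then have T: "tangent_map TA A fst (hamiltonian_vf A H (\<gamma> q)) = (q, left_inv_vf G A \<zeta> q)"
    unfolding X by (simp add: prod_eq_iff fst_gamma[OF q])
  have lhs: "tangent_map_dual A (reduction_proj G A \<circ> \<gamma>) (q, left_inv_vf G A \<zeta> q) = (?\<nu>, coad G A \<zeta> ?\<nu>)"
    by (simp add: tangent_map_dual_def gamma_bar_differential[OF q \<zeta>])
  have "orbit_hamiltonian_vf G A h ?\<nu> = (?\<nu>, coad G A \<zeta> ?\<nu>)"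
  proof (rule orbit_hamiltonian_vf_eq[OF reduction_proj_in[OF z] \<zeta>])
    fix \<eta> assume \<eta>: "\<eta> \<in> tangent_space A \<one>"
    let ?F = "H \<circ> \<gamma>"
    have one: "\<one> \<in> mcarrier A" by (simp add: carrier_eq)
    have mF: "mdiff A real_atlas ?F q" by (rule mdiff_comp[OF diff_atlas_base diff_atlas_cotangent diff_atlas_real mdiff_gamma[OF q] mdiff_H[OF z]])
    have ltq: "left_trans G q \<one> = q" using q by (simp add: left_trans_def)
    \<comment> \<open>By \<open>coAd_gamma_bar\<close>, the reduced Hamiltonian along the orbit map
      is \<open>H\<close> along \<open>\<gamma>\<close> at the points q g, so its differential can
      be computed on G.\<close>
    have "differential A (\<lambda>g. h (coAd G A g ?\<nu>)) \<one> \<eta> = differential A (?F \<circ> left_trans G q) \<one> \<eta>"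
    proof (rule differential_cong[OF diff_atlas_base one])
      fix g assume "g \<in> mcarrier A"
      then have g: "g \<in> carrier G" by (simp add: carrier_eq)
      show "h (coAd G A g ?\<nu>) = (?F \<circ> left_trans G q) g"
        using h[OF gamma_level, of "q \<otimes> g"] coAd_gamma_bar[OF q g] q g by (simp add: left_trans_def)
    qed
    also have "\<dots> = differential A ?F q (left_inv_vf G A \<eta> q)"
      using differential_comp[OF diff_atlas_base diff_atlas_base mdiff_left_trans[OF q one_closed] _ \<eta>, of ?F] mF
      unfolding ltq left_inv_vf_def by blast
    also have "\<dots> = frechet_derivative (?F \<circ> chart_inv c) (at ?x) (left_field c \<eta> ?x)"
      unfolding differential_rep[OF diff_atlas_base c left_inv_vf_in[OF q] mF] left_field_at[OF c] ..
    \<comment> \<open>The chain rule along the graph of \<open>form_rep\<close>, with the derivative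
      of \<open>H\<close> expressed through \<open>\<zeta>\<close>.\<close>
    also have "\<dots> = Dform c q (left_field c \<eta> ?x) \<bullet> left_field c \<zeta> ?x + form_rep c ?x \<bullet> Dleft c \<zeta> q (left_field c \<eta> ?x)"
    proof -
      let ?Hc = "H \<circ> chart_inv ?C"
      have dHc: "?Hc differentiable at (?x, form_rep c ?x)"
        using mdiff_real_differentiable[OF mdiff_H[OF z] C] unfolding gamma_coords[OF c] .
      have "((\<lambda>x. (x, form_rep c x)) has_derivative (\<lambda>v. (v, Dform c q v))) (at ?x)"
        by (intro has_derivative_Pair has_derivative_ident form_rep_has_derivative[OF c])
      from diff_chain_at[OF this differentiable_has_derivative[OF dHc]]
      have 1: "((\<lambda>x. ?Hc (x, form_rep c x)) has_derivative (\<lambda>v. frechet_derivative ?Hc (at (?x, form_rep c ?x)) (v, Dform c q v))) (at ?x)"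
        by (simp add: o_def)
      have ev: "eventually (\<lambda>x. (?F \<circ> chart_inv c) x = ?Hc (x, form_rep c x)) (nhds ?x)"
        using eventually_charts_at[OF c]
      proof eventually_elim
        case (elim x)
        have cx: "c \<in> charts_at A (chart_inv c x)" by (rule charts_at_inv[OF charts_atD(2)[OF c] elim])
        have "chart_inv ?C (snd ?C (\<gamma> (chart_inv c x))) = \<gamma> (chart_inv c x)"
          by (rule chart_inv_eq[OF diff_atlas_chart[OF diff_atlas_cotangent chart_gamma[OF cx]] charts_atD(1)[OF chart_gamma[OF cx]]])
        then show ?case unfolding gamma_coords[OF cx] chart_inv_right[OF elim] by simp
      qed
      show ?thesis unfolding frechet_derivative_cong_nhds(1)[OF ev] frechet_derivative_eq[OF 1] dH ..
    qed
    \<comment> \<open>The Lie derivative identity is used here for \<open>\<eta>\<close>, the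
      direction of differentiation, and leaves the commutator with \<open>\<zeta>\<close>.\<close>
    also have "\<dots> = - ?\<nu> (bracket G A \<zeta> \<eta>)"
      unfolding Dform_left_field[OF c \<eta>] gamma_bracket[OF c \<zeta> \<eta>] by (simp add: inner_diff_right)
    finally show "differential A (\<lambda>g. h (coAd G A g ?\<nu>)) \<one> \<eta> = - ?\<nu> (bracket G A \<zeta> \<eta>)" .
  qed
  then show ?thesis unfolding T lhs by simp
qed

end

theorem theorem5p1:
  fixes G :: "('g, 'b) monoid_scheme"
    and A :: "('g, 'e::real_inner) chart set"
    and H :: "'g \<times> ('g, 'e) covec \<Rightarrow> real"
    and \<gamma> :: "'g \<Rightarrow> 'g \<times> ('g, 'e) covec"
    and \<epsilon> :: "'g \<times> ('g, 'e) covec \<Rightarrow> 'g \<times> ('g, 'e) covec"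
    and \<mu> :: "('g, 'e) covec"
    and h_mu :: "('g, 'e) covec \<Rightarrow> real"
  assumes "lie_group G A"
    and "smooth_map (cotangent_atlas A) real_atlas H"
    and "\<forall>g\<in>carrier G. \<forall>z\<in>cotangent_bundle A. H (cotangent_lift G A g z) = H z"
    and "one_form A \<gamma>"
    and "symplectic_map A \<epsilon>"
    and "\<mu> \<in> lie_algebra_dual G A" and "regular_value G A \<mu>"
    and "\<gamma> ` carrier G \<subseteq> momentum_level G A \<mu>"
    and "\<forall>g\<in>isotropy_group G A \<mu>. \<forall>q\<in>carrier G. \<gamma> (g \<otimes>\<^bsub>G\<^esub> q) = cotangent_lift G A g (\<gamma> q)"
    and "\<forall>g\<in>isotropy_group G A \<mu>. \<forall>z\<in>cotangent_bundle A.
           \<epsilon> (cotangent_lift G A g z) = cotangent_lift G A g (\<epsilon> z)"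
    and "\<epsilon> ` momentum_level G A \<mu> \<subseteq> momentum_level G A \<mu>"
    and "\<forall>z\<in>momentum_level G A \<mu>. h_mu (reduction_proj G A z) = H z"
  shows
    "let T_pi = tangent_map (cotangent_atlas A) A fst;
         T_pi_mu = tangent_map_dual (cotangent_atlas A) (reduction_proj G A);
         T_eps = tangent_map (cotangent_atlas A) (cotangent_atlas A) \<epsilon>;
         lam = \<gamma> \<circ> fst;
         T_lam = tangent_map (cotangent_atlas A) (cotangent_atlas A) lam;
         gamma_bar = reduction_proj G A \<circ> \<gamma>;
         T_gamma_bar = tangent_map_dual A gamma_bar;
         eps_bar = reduction_proj G A \<circ> \<epsilon>;
         X_H = hamiltonian_vf A H;
         X_H_gamma = T_pi \<circ> X_H \<circ> \<gamma>;
         X_H_eps = T_pi \<circ> X_H \<circ> \<epsilon>;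
         X_h_mu = orbit_hamiltonian_vf G A h_mu;
         X_h_eps_bar = hamiltonian_vf A (H \<circ> \<epsilon>)
     in (closed_wrt_Tpi A \<gamma> \<longrightarrow>
           (\<forall>g\<in>carrier G. (T_gamma_bar \<circ> X_H_gamma) g = (X_h_mu \<circ> gamma_bar) g)) \<and>
        ((\<forall>z\<in>momentum_level G A \<mu>. (T_gamma_bar \<circ> X_H_eps) z = (X_h_mu \<circ> eps_bar) z) \<longleftrightarrow>
         (\<forall>z\<in>momentum_level G A \<mu>.
            (T_pi_mu \<circ> T_eps \<circ> X_h_eps_bar) z = (T_pi_mu \<circ> T_lam \<circ> X_H \<circ> \<epsilon>) z))"
proof -
  interpret lie_group G A by fact
  obtain B :: "'e set" where B: "finite B" "span B = UNIV" using manifold by (auto simp: smooth_manifold_def)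
  obtain E :: "'e set" where E: "expansion_basis E" using expansion_basis_exists[OF B] by blast
  have atlas: "smooth_atlas A" using manifold by (simp add: smooth_manifold_def)
  have H_inv: "H (cotangent_lift G A g z) = H z" if "g \<in> carrier G" "z \<in> cotangent_bundle A" for g z
    using assms(3) that by blast
  interpret invariant_hamiltonian G A E \<gamma> \<mu> H
    by unfold_locales (fact atlas E assms(2,4,8) | rule H_inv; assumption)+
  have h: "h_mu (reduction_proj G A z) = H z" if "z \<in> momentum_level G A \<mu>" for z
    using assms(12) that by blast
  note I = type_I[OF _ h]
  \<comment> \<open>\<open>\<epsilon>\<close> preserves the level set, which is the image of
    \<open>\<gamma>\<close>; the Type I identity at the base point of \<open>\<epsilon> z\<close>
    then applies.\<close>
  have \<epsilon>: "fst (\<epsilon> z) \<in> carrier G" "\<gamma> (fst (\<epsilon> z)) = \<epsilon> z" if "z \<in> momentum_level G A \<mu>" for z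
    using momentum_level_gamma[of "\<epsilon> z"] assms(11) that by blast+
  have II: "tangent_map_dual A (reduction_proj G A \<circ> \<gamma>) (tangent_map TA A fst (hamiltonian_vf A H (\<epsilon> z))) =
      orbit_hamiltonian_vf G A h_mu (reduction_proj G A (\<epsilon> z))" if z: "z \<in> momentum_level G A \<mu>" for z
    using I[OF \<epsilon>(1)[OF z]] unfolding \<epsilon>(2)[OF z] .
  \<comment> \<open>Both vectors equal the Hamiltonian vector of \<open>H\<close> at
    \<open>\<epsilon> z\<close>, so they agree before projection to the orbit.\<close>
  have "tangent_map TA TA \<epsilon> (hamiltonian_vf A (H \<circ> \<epsilon>) z) = tangent_map TA TA (\<gamma> \<circ> fst) (hamiltonian_vf A H (\<epsilon> z))"
    if z: "z \<in> momentum_level G A \<mu>" for z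
  proof -
    have \<epsilon>z: "\<epsilon> z \<in> cotangent_bundle A" using gamma_bundle[OF \<epsilon>(1)[OF z]] unfolding \<epsilon>(2)[OF z] .
    show ?thesis
      using tangent_map_lambda[OF \<epsilon>(1)[OF z]]
        symplectic_map_hamiltonian_vf[OF assms(5) momentum_level_bundle[OF z] \<epsilon>z mdiff_H[OF \<epsilon>z]]
      unfolding \<epsilon>(2)[OF z] by simp
  qed
  \<comment> \<open>Both sides of the Type II equivalence hold at every point of the level
    set.\<close>
  with I II show ?thesis unfolding Let_def o_apply by simp
qed

end
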